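(* Let $(X_i,Y_i)_{i\ge1}$ be i.i.d. random vectors in $\mathbb{R}^2$ with joint c.d.f. $H$ and equal marginal c.d.f.s $F=G$ with support $\mathbb{R}$. Assume that $F\in C^2(\mathbb{R})$, $f=F'>0$ on $\mathbb{R}$, and that $h_X=f\circ F^{-1}$ satisfies $$\sup_{0<u<1}\min(u,1-u)\,|(\log h_X)'(u)|<\infty,$$ $$\lim_{u\to0}\frac{u}{h_X(u)}=\lim_{u\to1}\frac{1-u}{h_X(u)}=0,\qquad\int_0^1\frac{u(1-u)}{h_X^2(u)}\,du<\infty.$$ Let $c(x,y)=\rho_c(x-y)$, where $\rho_c:\mathbb{R}\to[0,\infty)$ is convex and, for some $x_0>0$, $\rho_c(x)=x^2$ for all $|x|\le x_0$. Then, as $n\to\infty$, $$n\,W_c(\mathbb{F}_n,\mathbb{G}_n)\longrightarrow_{weak}\int_0^1\mathbb{B}(u)^2\,du.$$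
   Context: $\mathbb{F}_n,\mathbb{G}_n$ are the empirical c.d.f.s of $X_1,\dots,X_n$ and $Y_1,\dots,Y_n$, $F^{-1}$ is the generalized inverse, and $W_c(\mathbb{F}_n,\mathbb{G}_n)=\int_0^1c(\mathbb{F}_n^{-1}(u),\mathbb{G}_n^{-1}(u))du=\frac1n\sum_{i=1}^nc(X_{(i)},Y_{(i)})$ with order statistics. Limit process: $(B^X,B^Y)$ is a jointly centered Gaussian process on $(0,1)$ such that $B^X,B^Y$ are standard Brownian bridges and $\mathrm{cov}(B^X(u),B^Y(v))=H(F^{-1}(u),G^{-1}(v))-uv$; $h_Y=G'\circ G^{-1}$ ($=h_X$ here); $\mathbb{B}(u)=B^X(u)/h_X(u)-B^Y(u)/h_Y(u)$. $\to_{weak}$ is convergence in distribution. *)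

theory Defs
  imports "HOL-Probability.Probability"
begin

definition gen_inverse :: "(real \<Rightarrow> real) \<Rightarrow> real \<Rightarrow> real" where
  "gen_inverse F u = Inf {x. u \<le> F x}"

definition density_quantile :: "(real \<Rightarrow> real) \<Rightarrow> real \<Rightarrow> real" where
  "density_quantile F = deriv F \<circ> gen_inverse F"

text \<open>Samples are indexed from 1, so the empirical c.d.f. uses the indices 1, ..., n.\<close>

definition empirical_cdf :: "(nat \<Rightarrow> 'a \<Rightarrow> real) \<Rightarrow> nat \<Rightarrow> 'a \<Rightarrow> real \<Rightarrow> real" where
  "empirical_cdf X n \<omega> x = real (card {i \<in> {1..n}. X i \<omega> \<le> x}) / real n"

definition wasserstein_cost ::
    "(real \<Rightarrow> real \<Rightarrow> real) \<Rightarrow> (real \<Rightarrow> real) \<Rightarrow> (real \<Rightarrow> real) \<Rightarrow> real" where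
  "wasserstein_cost c F G = (LBINT u:{0<..<1}. c (gen_inverse F u) (gen_inverse G u))"

text \<open>Closed support of a Borel measure.\<close>

definition measure_support :: "'a::topological_space measure \<Rightarrow> 'a set" where
  "measure_support \<mu> = {x. \<forall>U. open U \<and> x \<in> U \<longrightarrow> emeasure \<mu> U > 0}"

text \<open>Normal laws are the laws of \<open>m + s N\<close> with \<open>N\<close> standard normal; point masses
  (\<open>s = 0\<close>) are included, as is needed for Gaussian processes.\<close>

definition normal_rv :: "'b measure \<Rightarrow> ('b \<Rightarrow> real) \<Rightarrow> bool" where
  "normal_rv N Z \<longleftrightarrow> Z \<in> borel_measurable N \<and>
     (\<exists>m s. distr N borel Z = distr std_normal_distribution borel (\<lambda>x. m + s * x))"

definition gaussian_process :: "'b measure \<Rightarrow> 'i set \<Rightarrow> ('i \<Rightarrow> 'b \<Rightarrow> real) \<Rightarrow> bool" where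
  "gaussian_process N T B \<longleftrightarrow>
     (\<forall>S a. finite S \<and> S \<subseteq> T \<longrightarrow> normal_rv N (\<lambda>\<omega>. \<Sum>t\<in>S. a t * B t \<omega>))"

definition centered_process :: "'b measure \<Rightarrow> 'i set \<Rightarrow> ('i \<Rightarrow> 'b \<Rightarrow> real) \<Rightarrow> bool" where
  "centered_process N T B \<longleftrightarrow>
     (\<forall>t\<in>T. integrable N (B t) \<and> integral\<^sup>L N (B t) = 0)"

definition covariance :: "'b measure \<Rightarrow> ('b \<Rightarrow> real) \<Rightarrow> ('b \<Rightarrow> real) \<Rightarrow> real" where
  "covariance N Z W =
     (LINT \<omega>|N. (Z \<omega> - integral\<^sup>L N Z) * (W \<omega> - integral\<^sup>L N W))"

text \<open>The bridge is indexed by the open unit interval; the limits 0 at the end points hold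
  almost surely as a consequence.\<close>

definition brownian_bridge :: "'b measure \<Rightarrow> (real \<Rightarrow> 'b \<Rightarrow> real) \<Rightarrow> bool" where
  "brownian_bridge N B \<longleftrightarrow>
     gaussian_process N {0<..<1} B \<and> centered_process N {0<..<1} B \<and>
     (\<forall>u\<in>{0<..<1}. \<forall>v\<in>{0<..<1}. covariance N (B u) (B v) = min u v - u * v) \<and>
     (\<forall>\<omega>\<in>space N. continuous_on {0<..<1} (\<lambda>u. B u \<omega>))"

text \<open>Two processes are jointly Gaussian if the process on the disjoint union of the index
  sets is Gaussian.\<close>

definition jointly_centered_gaussian ::
    "'b measure \<Rightarrow> 'i set \<Rightarrow> ('i \<Rightarrow> 'b \<Rightarrow> real) \<Rightarrow> ('i \<Rightarrow> 'b \<Rightarrow> real) \<Rightarrow> bool" where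
  "jointly_centered_gaussian N T B C \<longleftrightarrow>
     gaussian_process N (T <+> T) (case_sum B C) \<and> centered_process N (T <+> T) (case_sum B C)"

end

theory Submission imports Defs begin

text \<open>Let \<open>Q\<close> be the \<open>n\<close>-fold cost. Weak convergence of nonnegative variables follows from convergence of
  Laplace transforms, so it suffices to study \<open>E exp (- \<lambda> Q)\<close>.

  Write \<open>a\<close>, \<open>b\<close> for the two empirical distribution functions. With high probability
  \<open>a x \<le> b (x + x\<^sub>0)\<close> and \<open>b x \<le> a (x + x\<^sub>0)\<close> for all \<open>x\<close>; then the two quantile functions
  differ by at most \<open>x\<^sub>0\<close>, only the quadratic part of the cost is seen, and \<open>Q\<close> is \<open>2 n\<close> times the integral over \<open>x < y\<close> of
  \<open>max 0 (a x - b y) + max 0 (b x - a y)\<close>. On \<open>- L \<le> x \<le> L\<close> the substitution \<open>y = x + r / sqrt n\<close>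
  replaces \<open>sqrt n (a x - b y)\<close> by \<open>D x - f x r\<close>, where \<open>D = sqrt n (a - b)\<close>, and integrating over
  \<open>r > 0\<close> yields the integral of \<open>D\<^sup>2 / f\<close> over \<open>[- L, L]\<close>.
  Uniformly in \<open>n\<close>, the tails contribute little with high probability: there \<open>a / F\<close> and \<open>b / F\<close> are bounded from both sides
  by Chernoff's inequality, the condition on \<open>(log h)'\<close> makes \<open>f\<close> comparable at points with comparable
  values of \<open>F\<close>, and the tails are dominated by the integral of \<open>n ((a - F)\<^sup>2 + (b - F)\<^sup>2) / f\<close>,
  whose mean is at most \<open>2\<close> times the integral of \<open>F (1 - F) / f\<close>.

  For fixed \<open>L\<close>, a Riemann sum reduces the Laplace transform of the integral of \<open>D\<^sup>2 / f\<close> to finitely many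
  points, with an error that is uniform in \<open>n\<close>. There
  \<open>exp (- \<lambda> d\<^sup>2) = E exp (i sqrt (2 \<lambda>) d \<xi>)\<close> with \<open>\<xi>\<close> standard normal turns it into an average of
  characteristic functions of linear combinations of \<open>D\<close>, to which the
  one-dimensional central limit theorem applies. The substitution \<open>u = F x\<close> identifies the limit.\<close>

text \<open>The levels \<open>u\<close> at which one quantile function is at most \<open>x\<close>
  and the other exceeds \<open>y > x\<close> form an interval of length
  \<open>max 0 (a x - b y)\<close>. Writing a squared gap as twice the area of a triangle and
  exchanging integrals therefore removes the quantile functions. What remains depends on
  \<open>a\<close> and \<open>b\<close> pointwise, so second moments at fixed points and Fubini take
  the place of a strong approximation.

  The obstacle is the region \<open>F < K / n\<close>. There \<open>b\<close> may vanish,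
  \<open>b / F\<close> has no bound from below, and the comparison with
  \<open>n (b - F)^2 / f\<close> breaks down. The crude bound \<open>a <= K F\<close> and two uses
  of \<open>F <= \<epsilon> f\<close> show that this region contributes at most
  \<open>K^2 \<epsilon>^2\<close> even after multiplication by \<open>n\<close>; the limits of
  \<open>u / h\<close> and \<open>(1 - u) / h\<close> make \<epsilon> small. By the same limits
  \<open>F\<close> grows by a factor \<open>K^2\<close> over any given distance far out in the tail,
  which separates \<open>a\<close> and \<open>b\<close> where the law of large numbers gives no
  uniform control.

  The constants are chosen in the order \<eta>, \<open>K\<close>, \<epsilon>, \<open>L\<close>,
  \<open>n\<close>; neither \<open>K\<close> nor \<open>L\<close> depends on
  \<open>n\<close>.\<close>

section \<open>Laplace transforms\<close>

text \<open>In terms of \<open>z = exp (- Q)\<close> the assumption is convergence of all moments, and polynomials are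
  dense in the continuous functions on \<open>[0, 1]\<close>.\<close>
lemma laplace_weak_conv:
  fixes Q :: "nat \<Rightarrow> 'a \<Rightarrow> real" and R :: "'b \<Rightarrow> real"
  assumes M: "prob_space M" and N: "prob_space N"
    and Q [measurable]: "\<And>n. Q n \<in> borel_measurable M" and R [measurable]: "R \<in> borel_measurable N"
    and Q0: "\<And>n \<omega>. \<omega> \<in> space M \<Longrightarrow> 0 \<le> Q n \<omega>" and R0: "\<And>\<omega>. \<omega> \<in> space N \<Longrightarrow> 0 \<le> R \<omega>"
    and lim: "\<And>k::nat. (\<lambda>n. LINT \<omega>|M. exp (- (real k * Q n \<omega>))) \<longlonglongrightarrow> (LINT \<omega>|N. exp (- (real k * R \<omega>)))"
  shows "weak_conv_m (\<lambda>n. distr M borel (Q n)) (distr N borel R)"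
proof -
  interpret M: prob_space M by fact
  interpret N: prob_space N by fact
  have rdM: "real_distribution (distr M borel (Q n))" for n
    using M.real_distribution_distr[OF Q] by simp
  have rdN: "real_distribution (distr N borel R)"
    using N.real_distribution_distr[OF R] by simp
  have iM: "integrable M (\<lambda>\<omega>. exp (- (real k * Q n \<omega>)))" for k n
    by (rule M.integrable_const_bound[of _ 1]) (auto intro!: AE_I2 mult_nonneg_nonneg Q0)
  have iN: "integrable N (\<lambda>\<omega>. exp (- (real k * R \<omega>)))" for k
    by (rule N.integrable_const_bound[of _ 1]) (auto intro!: AE_I2 mult_nonneg_nonneg R0)
  have "(\<lambda>n. integral\<^sup>L (distr M borel (Q n)) (cts_step x y)) \<longlonglongrightarrow> integral\<^sup>L (distr N borel R) (cts_step x y)"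
    if xy: "x < y" for x y
  proof -
    have [measurable]: "cts_step x y \<in> borel_measurable borel"
      unfolding cts_step_def[abs_def] by measurable
    \<comment> \<open>In the variable \<open>z = exp (- r)\<close> the step function vanishes for
      \<open>z <= exp (- y)\<close>, so it extends by 0 to a continuous function on the compact
      interval [0, 1], where polynomials are dense.\<close>
    define g where "g z = (if z \<le> 0 then 0 else cts_step x y (- ln z))" for z
    have contg: "continuous_on {0..1} g"
    proof -
      have c1: "continuous_on UNIV (cts_step x y)"
        using cts_step_uniformly_continuous[OF xy] uniformly_continuous_imp_continuous by blast
      have "isCont g z" for z
      proof (cases "z < exp (-y)")
        case True
        have "g w = 0" if "w < exp (-y)" for w
        proof -
          have "y < - ln w" if "w > 0" using \<open>w < exp (-y)\<close> that ln_less_cancel_iff[of w "exp (-y)"]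
            by simp
          thus ?thesis using xy by (cases "w > 0") (auto simp: g_def cts_step_def)
        qed
        hence "eventually (\<lambda>w. g w = 0) (nhds z)"
          using True by (intro eventually_nhds_in_open[of "{..<exp(-y)}", THEN eventually_mono]) auto
        thus ?thesis
          using isCont_cong[of g "\<lambda>_. 0" z] by simp
      next
        case False
        hence z: "z > 0" by (meson exp_gt_zero less_le_trans not_less)
        have "eventually (\<lambda>w. g w = cts_step x y (- ln w)) (nhds z)"
          using z by (intro eventually_nhds_in_open[of "{0<..}", THEN eventually_mono]) (auto simp: g_def)
        moreover have "isCont (\<lambda>w. cts_step x y (- ln w)) z"
        proof (rule isCont_o2[where f="\<lambda>w. - ln w" and g="cts_step x y"])
          show "isCont (\<lambda>w. - ln w) z" using z by (intro isCont_minus isCont_ln) auto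
          show "isCont (cts_step x y) (- ln z)" using c1 by (simp add: continuous_on_eq_continuous_at)
        qed
        ultimately show ?thesis
          using isCont_cong[of g "\<lambda>w. cts_step x y (- ln w)" z] by simp
      qed
      thus ?thesis by (simp add: continuous_at_imp_continuous_on)
    qed
    have gQ: "cts_step x y r = g (exp (- r))" for r
      by (simp add: g_def)
    have [measurable]: "g \<in> borel_measurable borel"
      unfolding g_def[abs_def] by measurable
    have gb: "\<bar>g z\<bar> \<le> 1" for z using xy by (auto simp: g_def cts_step_def divide_simps)
    have igM: "integrable M (\<lambda>\<omega>. g (exp (- Q n \<omega>)))" for n
      by (rule M.integrable_const_bound[of _ 1]) (use gb in \<open>auto intro!: AE_I2\<close>)
    have igN: "integrable N (\<lambda>\<omega>. g (exp (- R \<omega>)))"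
      by (rule N.integrable_const_bound[of _ 1]) (use gb in \<open>auto intro!: AE_I2\<close>)
    have "(\<lambda>n. LINT \<omega>|M. g (exp (- Q n \<omega>))) \<longlonglongrightarrow> (LINT \<omega>|N. g (exp (- R \<omega>)))"
    proof (rule LIMSEQ_I)
      fix r :: real assume r: "0 < r"
      obtain p where p: "polynomial_function p" "\<forall>z\<in>{0..1}. norm (g z - p z) < r/4"
        using Stone_Weierstrass_polynomial_function[of "{0..1::real}" g "r/4"] contg r by auto
      from p(1) have "real_polynomial_function p" by (simp add: real_polynomial_function_eq)
      then obtain a m where a: "p = (\<lambda>z. \<Sum>i\<le>m. a i * z ^ i)"
        using real_polynomial_function_iff_sum by blast
      \<comment> \<open>Powers of \<open>exp (- s)\<close> are again exponentials, so only natural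
        arguments of the Laplace transform occur.\<close>
      have pe: "p (exp (- s)) = (\<Sum>i\<le>m. a i * exp (- (real i * s)))" for s
        unfolding a by (simp flip: exp_of_nat_mult)
      have ipM: "integrable M (\<lambda>\<omega>. p (exp (- Q n \<omega>)))" for n unfolding pe using iM by auto
      have ipN: "integrable N (\<lambda>\<omega>. p (exp (- R \<omega>)))" unfolding pe using iN by auto
      have "(\<lambda>n. LINT \<omega>|M. p (exp (- Q n \<omega>))) \<longlonglongrightarrow> (LINT \<omega>|N. p (exp (- R \<omega>)))"
        unfolding pe using iM iN by (simp, intro tendsto_sum tendsto_mult tendsto_const lim)
      from LIMSEQ_D[OF this, of "r/4"] r obtain n0 where
        n0: "\<And>n. n \<ge> n0 \<Longrightarrow> norm ((LINT \<omega>|M. p (exp (- Q n \<omega>))) - (LINT \<omega>|N. p (exp (- R \<omega>)))) < r/4"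
        by auto
      have dM: "\<bar>(LINT \<omega>|M. g (exp (- Q n \<omega>))) - (LINT \<omega>|M. p (exp (- Q n \<omega>)))\<bar> \<le> r/4" for n
      proof -
        have "\<bar>LINT \<omega>|M. g (exp (- Q n \<omega>)) - p (exp (- Q n \<omega>))\<bar> \<le> (LINT \<omega>|M. r/4)"
          using igM ipM p(2) Q0
          by (intro integral_abs_bound[THEN order_trans] integral_mono) (auto intro!: less_imp_le)
        thus ?thesis using igM ipM M.prob_space by simp
      qed
      have dN: "\<bar>(LINT \<omega>|N. g (exp (- R \<omega>))) - (LINT \<omega>|N. p (exp (- R \<omega>)))\<bar> \<le> r/4"
      proof -
        have "\<bar>LINT \<omega>|N. g (exp (- R \<omega>)) - p (exp (- R \<omega>))\<bar> \<le> (LINT \<omega>|N. r/4)"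
          using igN ipN p(2) R0
          by (intro integral_abs_bound[THEN order_trans] integral_mono) (auto intro!: less_imp_le)
        thus ?thesis using igN ipN N.prob_space by simp
      qed
      show "\<exists>n0. \<forall>n\<ge>n0. norm ((LINT \<omega>|M. g (exp (- Q n \<omega>))) - (LINT \<omega>|N. g (exp (- R \<omega>)))) < r"
      proof (intro exI[of _ n0] allI impI)
        fix n assume "n0 \<le> n"
        from n0[OF this] dM[of n] dN r
        show "norm ((LINT \<omega>|M. g (exp (- Q n \<omega>))) - (LINT \<omega>|N. g (exp (- R \<omega>)))) < r"
          unfolding real_norm_def by linarith
      qed
    qed
    thus ?thesis by (simp add: integral_distr flip: gQ)
  qed
  thus ?thesis using integral_cts_step_conv_imp_weak_conv[of "\<lambda>n. distr M borel (Q n)" "distr N borel R"] rdM rdN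
    by blast
qed

text \<open>A mixed transform: every coordinate in \<open>S\<close> carries a frequency
  \<open>a s\<close>, those in \<open>K\<close> also a quadratic damping \<open>l k\<close>. For
  empty \<open>K\<close> it is a characteristic function; for \<open>K = S\<close> and
  \<open>a = 0\<close> it is the Laplace transform of a weighted sum of squares. Induction on
  \<open>K\<close> passes from the one to the other.\<close>

definition gauss_laplace ::
    "'a measure \<Rightarrow> 's set \<Rightarrow> ('s \<Rightarrow> 'a \<Rightarrow> real) \<Rightarrow> ('s \<Rightarrow> real) \<Rightarrow> 's set \<Rightarrow> ('s \<Rightarrow> real) \<Rightarrow> complex" where
  "gauss_laplace M S d l K a =
     (CLINT \<omega>|M. iexp (\<Sum>s\<in>S. a s * d s \<omega>) * complex_of_real (exp (- (\<Sum>k\<in>K. l k * (d k \<omega>)\<^sup>2))))"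

lemma gauss_laplace_norm_le:
  assumes "\<And>k. k \<in> K \<Longrightarrow> 0 \<le> l k"
  shows "norm (iexp A * complex_of_real (exp (- (\<Sum>k\<in>K. l k * (d k)\<^sup>2)))) \<le> 1"
  using assms by (simp add: norm_mult sum_nonneg)

text \<open>\<open>exp (- l d\<^sup>2) = E exp (i sqrt (2 l) \<xi> d)\<close> trades a quadratic factor for a random shift of the
  frequency \<open>a k\<close>.\<close>
lemma gauss_laplace_insert:
  assumes M: "prob_space M" and S: "finite S" and d [measurable]: "\<And>s. s \<in> S \<Longrightarrow> d s \<in> borel_measurable M"
    and k: "k \<in> S" "k \<notin> K" "K \<subseteq> S" and l: "\<And>k. 0 \<le> l k"
  shows "gauss_laplace M S d l (insert k K) a =
    (CLINT \<xi>|std_normal_distribution. gauss_laplace M S d l K (a(k := a k + sqrt (2 * l k) * \<xi>)))"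
proof -
  interpret M: prob_space M by fact
  interpret G: prob_space std_normal_distribution
    using real_dist_normal_dist real_distribution_def by blast
  interpret P: pair_prob_space M std_normal_distribution ..
  define A where "A \<omega> = (\<Sum>s\<in>S. a s * d s \<omega>)" for \<omega>
  define R where "R \<omega> = exp (- (\<Sum>k\<in>K. l k * (d k \<omega>)\<^sup>2))" for \<omega>
  have finK: "finite K" using S k(3) finite_subset by blast
  have [measurable]: "A \<in> borel_measurable M" unfolding A_def by measurable
  have [measurable]: "R \<in> borel_measurable M" unfolding R_def using k by (measurable; auto)
  have [measurable]: "d k \<in> borel_measurable M" using k by auto
  have upd: "(\<Sum>s\<in>S. (a(k := a k + b)) s * d s \<omega>) = A \<omega> + b * d k \<omega>" for b \<omega>
    using S k(1) unfolding A_def by (simp add: sum.remove[of S k] algebra_simps)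
  have nR: "norm (complex_of_real (R \<omega>)) \<le> 1" for \<omega> unfolding R_def using l by (simp add: sum_nonneg)
  have pt: "iexp (A \<omega>) * complex_of_real (exp (- (\<Sum>k\<in>insert k K. l k * (d k \<omega>)\<^sup>2))) =
     (CLINT \<xi>|std_normal_distribution. iexp (A \<omega> + sqrt (2 * l k) * \<xi> * d k \<omega>) * complex_of_real (R \<omega>))" for \<omega>
  proof -
    have "(CLINT \<xi>|std_normal_distribution. iexp (sqrt (2 * l k) * d k \<omega> * \<xi>)) = exp (- (l k * (d k \<omega>)\<^sup>2))"
      using fun_cong[OF char_std_normal_distribution, of "sqrt (2 * l k) * d k \<omega>"] l[of k]
      by (simp add: char_def power_mult_distrib)
    moreover have "iexp (A \<omega> + sqrt (2 * l k) * \<xi> * d k \<omega>) * complex_of_real (R \<omega>) =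
        (iexp (A \<omega>) * complex_of_real (R \<omega>)) * iexp (sqrt (2 * l k) * d k \<omega> * \<xi>)" for \<xi>
      by (simp add: algebra_simps exp_add)
    ultimately have "(CLINT \<xi>|std_normal_distribution. iexp (A \<omega> + sqrt (2 * l k) * \<xi> * d k \<omega>) * complex_of_real (R \<omega>))
       = (iexp (A \<omega>) * complex_of_real (R \<omega>)) * exp (- (l k * (d k \<omega>)\<^sup>2))"
      by (simp only: integral_mult_right_zero)
    thus ?thesis using finK k(2)
      by (simp add: R_def exp_add[symmetric] exp_of_real[symmetric] algebra_simps del: exp_of_real of_real_exp flip: of_real_mult)
         
  qed
  have int: "integrable (M \<Otimes>\<^sub>M std_normal_distribution)
      (\<lambda>(\<omega>, \<xi>). iexp (A \<omega> + sqrt (2 * l k) * \<xi> * d k \<omega>) * complex_of_real (R \<omega>))"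
    by (rule P.integrable_const_bound[of _ 1]) (use nR in \<open>auto simp: norm_mult split_beta'\<close>)
  have "gauss_laplace M S d l (insert k K) a =
     (CLINT \<omega>|M. CLINT \<xi>|std_normal_distribution. iexp (A \<omega> + sqrt (2 * l k) * \<xi> * d k \<omega>) * complex_of_real (R \<omega>))"
    unfolding gauss_laplace_def pt[symmetric] by (simp add: A_def)
  also have "\<dots> = (CLINT \<xi>|std_normal_distribution. CLINT \<omega>|M. iexp (A \<omega> + sqrt (2 * l k) * \<xi> * d k \<omega>) * complex_of_real (R \<omega>))"
    using P.Fubini_integral[OF int] by simp
  also have "\<dots> = (CLINT \<xi>|std_normal_distribution. gauss_laplace M S d l K (a(k := a k + sqrt (2 * l k) * \<xi>)))"
    unfolding gauss_laplace_def upd R_def by simp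
  finally show ?thesis .
qed

text \<open>Inserting \<open>k\<close> averages transforms with one damped coordinate less over a
  Gaussian shift of the frequency \<open>a k\<close>. The integrands converge by the induction
  hypothesis, which is therefore needed for all \<open>a\<close>, and they are bounded by 1, so
  dominated convergence applies.\<close>

lemma gauss_laplace_tendsto:
  assumes M: "prob_space M" and N: "prob_space N" and S: "finite S" and "K \<subseteq> S" and l: "\<And>k. 0 \<le> l k"
    and D: "\<And>n s. s \<in> S \<Longrightarrow> D n s \<in> borel_measurable M" and E: "\<And>s. s \<in> S \<Longrightarrow> E s \<in> borel_measurable N"
    and lim: "\<And>a. (\<lambda>n. CLINT \<omega>|M. iexp (\<Sum>s\<in>S. a s * D n s \<omega>)) \<longlonglongrightarrow> (CLINT \<omega>|N. iexp (\<Sum>s\<in>S. a s * E s \<omega>))"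
  shows "(\<lambda>n. gauss_laplace M S (D n) l K a) \<longlonglongrightarrow> gauss_laplace N S E l K a"
proof -
  have "finite K" using S \<open>K \<subseteq> S\<close> finite_subset by blast
  thus ?thesis using \<open>K \<subseteq> S\<close>
  proof (induction K arbitrary: a)
    case empty
    show ?case using lim by (simp add: gauss_laplace_def)
  next
    case (insert k K)
    interpret M: prob_space M by fact
    interpret N: prob_space N by fact
    interpret G: prob_space std_normal_distribution
      using real_dist_normal_dist real_distribution_def by blast
    have 1: "gauss_laplace M S (D n) l (insert k K) a =
      (CLINT \<xi>|std_normal_distribution. gauss_laplace M S (D n) l K (a(k := a k + sqrt (2 * l k) * \<xi>)))" for n
      using insert by (intro gauss_laplace_insert M S D l) auto
    have 2: "gauss_laplace N S E l (insert k K) a =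
      (CLINT \<xi>|std_normal_distribution. gauss_laplace N S E l K (a(k := a k + sqrt (2 * l k) * \<xi>)))"
      using insert by (intro gauss_laplace_insert N S E l) auto
    have meas: "(\<lambda>\<xi>. gauss_laplace P S d l K (a(k := a k + sqrt (2 * l k) * \<xi>))) \<in> borel_measurable borel"
      if P: "prob_space P" and d [measurable]: "\<And>s. s \<in> S \<Longrightarrow> d s \<in> borel_measurable P" for P and d :: "_ \<Rightarrow> 'z \<Rightarrow> real"
    proof -
      interpret P: prob_space P by fact
      have [measurable]: "(\<lambda>\<omega>. \<Sum>k\<in>K. l k * (d k \<omega>)\<^sup>2) \<in> borel_measurable P"
        using insert by (intro borel_measurable_sum borel_measurable_times borel_measurable_power d) auto
      have [measurable]: "(\<lambda>\<omega>. \<Sum>s\<in>S. a s * d s \<omega>) \<in> borel_measurable P" by measurable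
      have [measurable]: "d k \<in> borel_measurable P" using insert by auto
      have upd: "(\<Sum>s\<in>S. (a(k := a k + b)) s * d s \<omega>) = (\<Sum>s\<in>S. a s * d s \<omega>) + b * d k \<omega>" for b \<omega>
        using S insert.prems by (simp add: sum.remove[of S k] algebra_simps)
      show ?thesis unfolding gauss_laplace_def upd by measurable
    qed
    have bd: "norm (gauss_laplace M S (D n) l K b) \<le> 1" for n b
    proof -
      have [measurable]: "(\<lambda>\<omega>. \<Sum>k\<in>K. l k * (D n k \<omega>)\<^sup>2) \<in> borel_measurable M"
        using insert by (intro borel_measurable_sum borel_measurable_times borel_measurable_power D) auto
      have [measurable]: "(\<lambda>\<omega>. \<Sum>s\<in>S. b s * D n s \<omega>) \<in> borel_measurable M"
        by (intro borel_measurable_sum borel_measurable_times D) auto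
      define f where "f \<omega> = iexp (\<Sum>s\<in>S. b s * D n s \<omega>) * complex_of_real (exp (- (\<Sum>k\<in>K. l k * (D n k \<omega>)\<^sup>2)))" for \<omega>
      have [measurable]: "f \<in> borel_measurable M" unfolding f_def by measurable
      have f1: "norm (f \<omega>) \<le> 1" for \<omega> unfolding f_def by (rule gauss_laplace_norm_le[OF l])
      have "norm (integral\<^sup>L M f) \<le> (LINT \<omega>|M. norm (f \<omega>))" by (rule integral_norm_bound)
      also have "\<dots> \<le> 1" using f1 by (intro M.integral_le_const M.integrable_const_bound[of _ 1]) auto
      finally show ?thesis by (simp add: gauss_laplace_def f_def[abs_def])
    qed
    show ?case unfolding 1 2
    proof (rule integral_dominated_convergence[where w="\<lambda>_. 1"])
      show "(\<lambda>\<xi>. gauss_laplace N S E l K (a(k := a k + sqrt (2 * l k) * \<xi>))) \<in> borel_measurable std_normal_distribution"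
        using meas[OF N E] by simp
      show "(\<lambda>\<xi>. gauss_laplace M S (D n) l K (a(k := a k + sqrt (2 * l k) * \<xi>))) \<in> borel_measurable std_normal_distribution" for n
        using meas[OF M D] by simp
    qed (use insert bd in auto)
  qed
qed

section \<open>Empirical measures\<close>

text \<open>The samples are numbered from 1, the summands in the central limit theorem from
  0.\<close>

lemma (in prob_space) indep_vars_Suc:
  assumes "indep_vars (\<lambda>_. S) Z {1..}"
  shows "indep_vars (\<lambda>_. S) (\<lambda>i. Z (Suc i)) UNIV"
proof -
  have Z: "\<And>i. 1 \<le> i \<Longrightarrow> random_variable S (Z i)"
    and ind: "indep_sets (\<lambda>i. {Z i -` A \<inter> space M |A. A \<in> sets S}) {1..}"
    using assms by (auto simp: indep_vars_def2)
  have "indep_sets (\<lambda>i. {Z (Suc i) -` A \<inter> space M |A. A \<in> sets S}) UNIV"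
  proof (rule indep_setsI)
    show "{Z (Suc i) -` A \<inter> space M |A. A \<in> sets S} \<subseteq> events" for i
      using Z[of "Suc i"] by (auto intro: measurable_sets)
    fix A J assume J: "J \<noteq> {}" "finite (J::nat set)" "\<forall>j\<in>J. A j \<in> {Z (Suc j) -` A \<inter> space M |A. A \<in> sets S}"
    have "prob (\<Inter>j\<in>Suc ` J. A (j - 1)) = (\<Prod>j\<in>Suc ` J. prob (A (j - 1)))"
      by (rule indep_setsD[OF ind]) (use J in auto)
    thus "prob (\<Inter>j\<in>J. A j) = (\<Prod>j\<in>J. prob (A j))" by (simp add: prod.reindex)
  qed
  thus ?thesis using Z by (auto simp: indep_vars_def2)
qed

text \<open>The values lie in an arbitrary measurable space, so that a pair \<open>(X, Y)\<close> is
  one observation and its two components may depend on each other.\<close>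

locale iid_sample = prob_space M for M :: "'a measure" +
  fixes S :: "'c measure" and Z :: "nat \<Rightarrow> 'a \<Rightarrow> 'c"
  assumes indep: "indep_vars (\<lambda>_. S) Z {1..}"
    and ident: "\<And>i. 1 \<le> i \<Longrightarrow> distr M S (Z i) = distr M S (Z 1)"
begin

definition law :: "'c measure" where "law = distr M S (Z 1)"

lemma Z_meas: "1 \<le> i \<Longrightarrow> Z i \<in> measurable M S"
  using indep by (auto simp: indep_vars_def)

lemma prob_space_law: "prob_space law"
  unfolding law_def by (rule prob_space_distr) (simp add: Z_meas)

lemma sets_law [measurable_cong, simp]: "sets law = sets S"
  by (simp add: law_def)

lemma space_law [simp]: "space law = space S"
  by (simp add: law_def)

lemma distr_Z: "1 \<le> i \<Longrightarrow> distr M S (Z i) = law"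
  using ident unfolding law_def by blast

lemma integral_Z:
  fixes g :: "'c \<Rightarrow> real"
  assumes "1 \<le> i" "g \<in> borel_measurable S"
  shows "(LINT \<omega>|M. g (Z i \<omega>)) = (LINT z|law. g z)"
  using assms by (subst distr_Z[symmetric, of i]) (auto simp: integral_distr Z_meas)

lemma nn_integral_Z:
  assumes "1 \<le> i" "g \<in> borel_measurable S"
  shows "(\<integral>\<^sup>+\<omega>. g (Z i \<omega>) \<partial>M) = (\<integral>\<^sup>+z. g z \<partial>law)"
  using assms by (subst distr_Z[symmetric, of i]) (auto simp: nn_integral_distr Z_meas)

lemma nn_integral_exp_sum:
  fixes g :: "'c \<Rightarrow> real"
  assumes g [measurable]: "g \<in> borel_measurable S"
  shows "(\<integral>\<^sup>+\<omega>. ennreal (exp (\<Sum>i=1..n. g (Z i \<omega>))) \<partial>M) = (\<integral>\<^sup>+z. ennreal (exp (g z)) \<partial>law) ^ n"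
proof -
  have ind: "indep_vars (\<lambda>_. borel) (\<lambda>i \<omega>. ennreal (exp (g (Z i \<omega>)))) {1..n}"
    by (rule indep_vars_compose2[OF indep_vars_subset[OF indep]]) auto
  have "(\<integral>\<^sup>+\<omega>. (\<Prod>i\<in>{1..n}. ennreal (exp (g (Z i \<omega>)))) \<partial>M) = (\<Prod>i\<in>{1..n}. \<integral>\<^sup>+\<omega>. ennreal (exp (g (Z i \<omega>))) \<partial>M)"
    by (rule indep_vars_nn_integral[OF _ ind]) auto
  also have "\<dots> = (\<Prod>i\<in>{1..n}. \<integral>\<^sup>+z. ennreal (exp (g z)) \<partial>law)"
    by (intro prod.cong refl nn_integral_Z) auto
  finally show ?thesis by (simp add: exp_sum prod_ennreal)
qed

text \<open>The empirical process indexed by functions. For \<open>n = 0\<close> its value is 0, by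
  division by zero, so the moment bounds derived from it hold for every \<open>n\<close>.\<close>

definition cemp :: "nat \<Rightarrow> ('c \<Rightarrow> real) \<Rightarrow> 'a \<Rightarrow> real" where
  "cemp n g \<omega> = (\<Sum>i=1..n. g (Z i \<omega>) - (LINT z|law. g z)) / sqrt (real n)"

lemma cemp_measurable [measurable]:
  assumes [measurable]: "g \<in> borel_measurable S" shows "cemp n g \<in> borel_measurable M"
  unfolding cemp_def[abs_def]
  by (intro borel_measurable_divide borel_measurable_sum borel_measurable_diff measurable_compose[OF Z_meas assms]) auto

lemma integrable_law:
  fixes g :: "'c \<Rightarrow> real"
  assumes "g \<in> borel_measurable S" "\<And>z. z \<in> space S \<Longrightarrow> \<bar>g z\<bar> \<le> B"
  shows "integrable law g"
proof -
  interpret L: prob_space law by (rule prob_space_law)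
  show ?thesis using assms by (intro L.integrable_const_bound[of _ B]) (auto simp: law_def)
qed

text \<open>In the double sum obtained by expanding the square, the off-diagonal terms vanish by
  independence and centring; the \<open>n\<close> diagonal terms cancel the factor
  \<open>1 / n\<close>.\<close>

lemma second_moment_cemp:
  fixes g :: "'c \<Rightarrow> real"
  assumes g [measurable]: "g \<in> borel_measurable S" and B: "\<And>z. z \<in> space S \<Longrightarrow> \<bar>g z\<bar> \<le> B" and n: "1 \<le> n"
  shows "integrable M (\<lambda>\<omega>. (cemp n g \<omega>)\<^sup>2)"
    and "(LINT \<omega>|M. (cemp n g \<omega>)\<^sup>2) = (LINT z|law. (g z - (LINT z|law. g z))\<^sup>2)"
proof -
  interpret L: prob_space law by (rule prob_space_law)
  define h where "h z = g z - (LINT z|law. g z)" for z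
  have [measurable]: "h \<in> borel_measurable S" unfolding h_def by measurable
  have "\<bar>LINT z|law. g z\<bar> \<le> (LINT z|law. \<bar>g z\<bar>)" by (rule integral_abs_bound)
  also have "\<dots> \<le> B" using B integrable_law[OF g B] by (intro L.integral_le_const) (auto simp: AE_I2)
  finally have Bh: "\<bar>h z\<bar> \<le> 2 * B" if "z \<in> space S" for z unfolding h_def using B[OF that] by linarith
  have h0: "(LINT z|law. h z) = 0" unfolding h_def using integrable_law[OF g B] L.prob_space by simp
  obtain z0 where "z0 \<in> space S" using L.not_empty by auto
  hence B0: "0 \<le> B" using B[of z0] by linarith
  have Zs: "Z i \<omega> \<in> space S" if "1 \<le> i" "\<omega> \<in> space M" for i \<omega> using Z_meas[OF that(1)] that(2) by (auto dest: measurable_space)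
  have hZ [measurable]: "(\<lambda>\<omega>. h (Z i \<omega>)) \<in> borel_measurable M" if "1 \<le> i" for i
    using Z_meas[OF that] by measurable
  have bb: "\<bar>h (Z i \<omega>) * h (Z j \<omega>)\<bar> \<le> 2 * B * (2 * B)" if "1 \<le> i" "1 \<le> j" "\<omega> \<in> space M" for i j \<omega>
    unfolding abs_mult using Bh Zs that by (intro mult_mono) (use B0 in auto)
  have int: "integrable M (\<lambda>\<omega>. h (Z i \<omega>) * h (Z j \<omega>))" if "1 \<le> i" "1 \<le> j" for i j
    using bb[OF that] hZ that by (intro integrable_const_bound[of _ "2 * B * (2 * B)"]) auto
  have inth: "integrable M (\<lambda>\<omega>. h (Z i \<omega>))" if "1 \<le> i" for i
    using Bh Zs hZ that by (intro integrable_const_bound[of _ "2 * B"]) auto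
  have cov: "(LINT \<omega>|M. h (Z i \<omega>) * h (Z j \<omega>)) = (if i = j then LINT z|law. (h z)\<^sup>2 else 0)"
    if "1 \<le> i" "1 \<le> j" for i j
  proof (cases "i = j")
    case True
    thus ?thesis using integral_Z[OF that(1), of "\<lambda>z. (h z)\<^sup>2"] by (simp add: power2_eq_square)
  next
    case False
    have "indep_vars (\<lambda>_. borel) (\<lambda>i \<omega>. h (Z i \<omega>)) {i, j}"
      by (rule indep_vars_compose2[OF indep_vars_subset[OF indep]]) (use that in auto)
    hence "(LINT \<omega>|M. (\<Prod>k\<in>{i, j}. h (Z k \<omega>))) = (\<Prod>k\<in>{i, j}. LINT \<omega>|M. h (Z k \<omega>))"
      using inth that by (intro indep_vars_lebesgue_integral) auto
    thus ?thesis using False integral_Z[OF that(1), of h] h0 by simp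
  qed
  have sq: "(cemp n g \<omega>)\<^sup>2 = (\<Sum>i=1..n. \<Sum>j=1..n. h (Z i \<omega>) * h (Z j \<omega>)) / real n" for \<omega>
    by (simp add: cemp_def h_def power_divide power2_eq_square sum_product)
  show "integrable M (\<lambda>\<omega>. (cemp n g \<omega>)\<^sup>2)" unfolding sq
    by (intro integrable_divide_zero Bochner_Integration.integrable_sum int) auto
  have "(LINT \<omega>|M. (cemp n g \<omega>)\<^sup>2) = (LINT \<omega>|M. (\<Sum>i=1..n. \<Sum>j=1..n. h (Z i \<omega>) * h (Z j \<omega>))) / real n"
    unfolding sq by simp
  also have "(LINT \<omega>|M. (\<Sum>i=1..n. \<Sum>j=1..n. h (Z i \<omega>) * h (Z j \<omega>))) =
      (\<Sum>i=1..n. LINT \<omega>|M. (\<Sum>j=1..n. h (Z i \<omega>) * h (Z j \<omega>)))"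
    by (intro Bochner_Integration.integral_sum Bochner_Integration.integrable_sum int) auto
  also have "\<dots> = (\<Sum>i=1..n. \<Sum>j=1..n. LINT \<omega>|M. h (Z i \<omega>) * h (Z j \<omega>))"
    by (intro sum.cong refl Bochner_Integration.integral_sum int) auto
  also have "(\<Sum>i=1..n. \<Sum>j=1..n. LINT \<omega>|M. h (Z i \<omega>) * h (Z j \<omega>)) = (\<Sum>i=1..n. \<Sum>j=1..n. if i = j then LINT z|law. (h z)\<^sup>2 else 0)"
    by (intro sum.cong refl cov) auto
  also have "\<dots> = real n * (LINT z|law. (h z)\<^sup>2)" by simp
  finally show "(LINT \<omega>|M. (cemp n g \<omega>)\<^sup>2) = (LINT z|law. (g z - (LINT z|law. g z))\<^sup>2)"
    using n by (simp add: h_def)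
qed

lemma char_cemp_tendsto:
  fixes g :: "'c \<Rightarrow> real"
  assumes g [measurable]: "g \<in> borel_measurable S" and B: "\<And>z. z \<in> space S \<Longrightarrow> \<bar>g z\<bar> \<le> B"
    and g0: "(LINT z|law. g z) = 0"
  shows "(\<lambda>n. CLINT \<omega>|M. iexp (cemp n g \<omega>)) \<longlonglongrightarrow> exp (- (LINT z|law. (g z)\<^sup>2) / 2)"
proof -
  define s where "s = (LINT z|law. (g z)\<^sup>2)"
  have s0: "0 \<le> s" unfolding s_def by simp
  show ?thesis
  proof (cases "s = 0")
    \<comment> \<open>A degenerate limit has to be treated apart, since the central limit theorem
      assumes positive variance. Here \<open>cemp\<close> vanishes almost surely.\<close>
    case True
    have ae: "AE \<omega> in M. cemp n g \<omega> = 0" for n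
    proof (cases "n = 0")
      case False
      hence "AE \<omega> in M. (cemp n g \<omega>)\<^sup>2 = 0"
        using second_moment_cemp[OF g B, of n] True g0
        by (subst integral_nonneg_eq_0_iff_AE[symmetric]) (auto simp: s_def)
      thus ?thesis by simp
    qed (simp add: cemp_def)
    have "(CLINT \<omega>|M. iexp (cemp n g \<omega>)) = (CLINT \<omega>|M. 1)" for n
      using ae[of n] by (intro integral_cong_AE) (auto elim!: eventually_mono)
    thus ?thesis using True by (simp add: s_def prob_space)
  next
    case False
    hence s: "s > 0" using s0 by simp
    have gb2: "\<bar>(g z)\<^sup>2\<bar> \<le> B\<^sup>2" if "z \<in> space S" for z
      using power_mono[OF B[OF that], of 2] by simp
    have gm: "(\<lambda>\<omega>. g (Z (Suc i) \<omega>)) \<in> borel_measurable M" for i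
      using Z_meas[of "Suc i"] by measurable
    have i2: "integrable M (\<lambda>\<omega>. (g (Z (Suc i) \<omega>))\<^sup>2)" for i
      using integrable_law[of "\<lambda>z. (g z)\<^sup>2" "B\<^sup>2"] gb2
      by (subst (asm) distr_Z[symmetric, of "Suc i"]) (auto simp: integrable_distr_eq Z_meas)
    have e: "expectation (\<lambda>\<omega>. g (Z (Suc i) \<omega>)) = 0" for i
      using integral_Z[of "Suc i" g] g0 by simp
    have "indep_vars (\<lambda>_. S) (\<lambda>i. Z (Suc i)) UNIV"
      by (rule indep_vars_Suc[OF indep])
    hence ind: "indep_vars (\<lambda>_. borel) (\<lambda>i \<omega>. g (Z (Suc i) \<omega>)) UNIV"
      by (rule indep_vars_compose2) auto
    have d: "distr M borel (\<lambda>\<omega>. g (Z (Suc i) \<omega>)) = distr law borel g" for i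
      by (subst distr_Z[symmetric, of "Suc i"]) (auto simp: distr_distr Z_meas comp_def)
    \<comment> \<open>This sum is normalised to unit variance; evaluating its characteristic
      function at \<open>sqrt s\<close> restores the scaling of \<open>cemp\<close>.\<close>
    have "weak_conv_m (\<lambda>n. distr M borel (\<lambda>x. (\<Sum>i<n. g (Z (Suc i) x)) / sqrt (n * (sqrt s)\<^sup>2))) std_normal_distribution"
      by (rule central_limit_theorem_zero_mean[OF ind e _ i2 _ d])
         (use s integral_Z[of "Suc _" "\<lambda>z. (g z)\<^sup>2"] e in \<open>auto simp: s_def\<close>)
    hence "(\<lambda>n. char (distr M borel (\<lambda>x. (\<Sum>i<n. g (Z (Suc i) x)) / sqrt (n * (sqrt s)\<^sup>2))) (sqrt s)) \<longlonglongrightarrow>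
        char std_normal_distribution (sqrt s)"
      by (intro levy_continuity1) (auto intro!: real_distribution_distr real_dist_normal_dist borel_measurable_divide borel_measurable_sum gm)
    moreover have "char (distr M borel (\<lambda>x. (\<Sum>i<n. g (Z (Suc i) x)) / sqrt (n * (sqrt s)\<^sup>2))) (sqrt s) = (CLINT \<omega>|M. iexp (cemp n g \<omega>))" for n
    proof -
      have "sqrt s * ((\<Sum>i<n. g (Z (Suc i) x)) / sqrt (n * (sqrt s)\<^sup>2)) = cemp n g x" for x
        using s by (simp add: cemp_def g0 real_sqrt_mult sum.atLeast1_atMost_eq)
      thus ?thesis unfolding char_def
        by (subst integral_distr) (auto intro!: borel_measurable_divide borel_measurable_sum gm simp del: of_real_mult of_real_divide of_real_sum)
    qed
    ultimately show ?thesis using s by (simp add: char_std_normal_distribution s_def)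
  qed
qed

end

lemma bernoulli_mgf_nonneg:
  fixes p t :: real assumes "0 \<le> p" "p \<le> 1" shows "0 \<le> 1 + p * (exp t - 1)"
proof -
  have "1 + p * (exp t - 1) = (1 - p) + p * exp t" by (simp add: algebra_simps)
  also have "0 \<le> \<dots>" using assms by (intro add_nonneg_nonneg) auto
  finally show ?thesis .
qed

section \<open>Empirical frequencies of sets: moments, exponential bounds and deviations\<close>

context iid_sample begin

lemma second_moment_cemp_le:
  fixes g :: "'c \<Rightarrow> real"
  assumes g [measurable]: "g \<in> borel_measurable S" and B: "\<And>z. z \<in> space S \<Longrightarrow> \<bar>g z\<bar> \<le> B"
  shows "integrable M (\<lambda>\<omega>. (cemp n g \<omega>)\<^sup>2)"
    and "(LINT \<omega>|M. (cemp n g \<omega>)\<^sup>2) \<le> (LINT z|law. (g z)\<^sup>2)"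
proof -
  interpret L: prob_space law by (rule prob_space_law)
  have ig: "integrable law g" by (rule integrable_law[OF g B])
  have ig2: "integrable law (\<lambda>z. (g z)\<^sup>2)"
    by (rule integrable_law[of _ "B\<^sup>2"]) (use B power_mono[OF B, of _ 2] in auto)
  have "(LINT z|law. (g z - (LINT z|law. g z))\<^sup>2) = (LINT z|law. (g z)\<^sup>2) - (LINT z|law. g z)\<^sup>2"
    using L.variance_eq[OF ig ig2] by simp
  hence le: "(LINT z|law. (g z - (LINT z|law. g z))\<^sup>2) \<le> (LINT z|law. (g z)\<^sup>2)" by simp
  show "integrable M (\<lambda>\<omega>. (cemp n g \<omega>)\<^sup>2)"
    using second_moment_cemp(1)[OF g B, of n] by (cases "n = 0") (auto simp: cemp_def)
  show "(LINT \<omega>|M. (cemp n g \<omega>)\<^sup>2) \<le> (LINT z|law. (g z)\<^sup>2)"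
    using second_moment_cemp(2)[OF g B, of n] le by (cases "n = 0") (auto simp: cemp_def)
qed

definition emp :: "nat \<Rightarrow> 'c set \<Rightarrow> 'a \<Rightarrow> real" where
  "emp n A \<omega> = (\<Sum>i=1..n. indicator A (Z i \<omega>)) / real n"

lemma count_measurable [measurable]:
  assumes [measurable]: "A \<in> sets S"
  shows "(\<lambda>\<omega>. \<Sum>i=1..n. indicator A (Z i \<omega>) :: real) \<in> borel_measurable M"
  by (intro borel_measurable_sum measurable_compose[OF Z_meas, of _ "indicator A"]) auto

lemma emp_measurable [measurable]:
  assumes [measurable]: "A \<in> sets S" shows "emp n A \<in> borel_measurable M"
  unfolding emp_def[abs_def] by measurable

lemma emp_nonneg: "0 \<le> emp n A \<omega>"
  by (simp add: emp_def sum_nonneg)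

lemma emp_le_1: "emp n A \<omega> \<le> 1"
proof -
  have "(\<Sum>i=1..n. indicator A (Z i \<omega>) :: real) \<le> (\<Sum>i=1..n. 1)"
    by (intro sum_mono) (auto simp: indicator_def)
  thus ?thesis by (simp add: emp_def divide_simps)
qed

lemma count_mono: "A \<subseteq> B \<Longrightarrow> (\<Sum>i=1..n. indicator A (Z i \<omega>) :: real) \<le> (\<Sum>i=1..n. indicator B (Z i \<omega>))"
  by (intro sum_mono) (auto simp: indicator_def)

lemma emp_mono: "A \<subseteq> B \<Longrightarrow> emp n A \<omega> \<le> emp n B \<omega>"
  unfolding emp_def by (intro divide_right_mono count_mono) auto

lemma cemp_indicator:
  assumes "A \<in> sets S" shows "cemp n (indicator A) \<omega> = sqrt (real n) * (emp n A \<omega> - measure law A)"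
proof (cases "n = 0")
  case False
  have "(\<Sum>i=1..n. indicator A (Z i \<omega>) - measure law A) = real n * (emp n A \<omega> - measure law A)"
    using False by (simp add: sum_subtractf emp_def right_diff_distrib)
  moreover have "(LINT z|law. indicator A z) = measure law A" using assms
    by (simp add: Bochner_Integration.integral_indicator Int_absorb2 sets.sets_into_space)
  ultimately have "cemp n (indicator A) \<omega> = real n / sqrt (real n) * (emp n A \<omega> - measure law A)"
    by (simp add: cemp_def)
  thus ?thesis by (simp add: real_div_sqrt)
qed (simp add: cemp_def)

lemma nn_integral_exp_count:
  assumes A [measurable]: "A \<in> sets S"
  shows "(\<integral>\<^sup>+\<omega>. ennreal (exp (t * (\<Sum>i=1..n. indicator A (Z i \<omega>)))) \<partial>M) = ennreal ((1 + measure law A * (exp t - 1)) ^ n)"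
proof -
  interpret L: prob_space law by (rule prob_space_law)
  have e: "exp (t * indicator A z) = 1 + (exp t - 1) * indicator A z" for z :: 'c
    by (auto simp: indicator_def)
  have iA: "integrable law (\<lambda>z. 1 + (exp t - 1) * indicator A z :: real)"
    by (intro Bochner_Integration.integrable_add integrable_mult_right) (auto intro!: integrable_real_indicator simp: L.emeasure_eq_measure)
  have "(\<integral>\<^sup>+z. ennreal (exp (t * indicator A z)) \<partial>law) = ennreal (LINT z|law. exp (t * indicator A z))"
    by (rule nn_integral_eq_integral) (use iA in \<open>simp_all flip: e\<close>)
  also have "(LINT z|law. exp (t * indicator A z)) = 1 + measure law A * (exp t - 1)"
    unfolding e using L.prob_space sets.sets_into_space[OF A]
    by (subst Bochner_Integration.integral_add) (auto simp: L.emeasure_eq_measure Int_absorb2 mult.commute)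
  finally have 1: "(\<integral>\<^sup>+z. ennreal (exp (t * indicator A z)) \<partial>law) = ennreal (1 + measure law A * (exp t - 1))" .
  have p: "0 \<le> 1 + measure law A * (exp t - 1)"
  by (rule bernoulli_mgf_nonneg) auto
  have "(\<integral>\<^sup>+\<omega>. ennreal (exp (\<Sum>i=1..n. t * indicator A (Z i \<omega>))) \<partial>M) = ennreal (1 + measure law A * (exp t - 1)) ^ n"
    by (subst nn_integral_exp_sum) (auto simp: 1)
  thus ?thesis using p by (simp add: sum_distrib_left ennreal_power)
qed

text \<open>Markov's inequality for \<open>exp (t * count)\<close> together with
  \<open>1 + x <= exp x\<close>. The sign of \<open>t\<close> decides which deviation is meant: for
  negative \<open>t\<close> the event says that the count is at most \<open>b\<close>.\<close>

lemma count_chernoff: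
  assumes A [measurable]: "A \<in> sets S"
  shows "prob {\<omega>\<in>space M. t * b \<le> t * (\<Sum>i=1..n. indicator A (Z i \<omega>))} \<le> exp (real n * measure law A * (exp t - 1) - t * b)"
proof -
  interpret L: prob_space law by (rule prob_space_law)
  have p: "0 \<le> 1 + measure law A * (exp t - 1)"
  by (rule bernoulli_mgf_nonneg) auto
  have eq: "{\<omega>\<in>space M. t * b \<le> t * (\<Sum>i=1..n. indicator A (Z i \<omega>))} =
    {\<omega>\<in>space M. 1 \<le> ennreal (exp (- (t * b))) * ennreal (exp (t * (\<Sum>i=1..n. indicator A (Z i \<omega>))))}"
    by (auto simp flip: ennreal_mult exp_add simp: ennreal_1[symmetric] simp del: ennreal_1)
  have "emeasure M {\<omega>\<in>space M. t * b \<le> t * (\<Sum>i=1..n. indicator A (Z i \<omega>))}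
    \<le> ennreal (exp (- (t * b))) * (\<integral>\<^sup>+\<omega>. ennreal (exp (t * (\<Sum>i=1..n. indicator A (Z i \<omega>)))) * indicator (space M) \<omega> \<partial>M)"
    unfolding eq by (rule nn_integral_Markov_inequality) measurable
  also have "(\<integral>\<^sup>+\<omega>. ennreal (exp (t * (\<Sum>i=1..n. indicator A (Z i \<omega>)))) * indicator (space M) \<omega> \<partial>M) =
    (\<integral>\<^sup>+\<omega>. ennreal (exp (t * (\<Sum>i=1..n. indicator A (Z i \<omega>)))) \<partial>M)"
    by (intro nn_integral_cong) auto
  also have "ennreal (exp (- (t * b))) * \<dots> = ennreal (exp (- (t * b)) * (1 + measure law A * (exp t - 1)) ^ n)"
    unfolding nn_integral_exp_count[OF A] using p by (simp add: ennreal_mult')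
  also have "\<dots> \<le> ennreal (exp (- (t * b)) * exp (measure law A * (exp t - 1)) ^ n)"
    using p by (intro ennreal_leI mult_left_mono power_mono exp_ge_add_one_self) auto
  also have "exp (- (t * b)) * exp (measure law A * (exp t - 1)) ^ n = exp (real n * measure law A * (exp t - 1) - t * b)"
    by (simp only: exp_of_nat_mult[symmetric] exp_add[symmetric]) (simp add: algebra_simps)
  finally show ?thesis by (simp add: emeasure_eq_measure)
qed

text \<open>A sub-Gaussian bound that is uniform in \<open>n\<close> and in the set. It later
  supplies an integrable dominating function in the rescaled variable \<open>r\<close>.\<close>

lemma cemp_hoeffding:
  assumes A [measurable]: "A \<in> sets S" and n: "1 \<le> n"
  shows "(\<integral>\<^sup>+\<omega>. ennreal (exp (t * cemp n (indicator A) \<omega>)) \<partial>M) \<le> ennreal (exp (t\<^sup>2 / 8))"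
proof -
  interpret L: prob_space law by (rule prob_space_law)
  define p where "p = measure law A"
  have p: "0 \<le> p" "p \<le> 1" unfolding p_def by auto
  have hoef: "exp (- (h * p)) * (1 + p * (exp h - 1)) \<le> exp (h\<^sup>2 / 8)" if "0 \<le> h" "0 \<le> p" "p \<le> 1" for h p :: real
  proof -
    have pos: "0 < 1 + p * (exp h - 1)" using that by (intro add_pos_nonneg mult_nonneg_nonneg) auto
    have le: "exp (- h * p + ln (1 + p * (exp h - 1))) \<le> exp (h\<^sup>2 / 8)"
      using Hoeffdings_lemma_aux[OF that(1,2)] by simp
    have eq: "exp (- h * p + ln (1 + p * (exp h - 1))) = exp (- (h * p)) * (1 + p * (exp h - 1))"
      using pos by (simp only: exp_add exp_ln minus_mult_left)
    show ?thesis using le unfolding eq .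
  qed
  define s where "s = t / sqrt (real n)"
  have key: "exp (- (s * p)) * (1 + p * (exp s - 1)) \<le> exp (s\<^sup>2 / 8)"
  proof (cases "0 \<le> s")
    case True thus ?thesis using hoef p by simp
  next
    case False
    \<comment> \<open>Passing to the complement replaces \<open>p\<close> by \<open>1 - p\<close>
      and \<open>s\<close> by \<open>- s\<close>, and so reduces to a nonnegative exponent.\<close>
    have "exp (- (s * p)) * (1 + p * (exp s - 1)) = exp (- ((-s) * (1-p))) * (1 + (1-p) * (exp (-s) - 1))"
      by (simp add: algebra_simps exp_add exp_diff exp_minus divide_simps)
    also have "\<dots> \<le> exp ((-s)\<^sup>2 / 8)" using False p by (intro hoef) auto
    finally show ?thesis by simp
  qed
  have p1: "0 \<le> 1 + p * (exp s - 1)"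
  by (rule bernoulli_mgf_nonneg) (use p in auto)
  have c: "t * cemp n (indicator A) \<omega> = s * (\<Sum>i=1..n. indicator A (Z i \<omega>)) - real n * s * p" for \<omega>
  proof -
    define r where "r = sqrt (real n)"
    have r: "0 < r" "real n = r * r" using n by (auto simp: r_def)
    show ?thesis unfolding cemp_indicator[OF A] emp_def s_def p_def r_def[symmetric]
      unfolding r(2) using r(1) by (simp add: field_simps)
  qed
  have "(\<integral>\<^sup>+\<omega>. ennreal (exp (t * cemp n (indicator A) \<omega>)) \<partial>M) =
     (\<integral>\<^sup>+\<omega>. ennreal (exp (- (real n * s * p))) * ennreal (exp (s * (\<Sum>i=1..n. indicator A (Z i \<omega>)))) \<partial>M)"
    unfolding c by (intro nn_integral_cong) (simp add: ennreal_mult'[symmetric] exp_add[symmetric])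
  also have "\<dots> = ennreal (exp (- (real n * s * p))) * ennreal ((1 + p * (exp s - 1)) ^ n)"
    unfolding p_def nn_integral_exp_count[OF A, symmetric] by (rule nn_integral_cmult) measurable
  also have "\<dots> = ennreal ((exp (- (s * p)) * (1 + p * (exp s - 1))) ^ n)"
    by (simp add: ennreal_mult'[symmetric] power_mult_distrib exp_of_nat_mult[symmetric] mult.assoc)
  also have "\<dots> \<le> ennreal (exp (s\<^sup>2 / 8) ^ n)"
    using key p1 by (intro ennreal_leI power_mono) auto
  also have "exp (s\<^sup>2 / 8) ^ n = exp (t\<^sup>2 / 8)"
    using n by (simp add: exp_of_nat_mult[symmetric] s_def power_divide)
  finally show ?thesis .
qed

text \<open>A reversed order of the frequencies forces the difference of the two centred counts to
  be at least \<open>sqrt n * d\<close>, while its second moment stays bounded; this is Chebyshev's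
  argument.\<close>

lemma emp_less_tendsto:
  assumes A [measurable]: "A \<in> sets S" and B [measurable]: "B \<in> sets S" and lt: "measure law A < measure law B"
  shows "(\<lambda>n. prob {\<omega>\<in>space M. emp n B \<omega> < emp n A \<omega>}) \<longlonglongrightarrow> 0"
proof -
  interpret L: prob_space law by (rule prob_space_law)
  define d where "d = measure law B - measure law A"
  have d: "d > 0" using lt by (simp add: d_def)
  have le: "prob {\<omega>\<in>space M. emp n B \<omega> < emp n A \<omega>} \<le> 4 / d\<^sup>2 * inverse (real n)" if n: "1 \<le> n" for n
  proof -
    have m: "integrable M (\<lambda>\<omega>. (cemp n (indicator A) \<omega>)\<^sup>2)" "(LINT \<omega>|M. (cemp n (indicator A) \<omega>)\<^sup>2) \<le> 1"
      if [measurable]: "A \<in> sets S" for A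
    proof -
      show "integrable M (\<lambda>\<omega>. (cemp n (indicator A) \<omega>)\<^sup>2)" by (rule second_moment_cemp_le(1)[of _ 1]) auto
      have "(LINT \<omega>|M. (cemp n (indicator A) \<omega>)\<^sup>2) \<le> (LINT z|law. (indicator A z)\<^sup>2)"
        by (rule second_moment_cemp_le(2)[of _ 1]) auto
      also have "\<dots> \<le> 1" by (intro L.integral_le_const L.integrable_const_bound[of _ 1]) (auto simp: indicator_def)
      finally show "(LINT \<omega>|M. (cemp n (indicator A) \<omega>)\<^sup>2) \<le> 1" .
    qed
    define V where "V \<omega> = 2 * (cemp n (indicator A) \<omega>)\<^sup>2 + 2 * (cemp n (indicator B) \<omega>)\<^sup>2" for \<omega>
    have iV: "integrable M V" unfolding V_def using m(1)[OF A] m(1)[OF B] by auto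
    have V0: "0 \<le> V \<omega>" for \<omega> by (simp add: V_def)
    have EV: "(LINT \<omega>|M. V \<omega>) \<le> 4"
      unfolding V_def using m[OF A] m[OF B] by simp
    have "{\<omega>\<in>space M. emp n B \<omega> < emp n A \<omega>} \<subseteq> {\<omega>\<in>space M. real n * d\<^sup>2 \<le> V \<omega>}"
    proof safe
      fix \<omega> assume "\<omega> \<in> space M" "emp n B \<omega> < emp n A \<omega>"
      hence "0 \<le> sqrt (real n) * (emp n A \<omega> - emp n B \<omega>)" by simp
      hence "sqrt (real n) * d \<le> cemp n (indicator A) \<omega> - cemp n (indicator B) \<omega>"
        unfolding cemp_indicator[OF A] cemp_indicator[OF B] d_def by (simp add: algebra_simps)
      hence "(sqrt (real n) * d)\<^sup>2 \<le> (cemp n (indicator A) \<omega> - cemp n (indicator B) \<omega>)\<^sup>2"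
        using d by (intro power_mono) auto
      also have "\<dots> \<le> V \<omega>" unfolding V_def
        using zero_le_power2[of "cemp n (indicator A) \<omega> + cemp n (indicator B) \<omega>"]
        by (simp add: power2_eq_square algebra_simps)
      finally show "real n * d\<^sup>2 \<le> V \<omega>" by (simp add: power_mult_distrib)
    qed
    hence "prob {\<omega>\<in>space M. emp n B \<omega> < emp n A \<omega>} \<le> prob {\<omega>\<in>space M. real n * d\<^sup>2 \<le> V \<omega>}"
      using iV by (intro finite_measure_mono) (auto simp: borel_measurable_integrable)
    also have "\<dots> \<le> (LINT \<omega>|M. V \<omega>) / (real n * d\<^sup>2)"
      using iV d n by (intro integral_Markov_inequality_measure[where A="{}"]) (auto simp: V0)
    also have "\<dots> \<le> 4 / (real n * d\<^sup>2)" using EV by (intro divide_right_mono) auto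
    finally show ?thesis by (simp add: field_simps)
  qed
  have lim: "(\<lambda>n. 4 / d\<^sup>2 * inverse (real n)) \<longlonglongrightarrow> 0"
    using tendsto_mult[OF tendsto_const[of "4 / d\<^sup>2"] lim_inverse_n] by simp
  have ev: "eventually (\<lambda>n. prob {\<omega>\<in>space M. emp n B \<omega> < emp n A \<omega>} \<le> 4 / d\<^sup>2 * inverse (real n)) sequentially"
    by (rule eventually_sequentiallyI[of 1]) (rule le)
  show ?thesis
    by (rule tendsto_sandwich[OF _ ev tendsto_const lim]) simp
qed


text \<open>Chernoff's bound is applied at the points where \<open>F\<close> equals \<open>j / (n K)\<close>, respectively \<open>j K / n\<close>; the resulting
  failure probabilities are geometric in \<open>j\<close>.\<close>
lemma ratio_events:
  assumes eps: "0 < \<epsilon>"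
  obtains K where "1 \<le> K"
    "\<And>n F A. 1 \<le> n \<Longrightarrow> (\<And>x. A x \<in> sets S) \<Longrightarrow> (\<And>x y. x \<le> y \<Longrightarrow> A x \<subseteq> A y) \<Longrightarrow>
       (\<And>x. measure law (A x) = F x) \<Longrightarrow> (\<And>u. 0 < u \<Longrightarrow> u < 1 \<Longrightarrow> \<exists>x::real. F x = u) \<Longrightarrow>
       (\<And>x. 0 < F x) \<Longrightarrow> (\<And>x. F x < 1) \<Longrightarrow> (\<And>x y. x < y \<Longrightarrow> F x < F y) \<Longrightarrow>
       \<exists>E\<in>events. 1 - \<epsilon> \<le> prob E \<and>
          (\<forall>\<omega>\<in>E. (\<forall>x. emp n (A x) \<omega> \<le> K * F x) \<and> (\<forall>x. K / real n \<le> F x \<longrightarrow> F x \<le> K * emp n (A x) \<omega>))"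
proof
  \<comment> \<open>With \<open>q = exp 1 / K\<close> each of the two families of bad events below
    has probabilities at most \<open>q ^ j\<close>, hence the total is at most
    \<open>2 q / (1 - q)\<close>. This is at most \<epsilon> exactly when
    \<open>q (2 + \<epsilon>) <= \<epsilon>\<close>.\<close>
  define K where "K = max 2 (exp 1 * (2 + \<epsilon>) / \<epsilon>)"
  have K2: "2 \<le> K" by (simp add: K_def)
  thus "1 \<le> K" by simp
  define q where "q = exp 1 / K"
  have q0: "0 < q" using K2 by (simp add: q_def)
  have "exp 1 * (2 + \<epsilon>) / \<epsilon> \<le> K" by (simp add: K_def)
  hence q: "q * (2 + \<epsilon>) \<le> \<epsilon>" using eps K2 by (simp add: q_def field_simps)
  have q1: "q < 1"
  proof (rule ccontr)
    assume "\<not> q < 1"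
    hence "1 * (2 + \<epsilon>) \<le> q * (2 + \<epsilon>)" using eps by (intro mult_right_mono) auto
    thus False using q by simp
  qed
  fix n :: nat and F :: "real \<Rightarrow> real" and A
  assume n: "1 \<le> n" and A [measurable]: "\<And>x. A x \<in> sets S" and mono: "\<And>x y. x \<le> y \<Longrightarrow> A x \<subseteq> A y"
    and F: "\<And>x. measure law (A x) = F x" and onto: "\<And>u. 0 < u \<Longrightarrow> u < 1 \<Longrightarrow> \<exists>x::real. F x = u"
    and F0: "\<And>x. 0 < F x" and F1: "\<And>x. F x < 1" and Fstrict: "\<And>x y. x < y \<Longrightarrow> F x < F y"
  interpret L: prob_space law by (rule prob_space_law)
  have Fmono: "F x \<le> F y" if "x \<le> y" for x y
    unfolding F[symmetric] using mono[OF that] by (intro L.finite_measure_mono) auto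
  define cnt where "cnt x \<omega> = (\<Sum>i=1..n. indicator (A x) (Z i \<omega>) :: real)" for x \<omega>
  have cnt_mono: "cnt x \<omega> \<le> cnt y \<omega>" if "x \<le> y" for x y \<omega>
    unfolding cnt_def by (rule count_mono[OF mono[OF that]])
  have [measurable]: "cnt x \<in> borel_measurable M" for x unfolding cnt_def[abs_def] by measurable
  have nat_cnt: "\<exists>j::nat. cnt x \<omega> = real j \<and> j \<le> n" for x \<omega>
  proof -
    have "cnt x \<omega> = real (card {i\<in>{1..n}. Z i \<omega> \<in> A x})"
      unfolding cnt_def by (simp add: indicator_def sum.If_cases Int_def)
    moreover have "card {i\<in>{1..n}. Z i \<omega> \<in> A x} \<le> card {1..n}" by (intro card_mono) auto
    ultimately show ?thesis by auto
  qed
  define xs where "xs u = (SOME x. F x = u)" for u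
  have xs: "F (xs u) = u" if "0 < u" "u < 1" for u
    unfolding xs_def using onto[OF that] by (rule someI_ex)
  \<comment> \<open>At the point used in \<open>U j\<close> the expected count is
    \<open>j / K\<close>, too small for a count of \<open>j\<close>; at the point used in
    \<open>V j\<close> it is \<open>j K\<close>, too large for a count of at most \<open>j\<close>.
    The case distinction drops levels that \<open>F\<close> does not attain.\<close>
  define U where "U j = (if real j / (n * K) < 1 then {\<omega>\<in>space M. real j \<le> cnt (xs (real j / (n * K))) \<omega>} else {})" for j
  define V where "V j = (if real j * K / n < 1 then {\<omega>\<in>space M. cnt (xs (real j * K / n)) \<omega> \<le> real j} else {})" for j
  have [measurable]: "U j \<in> events" "V j \<in> events" for j
    unfolding U_def V_def by (auto intro: measurable_If)
  have qln: "ln q = 1 - ln K" using K2 by (simp add: q_def ln_div)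
  have qj: "q ^ j = exp (real j * (1 - ln K))" for j
    using q0 by (simp add: qln[symmetric] exp_of_nat_mult)
  have U: "prob (U j) \<le> q ^ j" if "1 \<le> j" for j
  proof (cases "real j / (n * K) < 1")
    case True
    have Fj: "F (xs (real j / (n * K))) = real j / (n * K)" using True that n K2 by (intro xs) auto
    have lnK: "0 < ln K" using K2 by simp
    have "U j = {\<omega>\<in>space M. ln K * real j \<le> ln K * (\<Sum>i=1..n. indicator (A (xs (real j / (n * K)))) (Z i \<omega>))}"
      using True lnK by (simp add: U_def cnt_def)
    hence "prob (U j) \<le> exp (real n * (real j / (n * K)) * (exp (ln K) - 1) - ln K * real j)"
      using count_chernoff[of "A (xs (real j / (n * K)))" "ln K" "real j" n] by (simp add: F Fj)
    also have "\<dots> = exp (real j * ((K - 1) / K) - ln K * real j)" using n K2 by (simp add: field_simps)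
    also have "\<dots> \<le> exp (real j * (1 - ln K))" using K2 by (simp add: field_simps)
    finally show ?thesis by (simp add: qj)
  next
    case False
    thus ?thesis using q0 by (simp add: U_def)
  qed
  have V: "prob (V j) \<le> q ^ j" if "1 \<le> j" for j
  proof (cases "real j * K / n < 1")
    case True
    have Fj: "F (xs (real j * K / n)) = real j * K / n" using True that n K2 by (intro xs) auto
    have "V j = {\<omega>\<in>space M. (-1) * real j \<le> (-1) * (\<Sum>i=1..n. indicator (A (xs (real j * K / n))) (Z i \<omega>))}"
      using True by (simp add: V_def cnt_def)
    hence "prob (V j) \<le> exp (real n * (real j * K / n) * (exp (-1) - 1) - (-1) * real j)"
      using count_chernoff[of "A (xs (real j * K / n))" "-1" "real j" n] by (simp add: F Fj)
    also have "\<dots> = exp (real j * (1 + K * (exp (-1) - 1)))" using n by (simp add: field_simps)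
    also have "\<dots> \<le> exp (real j * (1 - ln K))"
    \<comment> \<open>Both sides are compared through \<open>K / 2\<close>:
      \<open>exp (- 1) - 1 <= - 1/2\<close>, and \<open>ln K <= K / 2\<close>.\<close>
    proof -
      have "exp (-1) \<le> (1/2::real)" using exp_ge_add_one_self[of 1] by (simp add: exp_minus field_simps)
      hence "K * (exp (-1) - 1) \<le> K * (-1/2)" using K2 by (intro mult_left_mono) auto
      moreover have "ln K \<le> K / 2"
      proof -
        have "ln (K/2) \<le> K/2 - 1" using K2 by (intro ln_le_minus_one) auto
        moreover have "ln (2::real) \<le> 1" using ln_le_minus_one[of 2] by simp
        ultimately show ?thesis using K2 by (simp add: ln_div)
      qed
      ultimately have "1 + K * (exp (-1) - 1) \<le> 1 - ln K" by simp
      thus ?thesis by (simp add: mult_left_mono)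
    qed
    finally show ?thesis by (simp add: qj)
  next
    case False
    thus ?thesis using q0 by (simp add: V_def)
  qed
  define bad where "bad = (\<Union>j\<in>{1..n}. U j \<union> V j)"
  have [measurable]: "bad \<in> events" unfolding bad_def by measurable
  have "prob bad \<le> (\<Sum>j=1..n. prob (U j \<union> V j))"
    unfolding bad_def by (intro finite_measure_subadditive_finite) auto
  also have "\<dots> \<le> (\<Sum>j=1..n. 2 * q ^ j)"
    by (intro sum_mono order_trans[OF measure_Un_le]) (use U V in \<open>force+\<close>)
  also have "\<dots> = 2 * q * (\<Sum>j<n. q ^ j)"
    by (simp add: sum.atLeast1_atMost_eq sum_distrib_left mult.assoc)
  also have "\<dots> = 2 * q * ((1 - q ^ n) / (1 - q))" using q1 by (simp add: sum_gp_strict)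
  also have "\<dots> \<le> 2 * q * (1 / (1 - q))" using q0 q1 by (intro mult_left_mono divide_right_mono) auto
  also have "\<dots> \<le> \<epsilon>" using q q1 by (simp add: field_simps)
  finally have bad: "prob bad \<le> \<epsilon>" .
  show "\<exists>E\<in>events. 1 - \<epsilon> \<le> prob E \<and>
          (\<forall>\<omega>\<in>E. (\<forall>x. emp n (A x) \<omega> \<le> K * F x) \<and> (\<forall>x. K / real n \<le> F x \<longrightarrow> F x \<le> K * emp n (A x) \<omega>))"
  proof (intro bexI[of _ "space M - bad"] conjI ballI allI impI)
    show "1 - \<epsilon> \<le> prob (space M - bad)" using bad by (simp add: prob_compl)
    fix \<omega> x assume \<omega>: "\<omega> \<in> space M - bad"
    have emp: "emp n (A x) \<omega> = cnt x \<omega> / n" by (simp add: emp_def cnt_def)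
    show "emp n (A x) \<omega> \<le> K * F x"
    proof (rule ccontr)
      assume "\<not> ?thesis"
      hence lt: "K * F x < cnt x \<omega> / n" by (simp add: emp)
      \<comment> \<open>The count \<open>j\<close> at \<open>x\<close> is an integer. If the ratio
        is too large, the point with \<open>F = j / (n K)\<close> lies to the right of
        \<open>x\<close>, so its count is at least \<open>j\<close>, which is the event
        \<open>U j\<close>.\<close>
      obtain j where j: "cnt x \<omega> = real j" "j \<le> n" using nat_cnt by blast
      have "0 < K * F x" using K2 F0[of x] by simp
      hence j1: "1 \<le> j" using lt j(1) by (cases j) auto
      have "real j / (n * K) \<le> real n / (n * K)" using j(2) K2 by (intro divide_right_mono) auto
      also have "\<dots> < 1" using K2 n by simp
      finally have lt1: "real j / (n * K) < 1" .
      have Fj: "F (xs (real j / (n * K))) = real j / (n * K)" using lt1 j1 n K2 by (intro xs) auto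
      have "F x < F (xs (real j / (n * K)))" unfolding Fj using lt j(1) n K2 by (simp add: field_simps)
      hence "x \<le> xs (real j / (n * K))" using Fmono by (meson not_less linear)
      hence "real j \<le> cnt (xs (real j / (n * K))) \<omega>" using cnt_mono[of x _ \<omega>] j(1) by simp
      hence "\<omega> \<in> U j" using lt1 \<omega> by (simp add: U_def)
      thus False using \<omega> j1 j(2) by (auto simp: bad_def)
    qed
    assume Kn: "K / real n \<le> F x"
    show "F x \<le> K * emp n (A x) \<omega>"
    proof (rule ccontr)
      assume neg: "\<not> ?thesis"
      \<comment> \<open>Rounding down leads to a point on the left of \<open>x\<close>, and
        \<open>K / n <= F x\<close> ensures \<open>1 <= j\<close>. Outside \<open>V j\<close> the
        count there exceeds \<open>j\<close>, so it is at least \<open>j + 1\<close>, and this makes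
        up for the rounding.\<close>
      define j where "j = nat \<lfloor>n * F x / K\<rfloor>"
      have r1: "1 \<le> n * F x / K" using Kn n K2 by (simp add: field_simps)
      hence j1: "1 \<le> j" by (simp add: j_def le_nat_iff le_floor_iff)
      have jle: "real j \<le> n * F x / K" unfolding j_def using r1 by (simp add: of_nat_floor)
      have jgt: "n * F x / K < real j + 1" unfolding j_def using r1 by linarith
      have le: "real j * K / n \<le> F x" using jle n K2 by (simp add: field_simps)
      hence lt1: "real j * K / n < 1" using F1[of x] by simp
      have Fj: "F (xs (real j * K / n)) = real j * K / n" using lt1 j1 n K2 by (intro xs) auto
      have "real n * F x / K \<le> n" using F1[of x] K2 n by (simp add: field_simps)
      hence jn: "j \<le> n" using jle by linarith
      have "\<omega> \<notin> V j" using \<omega> j1 jn by (auto simp: bad_def)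
      hence gt: "real j < cnt (xs (real j * K / n)) \<omega>" using lt1 \<omega> by (simp add: V_def)
      have "cnt (xs (real j * K / n)) \<omega> \<le> cnt x \<omega>"
      proof (cases "xs (real j * K / n) \<le> x")
        case False
        hence "F x < F (xs (real j * K / n))" by (intro Fstrict) simp
        thus ?thesis using Fj le by simp
      qed (rule cnt_mono)
      hence "real j < cnt x \<omega>" using gt by simp
      moreover obtain i where "cnt x \<omega> = real i" using nat_cnt by blast
      ultimately have "real j + 1 \<le> cnt x \<omega>" by simp
      hence "n * F x / K < cnt x \<omega>" using jgt by simp
      hence "F x < K * emp n (A x) \<omega>" using n K2 by (simp add: emp field_simps)
      thus False using neg by simp
    qed
  qed simp
qed

end

section \<open>Tails\<close>

text \<open>One tail in isolation, so that the right tail becomes an instance by reflection. The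
  assumption \<open>ratio\<close> is the integrated form of the bound on the logarithmic derivative:
  \<open>(ln f)'\<close> is at most \<gamma> times \<open>(ln F)'\<close> in absolute value, as long
  as \<open>F <= 1/2\<close>.\<close>

locale left_tail =
  fixes F f :: "real \<Rightarrow> real" and \<gamma> :: real
  assumes F_deriv: "\<And>x. (F has_real_derivative f x) (at x)"
    and f_cont: "continuous_on UNIV f"
    and f_pos: "\<And>x. 0 < f x" and F_pos: "\<And>x. 0 < F x"
    and F_bot: "(F \<longlongrightarrow> 0) at_bot"
    and gam: "0 \<le> \<gamma>"
    and ratio: "\<And>x y. x \<le> y \<Longrightarrow> F y \<le> 1/2 \<Longrightarrow> \<bar>ln (f y) - ln (f x)\<bar> \<le> \<gamma> * (ln (F y) - ln (F x))"
    and tail: "((\<lambda>x. F x / f x) \<longlongrightarrow> 0) at_bot"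
begin

lemma F_strict: "x < y \<Longrightarrow> F x < F y"
  using DERIV_pos_imp_increasing[of x y F] F_deriv f_pos by blast

lemma F_mono: "x \<le> y \<Longrightarrow> F x \<le> F y"
  using F_strict[of x y] by (cases "x = y") auto

lemma F_less_iff: "F x < F y \<longleftrightarrow> x < y"
  using F_strict F_mono by (meson not_less)

lemma F_cont: "continuous_on UNIV F"
  using F_deriv by (meson DERIV_isCont continuous_at_imp_continuous_on)

lemma F_measurable [measurable]: "F \<in> borel_measurable borel"
  using F_cont by (rule borel_measurable_continuous_onI)

lemma f_measurable [measurable]: "f \<in> borel_measurable borel"
  using f_cont by (rule borel_measurable_continuous_onI)

lemma F_le_eps_f:
  assumes "0 < \<epsilon>" obtains c where "\<And>x. x \<le> c \<Longrightarrow> F x \<le> \<epsilon> * f x"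
proof -
  have "eventually (\<lambda>x. F x / f x < \<epsilon>) at_bot" using tail assms by (rule order_tendstoD)
  then obtain c where "\<And>x. x \<le> c \<Longrightarrow> F x / f x < \<epsilon>" by (auto simp: eventually_at_bot_linorder)
  then have "F x \<le> \<epsilon> * f x" if "x \<le> c" for x
  proof -
    have "F x / f x < \<epsilon>" if "x \<le> c" for x using that \<open>\<And>x. x \<le> c \<Longrightarrow> F x / f x < \<epsilon>\<close> by blast
    from this[OF that] show ?thesis using f_pos[of x] by (simp add: pos_divide_less_eq less_imp_le)
  qed
  thus ?thesis using that by blast
qed

text \<open>The derivative of \<open>ln F\<close> is \<open>f / F\<close>, which exceeds
  \<open>1 / \<epsilon>\<close> far to the left. Over a distance \<open>d\<close> the logarithm thus
  gains \<open>d / \<epsilon>\<close>, and so any fixed factor \<open>K\<close> costs an arbitrarily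
  small shift.\<close>

lemma F_shift:
  assumes K: "1 \<le> K" and d: "0 < d" obtains c where "\<And>x. x \<le> c \<Longrightarrow> K * F x \<le> F (x + d)"
proof -
  \<comment> \<open>Chosen so that \<open>d / \<epsilon> = ln K + 1\<close>; the summand 1 keeps the
    denominator positive when \<open>K = 1\<close>.\<close>
  define \<epsilon> where "\<epsilon> = d / (ln K + 1)"
  have lK: "0 \<le> ln K" using K by simp
  have e: "0 < \<epsilon>" using d lK by (simp add: \<epsilon>_def)
  obtain c where c: "\<And>x. x \<le> c \<Longrightarrow> F x \<le> \<epsilon> * f x" using F_le_eps_f[OF e] by blast
  have "K * F x \<le> F (x + d)" if x: "x \<le> c - d" for x
  proof -
    have "\<exists>z>x. z < x + d \<and> ln (F (x + d)) - ln (F x) = (x + d - x) * (f z / F z)"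
      using d F_pos by (intro MVT2) (auto intro!: derivative_eq_intros F_deriv simp: less_imp_neq[OF F_pos, symmetric])
    then obtain z where z: "x < z" "z < x + d" "ln (F (x + d)) - ln (F x) = d * (f z / F z)" by auto
    have "F z \<le> \<epsilon> * f z" using z x by (intro c) simp
    hence "d / \<epsilon> \<le> d * (f z / F z)" using e d F_pos[of z] by (simp add: field_simps)
    moreover have "d / \<epsilon> = ln K + 1" using d lK by (simp add: \<epsilon>_def)
    ultimately have "ln (K * F x) \<le> ln (F (x + d))" using z(3) K F_pos[of x] by (simp add: ln_mult)
    thus ?thesis using K F_pos by (simp add: zero_less_mult_iff)
  qed
  thus ?thesis using that by blast
qed

text \<open>Inserting \<open>F ((x + y) / 2)\<close> between \<open>a x\<close> and \<open>b y\<close> splits \<open>max 0 (a x - b y)\<close> into a part which can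
  be integrated over \<open>y\<close> with \<open>x\<close> fixed and one which can be integrated over \<open>x\<close> with \<open>y\<close> fixed. In
  both, \<open>f\<close> at the midpoint and \<open>f\<close> at the fixed point differ at most by the factor \<open>exp (\<gamma> ln K)\<close>.\<close>
lemma upper_tail_inner:
  assumes K: "1 \<le> K" and a: "a \<le> K * F x" "a \<le> 1/2"
  shows "(\<integral>\<^sup>+y. ennreal (max 0 (a - F ((x + y) / 2))) * indicator {x<..} y \<partial>lborel)
    \<le> ennreal (2 * exp (\<gamma> * ln K) * ((a - F x)\<^sup>2 / f x))"
proof -
  define k where "k = exp (- (\<gamma> * ln K)) * f x"
  define e where "e = max 0 (a - F x)"
  have k: "0 < k" using f_pos by (simp add: k_def)
  \<comment> \<open>The integrand is at most \<open>e\<close>, and it vanishes once \<open>F\<close>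
    at the midpoint reaches \<open>a\<close>. Up to there the slope is at least \<open>k\<close>,
    which leaves an interval of length \<open>2 * e / k\<close>; the factor 2 is there because the
    midpoint moves at half the speed of \<open>y\<close>.\<close>
  have "ennreal (max 0 (a - F ((x + y) / 2))) * indicator {x<..} y \<le> ennreal e * indicator {x..x + 2 * e / k} y" for y
  proof (cases "x < y \<and> F ((x + y) / 2) < a")
    case True
    define m where "m = (x + y) / 2"
    have m: "x < m" "F m < a" using True by (auto simp: m_def)
    obtain z where z: "x < z" "z < m" "F m - F x = (m - x) * f z"
      using MVT2[of x m F f] m F_deriv by auto
    have Fz: "F z < a" using F_strict[OF z(2)] m by simp
    have "\<bar>ln (f z) - ln (f x)\<bar> \<le> \<gamma> * (ln (F z) - ln (F x))" using z Fz a by (intro ratio) auto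
    also have "\<dots> \<le> \<gamma> * ln K"
    proof (rule mult_left_mono[OF _ gam])
      have "ln (F z) \<le> ln (K * F x)" using Fz a F_pos[of z] by (intro ln_mono) auto
      thus "ln (F z) - ln (F x) \<le> ln K" using K F_pos[of x] by (simp add: ln_mult)
    qed
    finally have "- (\<gamma> * ln K) + ln (f x) \<le> ln (f z)" by linarith
    hence "exp (- (\<gamma> * ln K) + ln (f x)) \<le> exp (ln (f z))" by simp
    hence "k \<le> f z" using f_pos by (simp add: k_def exp_diff exp_minus field_simps)
    hence "(m - x) * k \<le> F m - F x" using m z(3) by simp
    also have "\<dots> \<le> e" using m by (simp add: e_def)
    finally have "y \<le> x + 2 * e / k" using k by (simp add: m_def field_simps)
    moreover have "a - F m \<le> e" using F_mono[of x m] m by (simp add: e_def)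
    ultimately show ?thesis using True m by (auto simp: m_def[symmetric] indicator_def intro!: ennreal_leI)
  next
    case False
    thus ?thesis by (auto simp: indicator_def max_def)
  qed
  hence "(\<integral>\<^sup>+y. ennreal (max 0 (a - F ((x + y) / 2))) * indicator {x<..} y \<partial>lborel) \<le>
    (\<integral>\<^sup>+y. ennreal e * indicator {x..x + 2 * e / k} y \<partial>lborel)" by (intro nn_integral_mono) auto
  also have "\<dots> = ennreal e * ennreal (2 * e / k)"
    using k by (subst nn_integral_cmult_indicator) (auto simp: e_def)
  also have "\<dots> = ennreal (e * (2 * e / k))" by (rule ennreal_mult'[symmetric]) (simp add: e_def)
  also have "e * (2 * e / k) = 2 * exp (\<gamma> * ln K) * (e\<^sup>2 / f x)"
    by (simp add: k_def exp_minus power2_eq_square field_simps)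
  also have "\<dots> \<le> ennreal (2 * exp (\<gamma> * ln K) * ((a - F x)\<^sup>2 / f x))"
    using f_pos[of x] by (intro ennreal_leI mult_left_mono divide_right_mono) (auto simp: e_def max_def)
  finally show ?thesis .
qed

lemma lower_tail_inner:
  assumes K: "1 \<le> K" and b: "F y \<le> K * b" "F y \<le> 1/2"
  shows "(\<integral>\<^sup>+x. ennreal (max 0 (F ((x + y) / 2) - b)) * indicator {..<y} x \<partial>lborel)
    \<le> ennreal (2 * exp (\<gamma> * ln K) * ((b - F y)\<^sup>2 / f y))"
proof -
  define k where "k = exp (- (\<gamma> * ln K)) * f y"
  define e where "e = max 0 (F y - b)"
  have k: "0 < k" using f_pos by (simp add: k_def)
  have "0 < K * b" using b(1) F_pos[of y] by simp
  hence b0: "0 < b" using K by (simp add: zero_less_mult_iff)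
  have "ennreal (max 0 (F ((x + y) / 2) - b)) * indicator {..<y} x \<le> ennreal e * indicator {y - 2 * e / k..y} x" for x
  proof (cases "x < y \<and> b < F ((x + y) / 2)")
    case True
    define m where "m = (x + y) / 2"
    have m: "m < y" "b < F m" using True by (auto simp: m_def)
    obtain z where z: "m < z" "z < y" "F y - F m = (y - m) * f z"
      using MVT2[of m y F f] m F_deriv by auto
    have Fz: "b < F z" using F_strict[OF z(1)] m by simp
    \<comment> \<open>Between the midpoint and \<open>y\<close> the values of \<open>F\<close>
      exceed \<open>b\<close>, and \<open>F y <= K * b\<close>; so \<open>F\<close> varies there at
      most by the factor \<open>K\<close>.\<close>
    have "\<bar>ln (f y) - ln (f z)\<bar> \<le> \<gamma> * (ln (F y) - ln (F z))" using z b by (intro ratio) auto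
    also have "\<dots> \<le> \<gamma> * ln K"
    proof (rule mult_left_mono[OF _ gam])
      have "K * b \<le> K * F z" using Fz K by (intro mult_left_mono) auto
      hence "ln (F y) \<le> ln (K * F z)" using b(1) F_pos[of y] by (intro ln_mono) auto
      thus "ln (F y) - ln (F z) \<le> ln K" using K F_pos[of z] by (simp add: ln_mult)
    qed
    finally have "- (\<gamma> * ln K) + ln (f y) \<le> ln (f z)" by linarith
    hence "exp (- (\<gamma> * ln K) + ln (f y)) \<le> exp (ln (f z))" by simp
    hence "k \<le> f z" using f_pos by (simp add: k_def exp_diff exp_minus field_simps)
    hence "(y - m) * k \<le> F y - F m" using m z(3) by simp
    also have "\<dots> \<le> e" using m by (simp add: e_def)
    finally have "y - 2 * e / k \<le> x" using k by (simp add: m_def field_simps)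
    moreover have "F m - b \<le> e" using F_mono[of m y] m by (simp add: e_def)
    ultimately show ?thesis using True m by (auto simp: m_def[symmetric] indicator_def intro!: ennreal_leI)
  next
    case False
    thus ?thesis by (auto simp: indicator_def max_def)
  qed
  hence "(\<integral>\<^sup>+x. ennreal (max 0 (F ((x + y) / 2) - b)) * indicator {..<y} x \<partial>lborel) \<le>
    (\<integral>\<^sup>+x. ennreal e * indicator {y - 2 * e / k..y} x \<partial>lborel)" by (intro nn_integral_mono) auto
  also have "\<dots> = ennreal e * ennreal (2 * e / k)"
    using k by (subst nn_integral_cmult_indicator) (auto simp: e_def)
  also have "\<dots> = ennreal (e * (2 * e / k))" by (rule ennreal_mult'[symmetric]) (simp add: e_def)
  also have "e * (2 * e / k) = 2 * exp (\<gamma> * ln K) * (e\<^sup>2 / f y)"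
    by (simp add: k_def exp_minus power2_eq_square field_simps)
  also have "\<dots> \<le> ennreal (2 * exp (\<gamma> * ln K) * ((b - F y)\<^sup>2 / f y))"
    using f_pos[of y] by (intro ennreal_leI mult_left_mono divide_right_mono) (auto simp: e_def max_def power2_commute)
  finally show ?thesis .
qed

lemma nn_integral_density_left: "(\<integral>\<^sup>+x. ennreal (f x) * indicator {..y} x \<partial>lborel) = ennreal (F y)"
proof -
  have "(\<integral>\<^sup>+x. ennreal (f x) * indicator {..y} x \<partial>lborel) = (\<integral>\<^sup>+x. ennreal (f (0 + (-1) * x)) * indicator {..y} (0 + (-1) * x) \<partial>lborel)"
    by (subst nn_integral_real_affine[of _ "-1" 0]) auto
  also have "\<dots> = (\<integral>\<^sup>+x. ennreal (f (- x)) * indicator {- y..} x \<partial>lborel)"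
    by (intro nn_integral_cong) (auto simp: indicator_def)
  also have "\<dots> = ennreal (0 - (- F (- (- y))))"
  proof (rule nn_integral_FTC_atLeast)
    show "((\<lambda>x. - F (- x)) has_real_derivative f (- x)) (at x)" for x
      by (auto intro!: derivative_eq_intros DERIV_chain2[OF F_deriv])
    have "((\<lambda>x. F (- x)) \<longlongrightarrow> 0) at_top"
      using filterlim_compose[OF F_bot filterlim_uminus_at_bot_at_top] by simp
    thus "((\<lambda>x. - F (- x)) \<longlongrightarrow> 0) at_top" using tendsto_minus by fastforce
  qed (use f_pos in \<open>auto intro: less_imp_le\<close>)
  finally show ?thesis by simp
qed

text \<open>The terms \<open>P\<close> and \<open>R\<close> are the two halves of the midpoint
  splitting. \<open>R\<close> needs \<open>F y <= K * b y\<close> and is restricted to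
  \<open>K / n <= F y\<close>; the term \<open>T\<close> covers the rest, where \<open>b y\<close>
  may be 0. There \<open>a x <= K F x\<close>. Integrating \<open>F <= \<epsilon> f\<close> over
  \<open>x\<close> gives \<open>K \<epsilon> F y <= K \<epsilon>^2 f y\<close>, and \<open>f\<close>
  has mass at most \<open>K / n\<close> on this region. The resulting error is of order
  \<open>1 / n\<close>, just small enough for the factor \<open>n\<close> in front of the
  cost.\<close>

lemma left_tail_deterministic:
  fixes a b :: "real \<Rightarrow> real"
  assumes [measurable]: "a \<in> borel_measurable borel" "b \<in> borel_measurable borel"
    and K: "1 \<le> K" and \<epsilon>: "0 < \<epsilon>" and c: "\<And>x. x \<le> c \<Longrightarrow> F x \<le> \<epsilon> * f x" and Kc: "K * F c \<le> 1/2"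
    and b0: "\<And>y. 0 \<le> b y" and n: "1 \<le> (n::nat)"
    and aK: "\<And>x. x < c \<Longrightarrow> a x \<le> K * F x"
    and bK: "\<And>y. y < c \<Longrightarrow> K / real n \<le> F y \<Longrightarrow> F y \<le> K * b y"
  shows "(\<integral>\<^sup>+x. \<integral>\<^sup>+y. ennreal (max 0 (a x - b y)) * indicator {(x, y). x < y \<and> y < c} (x, y) \<partial>lborel \<partial>lborel)
    \<le> (\<integral>\<^sup>+x. ennreal (2 * exp (\<gamma> * ln K) * ((a x - F x)\<^sup>2 / f x)) * indicator {..<c} x \<partial>lborel)
      + (\<integral>\<^sup>+x. ennreal (2 * exp (\<gamma> * ln K) * ((b x - F x)\<^sup>2 / f x)) * indicator {..<c} x \<partial>lborel)
      + ennreal (K\<^sup>2 * \<epsilon>\<^sup>2 / real n)"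
proof -
  have Fc: "F c \<le> 1/2" using mult_right_mono[OF K less_imp_le[OF F_pos[of c]]] Kc by simp
  define P where "P x y = ennreal (max 0 (a x - F ((x + y) / 2))) * (indicator {..<c} x * indicator {(x, y). x < y} (x, y))" for x y
  define R where "R x y = ennreal (max 0 (F ((x + y) / 2) - b y)) * (indicator {y. y < c \<and> K / real n \<le> F y} y * indicator {(x, y). x < y} (x, y))" for x y
  define T where "T x y = ennreal (K * F x) * (indicator {y. y < c \<and> F y < K / real n} y * indicator {(x, y). x < y} (x, y))" for x y
  have [measurable]: "(\<lambda>(x, y). P x y) \<in> borel_measurable (borel \<Otimes>\<^sub>M borel)" "(\<lambda>(x, y). R x y) \<in> borel_measurable (borel \<Otimes>\<^sub>M borel)"
    "(\<lambda>(x, y). T x y) \<in> borel_measurable (borel \<Otimes>\<^sub>M borel)"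
    unfolding P_def R_def T_def by measurable
  have [measurable]: "(\<lambda>y. P x y) \<in> borel_measurable borel" "(\<lambda>y. R x y) \<in> borel_measurable borel" "(\<lambda>y. T x y) \<in> borel_measurable borel" for x
    unfolding P_def R_def T_def by measurable
  have split: "ennreal (max 0 (a x - b y)) * indicator {(x, y). x < y \<and> y < c} (x, y) \<le> P x y + (R x y + T x y)" for x y
  proof (cases "x < y \<and> y < c")
    case True
    hence x: "x < c" by simp
    show ?thesis
    proof (cases "K / real n \<le> F y")
      case True
      have "ennreal (max 0 (a x - b y)) \<le> ennreal (max 0 (a x - F ((x + y) / 2)) + max 0 (F ((x + y) / 2) - b y))"
        by (intro ennreal_leI) auto
      thus ?thesis using True \<open>x < y \<and> y < c\<close> x by (simp add: P_def R_def T_def)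
    next
      case False
      have "max 0 (a x - b y) \<le> K * F x" using aK[OF x] b0[of y] K F_pos[of x] by (auto simp: max_def mult_nonneg_nonneg less_imp_le)
      hence "ennreal (max 0 (a x - b y)) \<le> ennreal (K * F x)" by (rule ennreal_leI)
      thus ?thesis using False \<open>x < y \<and> y < c\<close> x by (simp add: P_def R_def T_def add_increasing)
    qed
  qed simp
  have IP: "(\<integral>\<^sup>+y. P x y \<partial>lborel) \<le> ennreal (2 * exp (\<gamma> * ln K) * ((a x - F x)\<^sup>2 / f x)) * indicator {..<c} x" for x
  proof (cases "x < c")
    case True
    have "K * F x \<le> K * F c" using K True F_mono[of x c] by (intro mult_left_mono) auto
    hence "a x \<le> 1/2" using aK[OF True] Kc by simp
    hence "(\<integral>\<^sup>+y. ennreal (max 0 (a x - F ((x + y) / 2))) * indicator {x<..} y \<partial>lborel) \<le> ennreal (2 * exp (\<gamma> * ln K) * ((a x - F x)\<^sup>2 / f x))"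
      using upper_tail_inner[OF K aK[OF True]] by simp
    moreover have "(\<integral>\<^sup>+y. P x y \<partial>lborel) = (\<integral>\<^sup>+y. ennreal (max 0 (a x - F ((x + y) / 2))) * indicator {x<..} y \<partial>lborel)"
      using True by (intro nn_integral_cong) (auto simp: P_def indicator_def)
    ultimately show ?thesis using True by simp
  qed (simp add: P_def)
  have IR: "(\<integral>\<^sup>+x. R x y \<partial>lborel) \<le> ennreal (2 * exp (\<gamma> * ln K) * ((b y - F y)\<^sup>2 / f y)) * indicator {..<c} y" for y
  proof (cases "y < c \<and> K / real n \<le> F y")
    case True
    have "F y \<le> 1/2" using F_mono[of y c] True Fc by simp
    hence "(\<integral>\<^sup>+x. ennreal (max 0 (F ((x + y) / 2) - b y)) * indicator {..<y} x \<partial>lborel) \<le> ennreal (2 * exp (\<gamma> * ln K) * ((b y - F y)\<^sup>2 / f y))"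
      using lower_tail_inner[OF K bK] True by simp
    moreover have "(\<integral>\<^sup>+x. R x y \<partial>lborel) = (\<integral>\<^sup>+x. ennreal (max 0 (F ((x + y) / 2) - b y)) * indicator {..<y} x \<partial>lborel)"
      using True by (intro nn_integral_cong) (auto simp: R_def indicator_def)
    ultimately show ?thesis using True by simp
  qed (auto simp: R_def)
  have IT: "(\<integral>\<^sup>+x. T x y \<partial>lborel) \<le> ennreal (K * \<epsilon>\<^sup>2) * (ennreal (f y) * indicator {y. y < c \<and> F y < K / real n} y)" for y
  proof (cases "y < c \<and> F y < K / real n")
    case True
    have "(\<integral>\<^sup>+x. T x y \<partial>lborel) \<le> (\<integral>\<^sup>+x. ennreal (K * \<epsilon>) * (ennreal (f x) * indicator {..y} x) \<partial>lborel)"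
    proof (intro nn_integral_mono)
      fix x
      show "T x y \<le> ennreal (K * \<epsilon>) * (ennreal (f x) * indicator {..y} x)"
      proof (cases "x < y")
        case True
        hence "F x \<le> \<epsilon> * f x" using c[of x] \<open>y < c \<and> _\<close> by simp
        hence "K * F x \<le> K * \<epsilon> * f x" using K by simp
        hence "ennreal (K * F x) \<le> ennreal (K * \<epsilon>) * ennreal (f x)" using f_pos[of x] by (simp add: ennreal_leI flip: ennreal_mult'')
        thus ?thesis using True \<open>y < c \<and> _\<close> by (simp add: T_def)
      qed (simp add: T_def)
    qed
    also have "\<dots> = ennreal (K * \<epsilon>) * ennreal (F y)"
      by (subst nn_integral_cmult) (auto simp: nn_integral_density_left)
    also have "\<dots> \<le> ennreal (K * \<epsilon>) * ennreal (\<epsilon> * f y)"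
      using c[of y] True by (intro mult_left_mono ennreal_leI) auto
    also have "\<dots> = ennreal (K * \<epsilon>\<^sup>2) * ennreal (f y)"
      using K \<epsilon> f_pos[of y] by (simp add: ennreal_mult[symmetric] power2_eq_square mult_ac)
    finally show ?thesis using True by simp
  qed (auto simp: T_def)
  have low: "(\<integral>\<^sup>+y. ennreal (f y) * indicator {y. y < c \<and> F y < K / real n} y \<partial>lborel) \<le> ennreal (K / real n)"
  proof -
    \<comment> \<open>The region lies in a half line ending at \<open>c\<close> or at the point
      where \<open>F\<close> equals \<open>K / n\<close>, whichever comes first.\<close>
    obtain z where z: "\<And>y. y < c \<Longrightarrow> F y < K / real n \<Longrightarrow> y \<le> z" "F z \<le> K / real n"
    proof (cases "F c \<le> K / real n")
      case True
      thus ?thesis using that[of c] by simp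
    next
      case False
      have "0 < K / real n" using K n by simp
      hence "eventually (\<lambda>x. F x < K / real n) at_bot" using F_bot by (rule order_tendstoD(2)[rotated])
      then obtain y0 where y0: "\<And>y. y \<le> y0 \<Longrightarrow> F y < K / real n" by (auto simp: eventually_at_bot_linorder)
      have "\<exists>z\<ge>min y0 c. z \<le> c \<and> F z = K / real n"
        using y0[of "min y0 c"] False by (intro IVT' continuous_on_subset[OF F_cont]) auto
      then obtain z where z: "F z = K / real n" by blast
      show ?thesis
      proof (rule that[of z])
        fix y assume "F y < K / real n" thus "y \<le> z" using z F_less_iff[of y z] by simp
      qed (use z in simp)
    qed
    have "(\<integral>\<^sup>+y. ennreal (f y) * indicator {y. y < c \<and> F y < K / real n} y \<partial>lborel) \<le> (\<integral>\<^sup>+y. ennreal (f y) * indicator {..z} y \<partial>lborel)"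
      using z(1) by (intro nn_integral_mono) (auto simp: indicator_def)
    also have "\<dots> \<le> ennreal (K / real n)" using z(2) by (simp add: nn_integral_density_left ennreal_leI)
    finally show ?thesis .
  qed
  have "(\<integral>\<^sup>+x. \<integral>\<^sup>+y. ennreal (max 0 (a x - b y)) * indicator {(x, y). x < y \<and> y < c} (x, y) \<partial>lborel \<partial>lborel)
    \<le> (\<integral>\<^sup>+x. \<integral>\<^sup>+y. P x y + (R x y + T x y) \<partial>lborel \<partial>lborel)"
    by (intro nn_integral_mono split)
  also have "\<dots> = (\<integral>\<^sup>+x. (\<integral>\<^sup>+y. P x y \<partial>lborel) + ((\<integral>\<^sup>+y. R x y \<partial>lborel) + (\<integral>\<^sup>+y. T x y \<partial>lborel)) \<partial>lborel)"
    by (simp add: nn_integral_add)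
  also have "\<dots> = (\<integral>\<^sup>+x. \<integral>\<^sup>+y. P x y \<partial>lborel \<partial>lborel) + ((\<integral>\<^sup>+x. \<integral>\<^sup>+y. R x y \<partial>lborel \<partial>lborel) + (\<integral>\<^sup>+x. \<integral>\<^sup>+y. T x y \<partial>lborel \<partial>lborel))"
    by (subst nn_integral_add, measurable, subst nn_integral_add, measurable)
  also have "(\<integral>\<^sup>+x. \<integral>\<^sup>+y. R x y \<partial>lborel \<partial>lborel) = (\<integral>\<^sup>+y. \<integral>\<^sup>+x. R x y \<partial>lborel \<partial>lborel)"
    by (rule lborel_pair.Fubini'[symmetric]) measurable
  also have "(\<integral>\<^sup>+x. \<integral>\<^sup>+y. T x y \<partial>lborel \<partial>lborel) = (\<integral>\<^sup>+y. \<integral>\<^sup>+x. T x y \<partial>lborel \<partial>lborel)"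
    by (rule lborel_pair.Fubini'[symmetric]) measurable
  also have "(\<integral>\<^sup>+x. \<integral>\<^sup>+y. P x y \<partial>lborel \<partial>lborel) + ((\<integral>\<^sup>+y. \<integral>\<^sup>+x. R x y \<partial>lborel \<partial>lborel) + (\<integral>\<^sup>+y. \<integral>\<^sup>+x. T x y \<partial>lborel \<partial>lborel))
    \<le> (\<integral>\<^sup>+x. ennreal (2 * exp (\<gamma> * ln K) * ((a x - F x)\<^sup>2 / f x)) * indicator {..<c} x \<partial>lborel)
      + ((\<integral>\<^sup>+x. ennreal (2 * exp (\<gamma> * ln K) * ((b x - F x)\<^sup>2 / f x)) * indicator {..<c} x \<partial>lborel)
      + ennreal (K * \<epsilon>\<^sup>2) * ennreal (K / real n))"
  proof (intro add_mono)
    have "(\<integral>\<^sup>+y. \<integral>\<^sup>+x. T x y \<partial>lborel \<partial>lborel) \<le> (\<integral>\<^sup>+y. ennreal (K * \<epsilon>\<^sup>2) * (ennreal (f y) * indicator {y. y < c \<and> F y < K / real n} y) \<partial>lborel)"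
      by (intro nn_integral_mono IT)
    also have "\<dots> = ennreal (K * \<epsilon>\<^sup>2) * (\<integral>\<^sup>+y. ennreal (f y) * indicator {y. y < c \<and> F y < K / real n} y \<partial>lborel)"
      by (rule nn_integral_cmult) measurable
    also have "\<dots> \<le> ennreal (K * \<epsilon>\<^sup>2) * ennreal (K / real n)" by (intro mult_left_mono low) auto
    finally show "(\<integral>\<^sup>+y. \<integral>\<^sup>+x. T x y \<partial>lborel \<partial>lborel) \<le> ennreal (K * \<epsilon>\<^sup>2) * ennreal (K / real n)" .
  qed (intro nn_integral_mono IP IR)+
  also have "ennreal (K * \<epsilon>\<^sup>2) * ennreal (K / real n) = ennreal (K\<^sup>2 * \<epsilon>\<^sup>2 / real n)"
    using K by (simp add: ennreal_mult[symmetric] power2_eq_square mult_ac)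
  finally show ?thesis by (simp add: add.assoc)
qed

end

lemma nn_integral_left_small:
  fixes g :: "real \<Rightarrow> ennreal"
  assumes [measurable]: "g \<in> borel_measurable borel"
    and fin: "(\<integral>\<^sup>+x. g x * indicator {..<c1} x \<partial>lborel) < \<infinity>" and d: "0 < \<delta>"
  obtains c where "(\<integral>\<^sup>+x. g x * indicator {..<c} x \<partial>lborel) < \<delta>"
proof -
  have "(\<lambda>k. \<integral>\<^sup>+x. g x * indicator {..<min c1 (- real k)} x \<partial>lborel) \<longlonglongrightarrow> (\<integral>\<^sup>+x. 0 \<partial>(lborel :: real measure))"
  proof (rule nn_integral_dominated_convergence[where w="\<lambda>x. g x * indicator {..<c1} x"])
    show "AE x in lborel. (\<lambda>k. g x * indicator {..<min c1 (- real k)} x) \<longlonglongrightarrow> 0"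
    proof (rule AE_I2)
      fix x
      have "eventually (\<lambda>k. - x \<le> real k) sequentially"
        using filterlim_real_sequentially by (auto simp: filterlim_at_top)
      hence "eventually (\<lambda>k. g x * indicator {..<min c1 (- real k)} x = 0) sequentially"
        by (elim eventually_mono) (auto simp: indicator_def)
      thus "(\<lambda>k. g x * indicator {..<min c1 (- real k)} x) \<longlonglongrightarrow> 0" by (rule tendsto_eventually)
    qed
  qed (use fin in \<open>auto simp: indicator_def\<close>)
  hence "eventually (\<lambda>k. (\<integral>\<^sup>+x. g x * indicator {..<min c1 (- real k)} x \<partial>lborel) < \<delta>) sequentially"
    using d by (intro order_tendstoD(2)[where y=0]) auto
  then obtain k where "(\<integral>\<^sup>+x. g x * indicator {..<min c1 (- real k)} x \<partial>lborel) < \<delta>"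
    by (auto simp: eventually_sequentially)
  thus ?thesis by (rule that)
qed

lemma (in left_tail) F_onto:
  assumes "(F \<longlongrightarrow> 1) at_top" "0 < u" "u < 1" shows "\<exists>x. F x = u"
proof -
  have "eventually (\<lambda>x. F x < u) at_bot" using F_bot assms(2) by (rule order_tendstoD)
  then obtain x0 where x0: "F x0 < u" by (auto simp: eventually_at_bot_linorder)
  have "eventually (\<lambda>x. u < F x) at_top" using assms(1,3) by (rule order_tendstoD)
  then obtain x1 where x1: "u < F x1" by (auto simp: eventually_at_top_linorder)
  have "x0 < x1" using x0 x1 F_less_iff[of x0 x1] by simp
  thus ?thesis using x0 x1 IVT'[of F x0 u x1] continuous_on_subset[OF F_cont] by fastforce
qed

section \<open>Probabilistic bounds for the tails\<close>

context iid_sample begin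

lemma emp_joint_measurable:
  assumes [measurable]: "(\<lambda>(x, z). indicator (A x) z :: real) \<in> borel_measurable (borel \<Otimes>\<^sub>M S)"
  shows "(\<lambda>(x::real, \<omega>). emp n (A x) \<omega>) \<in> borel_measurable (borel \<Otimes>\<^sub>M M)"
proof -
  have "(\<lambda>(x, \<omega>). indicator (A x) (Z i \<omega>) :: real) \<in> borel_measurable (borel \<Otimes>\<^sub>M M)" if "i \<in> {1..n}" for i
  proof -
    have "1 \<le> i" using that by simp
    note [measurable] = Z_meas[OF this]
    have "(\<lambda>p. (fst p, Z i (snd p))) \<in> measurable (borel \<Otimes>\<^sub>M M) (borel \<Otimes>\<^sub>M S)"
      by measurable
    from measurable_compose[OF this assms] show ?thesis by (simp add: split_beta')
  qed
  hence "(\<lambda>p. (\<Sum>i=1..n. case p of (x, \<omega>) \<Rightarrow> indicator (A x) (Z i \<omega>)) / real n) \<in> borel_measurable (borel \<Otimes>\<^sub>M M)"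
    by (intro borel_measurable_divide borel_measurable_sum) auto
  thus ?thesis by (simp add: emp_def split_beta')
qed

lemma nn_integral_cemp_indicator_sq:
  assumes [measurable]: "A \<in> sets S"
  shows "(\<integral>\<^sup>+\<omega>. ennreal ((cemp n (indicator A) \<omega>)\<^sup>2) \<partial>M) \<le> ennreal (measure law A)"
proof -
  interpret L: prob_space law by (rule prob_space_law)
  have "(LINT \<omega>|M. (cemp n (indicator A) \<omega>)\<^sup>2) \<le> (LINT z|law. (indicator A z)\<^sup>2)"
    by (rule second_moment_cemp_le(2)[of _ 1]) auto
  also have "(LINT z|law. (indicator A z :: real)\<^sup>2) = (LINT z|law. (indicator A z :: real))"
    by (intro Bochner_Integration.integral_cong) (auto simp: indicator_def)
  also have "\<dots> = measure law A"
    by (simp add: Bochner_Integration.integral_indicator Int_absorb2 sets.sets_into_space)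
  finally have "(LINT \<omega>|M. (cemp n (indicator A) \<omega>)\<^sup>2) \<le> measure law A" .
  moreover have "integrable M (\<lambda>\<omega>. (cemp n (indicator A) \<omega>)\<^sup>2)"
    by (rule second_moment_cemp_le(1)[of _ 1]) auto
  ultimately show ?thesis by (simp add: nn_integral_eq_integral ennreal_leI)
qed

text \<open>Fubini reduces the claim to a fixed \<open>x\<close>, where
  \<open>n E (emp - F)^2\<close> is a variance and at most \<open>F x\<close>. The bound is
  therefore the same for all \<open>n\<close>.\<close>

lemma tail_second_moment:
  fixes F f :: "real \<Rightarrow> real" and A :: "real \<Rightarrow> 'c set"
  assumes A [measurable]: "\<And>x. A x \<in> sets S"
    and Am: "(\<lambda>(x, z). indicator (A x) z :: real) \<in> borel_measurable (borel \<Otimes>\<^sub>M S)"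
    and F: "\<And>x. measure law (A x) = F x"
    and [measurable]: "F \<in> borel_measurable borel" "f \<in> borel_measurable borel" and f: "\<And>x. 0 < f x"
    and C: "0 \<le> C"
  shows "(\<integral>\<^sup>+\<omega>. ennreal (real n) * (\<integral>\<^sup>+x. ennreal (C * ((emp n (A x) \<omega> - F x)\<^sup>2 / f x)) * indicator {..<c} x \<partial>lborel) \<partial>M)
    \<le> ennreal C * (\<integral>\<^sup>+x. ennreal (F x / f x) * indicator {..<c} x \<partial>lborel)"
proof -
  interpret P: pair_sigma_finite lborel M ..
  note [measurable] = emp_joint_measurable[OF Am]
  have [measurable]: "(\<lambda>(\<omega>, x). emp n (A x) \<omega>) \<in> borel_measurable (M \<Otimes>\<^sub>M borel)"
    using measurable_compose[OF measurable_pair_swap' emp_joint_measurable[OF Am]] by (simp add: split_beta' cong: measurable_cong_sets)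
  have [measurable]: "(\<lambda>x. emp n (A x) \<omega>) \<in> borel_measurable borel" if "\<omega> \<in> space M" for \<omega>
    using measurable_Pair1[OF emp_joint_measurable[OF Am] that] by simp
  have meas: "(\<lambda>(x, \<omega>). ennreal (C * ((cemp n (indicator (A x)) \<omega>)\<^sup>2 / f x)) * indicator {..<c} x) \<in> borel_measurable (lborel \<Otimes>\<^sub>M M)"
    by (simp add: cemp_indicator F)
  have "(\<integral>\<^sup>+\<omega>. ennreal (real n) * (\<integral>\<^sup>+x. ennreal (C * ((emp n (A x) \<omega> - F x)\<^sup>2 / f x)) * indicator {..<c} x \<partial>lborel) \<partial>M) =
     (\<integral>\<^sup>+\<omega>. \<integral>\<^sup>+x. ennreal (C * ((cemp n (indicator (A x)) \<omega>)\<^sup>2 / f x)) * indicator {..<c} x \<partial>lborel \<partial>M)"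
  proof (intro nn_integral_cong)
    fix \<omega> assume [measurable]: "\<omega> \<in> space M"
    have "ennreal (real n) * (\<integral>\<^sup>+x. ennreal (C * ((emp n (A x) \<omega> - F x)\<^sup>2 / f x)) * indicator {..<c} x \<partial>lborel)
      = (\<integral>\<^sup>+x. ennreal (real n) * (ennreal (C * ((emp n (A x) \<omega> - F x)\<^sup>2 / f x)) * indicator {..<c} x) \<partial>lborel)"
      by (rule nn_integral_cmult[symmetric]) measurable
    also have "\<dots> = (\<integral>\<^sup>+x. ennreal (C * ((cemp n (indicator (A x)) \<omega>)\<^sup>2 / f x)) * indicator {..<c} x \<partial>lborel)"
    proof (intro nn_integral_cong)
      fix x
      have "C * ((cemp n (indicator (A x)) \<omega>)\<^sup>2 / f x) = real n * (C * ((emp n (A x) \<omega> - F x)\<^sup>2 / f x))"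
        by (simp add: cemp_indicator F power_mult_distrib)
      thus "ennreal (real n) * (ennreal (C * ((emp n (A x) \<omega> - F x)\<^sup>2 / f x)) * indicator {..<c} x)
        = ennreal (C * ((cemp n (indicator (A x)) \<omega>)\<^sup>2 / f x)) * indicator {..<c} x"
        by (simp only: ennreal_mult' of_nat_0_le_iff mult.assoc)
    qed
    finally show "ennreal (real n) * (\<integral>\<^sup>+x. ennreal (C * ((emp n (A x) \<omega> - F x)\<^sup>2 / f x)) * indicator {..<c} x \<partial>lborel) = \<dots>" .
  qed
  also have "\<dots> = (\<integral>\<^sup>+x. \<integral>\<^sup>+\<omega>. ennreal (C * ((cemp n (indicator (A x)) \<omega>)\<^sup>2 / f x)) * indicator {..<c} x \<partial>M \<partial>lborel)"
    using P.Fubini'[OF meas] .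
  also have "\<dots> \<le> (\<integral>\<^sup>+x. ennreal C * (ennreal (F x / f x) * indicator {..<c} x) \<partial>lborel)"
  proof (intro nn_integral_mono)
    fix x
    have "(\<integral>\<^sup>+\<omega>. ennreal (C * ((cemp n (indicator (A x)) \<omega>)\<^sup>2 / f x)) * indicator {..<c} x \<partial>M) =
      (\<integral>\<^sup>+\<omega>. (ennreal (C / f x) * indicator {..<c} x) * ennreal ((cemp n (indicator (A x)) \<omega>)\<^sup>2) \<partial>M)"
      using C f[of x] by (intro nn_integral_cong) (auto simp: ennreal_mult''[symmetric] indicator_def)
    also have "\<dots> = (ennreal (C / f x) * indicator {..<c} x) * (\<integral>\<^sup>+\<omega>. ennreal ((cemp n (indicator (A x)) \<omega>)\<^sup>2) \<partial>M)"
      by (rule nn_integral_cmult) measurable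
    also have "\<dots> \<le> (ennreal (C / f x) * indicator {..<c} x) * ennreal (F x)"
      using nn_integral_cemp_indicator_sq[OF A, of n x] by (intro mult_left_mono) (auto simp: F)
    also have "\<dots> = ennreal C * (ennreal (F x / f x) * indicator {..<c} x)"
      using C f[of x] F[of x, symmetric] by (auto simp: ennreal_mult'[symmetric] indicator_def)
    finally show "(\<integral>\<^sup>+\<omega>. ennreal (C * ((cemp n (indicator (A x)) \<omega>)\<^sup>2 / f x)) * indicator {..<c} x \<partial>M) \<le> ennreal C * (ennreal (F x / f x) * indicator {..<c} x)" .
  qed
  also have "\<dots> = ennreal C * (\<integral>\<^sup>+x. ennreal (F x / f x) * indicator {..<c} x \<partial>lborel)"
    by (rule nn_integral_cmult) measurable
  finally show ?thesis .
qed

text \<open>Three exceptional events of probability at most \<open>\<eta> / 4\<close> are removed: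
  bad ratios for \<open>A\<close>, bad ratios for \<open>B\<close>, and a large value of the
  weighted square deviation \<open>V\<close>. Besides the small tail integral, the conclusion
  records that the empirical functions are ordered after a shift by \<open>d\<close>; this later
  bounds the distance of the quantiles near the ends.\<close>

lemma left_tail_bound:
  fixes F f :: "real \<Rightarrow> real" and A B :: "real \<Rightarrow> 'c set"
  assumes lt: "left_tail F f \<gamma>" and F1: "\<And>x. F x < 1" and Ftop: "(F \<longlongrightarrow> 1) at_top"
    and fin: "(\<integral>\<^sup>+x. ennreal (F x / f x) * indicator {..<c1} x \<partial>lborel) < \<infinity>"
    and A [measurable]: "\<And>x. A x \<in> sets S" and Amono: "\<And>x y. x \<le> y \<Longrightarrow> A x \<subseteq> A y"
    and Am: "(\<lambda>(x, z). indicator (A x) z :: real) \<in> borel_measurable (borel \<Otimes>\<^sub>M S)"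
    and FA: "\<And>x. measure law (A x) = F x"
    and B [measurable]: "\<And>x. B x \<in> sets S" and Bmono: "\<And>x y. x \<le> y \<Longrightarrow> B x \<subseteq> B y"
    and Bm: "(\<lambda>(x, z). indicator (B x) z :: real) \<in> borel_measurable (borel \<Otimes>\<^sub>M S)"
    and FB: "\<And>x. measure law (B x) = F x"
    and \<eta>: "0 < \<eta>" and d: "0 < d"
  obtains c0 where "\<And>c n. c \<le> c0 \<Longrightarrow> 1 \<le> n \<Longrightarrow> \<exists>E\<in>events. 1 - \<eta> \<le> prob E \<and> (\<forall>\<omega>\<in>E.
      ennreal (real n) * (\<integral>\<^sup>+x. \<integral>\<^sup>+y. ennreal (max 0 (emp n (A x) \<omega> - emp n (B y) \<omega>)) * indicator {(x, y). x < y \<and> y < c} (x, y) \<partial>lborel \<partial>lborel) \<le> ennreal \<eta> \<and>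
      (\<forall>x<c. emp n (A x) \<omega> \<le> emp n (B (x + d)) \<omega>))"
proof -
  interpret T: left_tail F f \<gamma> by fact
  have \<eta>4: "0 < \<eta> / 4" using \<eta> by simp
  obtain K where K: "1 \<le> K" and ratio: "\<And>n F A. 1 \<le> n \<Longrightarrow> (\<And>x. A x \<in> sets S) \<Longrightarrow> (\<And>x y. x \<le> y \<Longrightarrow> A x \<subseteq> A y) \<Longrightarrow>
       (\<And>x. measure law (A x) = F x) \<Longrightarrow> (\<And>u. 0 < u \<Longrightarrow> u < 1 \<Longrightarrow> \<exists>x::real. F x = u) \<Longrightarrow>
       (\<And>x. 0 < F x) \<Longrightarrow> (\<And>x. F x < 1) \<Longrightarrow> (\<And>x y. x < y \<Longrightarrow> F x < F y) \<Longrightarrow>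
       \<exists>E\<in>events. 1 - \<eta>/4 \<le> prob E \<and>
          (\<forall>\<omega>\<in>E. (\<forall>x. emp n (A x) \<omega> \<le> K * F x) \<and> (\<forall>x. K / real n \<le> F x \<longrightarrow> F x \<le> K * emp n (A x) \<omega>))"
    using ratio_events[OF \<eta>4] by blast
  \<comment> \<open>Then \<open>K^2 * \<epsilon>^2 = \<eta> / 2\<close>; the other half of \<eta> is
    reserved for \<open>V\<close>.\<close>
  define \<epsilon> where "\<epsilon> = sqrt (\<eta> / 2) / K"
  have \<epsilon>: "0 < \<epsilon>" and \<epsilon>2: "K\<^sup>2 * \<epsilon>\<^sup>2 = \<eta> / 2" using \<eta> K by (auto simp: \<epsilon>_def power_divide)
  define C where "C = 2 * exp (\<gamma> * ln K)"
  have C: "0 < C" by (simp add: C_def)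
  obtain c2 where c2: "\<And>x. x \<le> c2 \<Longrightarrow> F x \<le> \<epsilon> * f x" using T.F_le_eps_f[OF \<epsilon>] by blast
  \<comment> \<open>One factor \<open>K\<close> pays for the upper bound on the frequency of
    \<open>A x\<close>, the other for the lower bound on that of \<open>B (x + d)\<close>.\<close>
  obtain c3 where c3: "\<And>x. x \<le> c3 \<Longrightarrow> K\<^sup>2 * F x \<le> F (x + d)" using T.F_shift[OF _ d, of "K\<^sup>2"] K by auto
  have "eventually (\<lambda>x. F x < 1 / (2 * K)) at_bot" using T.F_bot K by (intro order_tendstoD) auto
  then obtain c4 where c4: "F c4 < 1 / (2 * K)" by (auto simp: eventually_at_bot_linorder)
  \<comment> \<open>This makes the mean of \<open>V\<close> at most \<open>\<eta>^2 / 8\<close>, so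
    by Markov's inequality \<open>V\<close> reaches \<open>\<eta> / 2\<close> with probability at
    most \<open>\<eta> / 4\<close>.\<close>
  obtain c5 where c5: "(\<integral>\<^sup>+x. ennreal (F x / f x) * indicator {..<c5} x \<partial>lborel) < ennreal (\<eta>\<^sup>2 / (16 * C))"
    by (rule nn_integral_left_small[OF _ fin, of "ennreal (\<eta>\<^sup>2 / (16 * C))"]) (use \<eta> C in auto)
  define c0 where "c0 = min (min c2 c3) (min c4 c5)"
  show thesis
  proof (rule that[of c0])
    fix c n assume c: "c \<le> c0" and n: "1 \<le> (n::nat)"
    have onto: "\<And>u. 0 < u \<Longrightarrow> u < 1 \<Longrightarrow> \<exists>x. F x = u" using T.F_onto[OF Ftop] by blast
    obtain E1 where E1: "E1 \<in> events" "1 - \<eta>/4 \<le> prob E1"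
      "\<And>\<omega> x. \<omega> \<in> E1 \<Longrightarrow> emp n (A x) \<omega> \<le> K * F x"
      using ratio[OF n A Amono FA onto T.F_pos F1 T.F_strict] by blast
    obtain E2 where E2: "E2 \<in> events" "1 - \<eta>/4 \<le> prob E2"
      "\<And>\<omega> x. \<omega> \<in> E2 \<Longrightarrow> K / real n \<le> F x \<Longrightarrow> F x \<le> K * emp n (B x) \<omega>"
      using ratio[OF n B Bmono FB onto T.F_pos F1 T.F_strict] by blast
    define V where "V \<omega> = ennreal (real n) * (\<integral>\<^sup>+x. ennreal (C * ((emp n (A x) \<omega> - F x)\<^sup>2 / f x)) * indicator {..<c} x \<partial>lborel)
        + ennreal (real n) * (\<integral>\<^sup>+x. ennreal (C * ((emp n (B x) \<omega> - F x)\<^sup>2 / f x)) * indicator {..<c} x \<partial>lborel)" for \<omega>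
    have jm: "(\<lambda>(\<omega>, x). emp n (A x) \<omega>) \<in> borel_measurable (M \<Otimes>\<^sub>M borel)"
      if "(\<lambda>(x, z). indicator (A x) z :: real) \<in> borel_measurable (borel \<Otimes>\<^sub>M S)" for A :: "real \<Rightarrow> _"
      using measurable_compose[OF measurable_pair_swap' emp_joint_measurable[OF that]] by (simp add: split_beta' cong: measurable_cong_sets)
    note [measurable] = jm[OF Am] jm[OF Bm]
    have Vm [measurable]: "V \<in> borel_measurable M" unfolding V_def by measurable
    have "(\<integral>\<^sup>+\<omega>. V \<omega> \<partial>M) \<le> ennreal C * (\<integral>\<^sup>+x. ennreal (F x / f x) * indicator {..<c} x \<partial>lborel) + ennreal C * (\<integral>\<^sup>+x. ennreal (F x / f x) * indicator {..<c} x \<partial>lborel)"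
      unfolding V_def using tail_second_moment[OF A Am FA T.F_measurable T.f_measurable T.f_pos, of C n c] tail_second_moment[OF B Bm FB T.F_measurable T.f_measurable T.f_pos, of C n c] C
      by (subst nn_integral_add) (measurable, intro add_mono, auto)
    also have "\<dots> = ennreal (2 * C) * (\<integral>\<^sup>+x. ennreal (F x / f x) * indicator {..<c} x \<partial>lborel)"
    proof -
      have "ennreal (2 * C) = ennreal C + ennreal C" using C by (simp flip: ennreal_plus)
      thus ?thesis by (simp only: distrib_right)
    qed
    also have "\<dots> \<le> ennreal (2 * C) * (\<integral>\<^sup>+x. ennreal (F x / f x) * indicator {..<c5} x \<partial>lborel)"
      using c by (intro mult_left_mono nn_integral_mono) (auto simp: indicator_def c0_def)
    also have "\<dots> \<le> ennreal (2 * C) * ennreal (\<eta>\<^sup>2 / (16 * C))" using c5 by (intro mult_left_mono) auto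
    also have "\<dots> = ennreal (\<eta>\<^sup>2 / 8)" using C by (simp add: ennreal_mult'[symmetric])
    finally have EV: "(\<integral>\<^sup>+\<omega>. V \<omega> \<partial>M) \<le> ennreal (\<eta>\<^sup>2 / 8)" .
    define W where "W = {\<omega>\<in>space M. 1 \<le> ennreal (2 / \<eta>) * V \<omega>}"
    have Wm [measurable]: "W \<in> events" unfolding W_def by measurable
    have "emeasure M W \<le> ennreal (2 / \<eta>) * (\<integral>\<^sup>+\<omega>. V \<omega> * indicator (space M) \<omega> \<partial>M)"
      unfolding W_def by (rule nn_integral_Markov_inequality) measurable
    also have "(\<integral>\<^sup>+\<omega>. V \<omega> * indicator (space M) \<omega> \<partial>M) = (\<integral>\<^sup>+\<omega>. V \<omega> \<partial>M)" by (intro nn_integral_cong) auto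
    also have "ennreal (2 / \<eta>) * (\<integral>\<^sup>+\<omega>. V \<omega> \<partial>M) \<le> ennreal (2 / \<eta>) * ennreal (\<eta>\<^sup>2 / 8)" by (intro mult_left_mono EV) auto
    also have "\<dots> = ennreal (\<eta> / 4)" using \<eta> by (simp add: ennreal_mult'[symmetric] power2_eq_square)
    finally have PW: "prob W \<le> \<eta> / 4" using \<eta> by (simp add: emeasure_eq_measure)
    define E where "E = E1 \<inter> E2 - W"
    have [measurable]: "E1 \<in> events" "E2 \<in> events" "E \<in> events" using E1(1) E2(1) by (auto simp: E_def)
    have "space M - E \<subseteq> (space M - E1) \<union> (space M - E2) \<union> W" by (auto simp: E_def)
    hence "prob (space M - E) \<le> prob ((space M - E1) \<union> (space M - E2) \<union> W)" by (intro finite_measure_mono) auto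
    also have "\<dots> \<le> prob (space M - E1) + prob (space M - E2) + prob W"
      by (intro order_trans[OF measure_Un_le] add_mono order_refl) auto
    also have "\<dots> \<le> \<eta>/4 + \<eta>/4 + \<eta>/4" using E1(2) E2(2) PW by (simp add: prob_compl)
    finally have PE: "1 - \<eta> \<le> prob E" using \<eta> by (simp add: prob_compl)
    show "\<exists>E\<in>events. 1 - \<eta> \<le> prob E \<and> (\<forall>\<omega>\<in>E.
      ennreal (real n) * (\<integral>\<^sup>+x. \<integral>\<^sup>+y. ennreal (max 0 (emp n (A x) \<omega> - emp n (B y) \<omega>)) * indicator {(x, y). x < y \<and> y < c} (x, y) \<partial>lborel \<partial>lborel) \<le> ennreal \<eta> \<and>
      (\<forall>x<c. emp n (A x) \<omega> \<le> emp n (B (x + d)) \<omega>))"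
    proof (intro bexI[of _ E] conjI ballI allI impI PE)
      fix \<omega> assume \<omega>: "\<omega> \<in> E"
      hence \<omega>M [measurable]: "\<omega> \<in> space M" using sets.sets_into_space[OF E1(1)] by (auto simp: E_def)
      have \<omega>12: "\<omega> \<in> E1" "\<omega> \<in> E2" using \<omega> by (auto simp: E_def)
      have Kc: "K * F c \<le> 1/2"
      proof -
        have "F c \<le> 1 / (2 * K)" using c4 T.F_mono[of c c4] c by (simp add: c0_def)
        thus ?thesis using K by (simp add: field_simps)
      qed
      have "(\<integral>\<^sup>+x. \<integral>\<^sup>+y. ennreal (max 0 (emp n (A x) \<omega> - emp n (B y) \<omega>)) * indicator {(x, y). x < y \<and> y < c} (x, y) \<partial>lborel \<partial>lborel)
         \<le> (\<integral>\<^sup>+x. ennreal (C * ((emp n (A x) \<omega> - F x)\<^sup>2 / f x)) * indicator {..<c} x \<partial>lborel)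
          + (\<integral>\<^sup>+x. ennreal (C * ((emp n (B x) \<omega> - F x)\<^sup>2 / f x)) * indicator {..<c} x \<partial>lborel)
          + ennreal (K\<^sup>2 * \<epsilon>\<^sup>2 / real n)"
        unfolding C_def
      proof (rule T.left_tail_deterministic[OF _ _ K \<epsilon> _ Kc emp_nonneg n])
        show "(\<lambda>x. emp n (A x) \<omega>) \<in> borel_measurable borel" "(\<lambda>x. emp n (B x) \<omega>) \<in> borel_measurable borel"
          by (auto intro!: borel_measurable_mono monoI emp_mono Amono Bmono)
        show "F x \<le> \<epsilon> * f x" if "x \<le> c" for x using that c by (intro c2) (simp add: c0_def)
      qed (use E1(3)[OF \<omega>12(1)] E2(3)[OF \<omega>12(2)] in auto)
      hence "ennreal (real n) * (\<integral>\<^sup>+x. \<integral>\<^sup>+y. ennreal (max 0 (emp n (A x) \<omega> - emp n (B y) \<omega>)) * indicator {(x, y). x < y \<and> y < c} (x, y) \<partial>lborel \<partial>lborel)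
         \<le> ennreal (real n) * ((\<integral>\<^sup>+x. ennreal (C * ((emp n (A x) \<omega> - F x)\<^sup>2 / f x)) * indicator {..<c} x \<partial>lborel)
          + (\<integral>\<^sup>+x. ennreal (C * ((emp n (B x) \<omega> - F x)\<^sup>2 / f x)) * indicator {..<c} x \<partial>lborel)
          + ennreal (K\<^sup>2 * \<epsilon>\<^sup>2 / real n))" by (rule mult_left_mono) simp
      also have "\<dots> = V \<omega> + ennreal (real n) * ennreal (K\<^sup>2 * \<epsilon>\<^sup>2 / real n)" by (simp add: V_def distrib_left)
      also have "ennreal (real n) * ennreal (K\<^sup>2 * \<epsilon>\<^sup>2 / real n) = ennreal (\<eta> / 2)"
        using n by (simp add: \<epsilon>2 ennreal_mult'[symmetric])
      also have "V \<omega> + ennreal (\<eta> / 2) \<le> ennreal (\<eta> / 2) + ennreal (\<eta> / 2)"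
      proof (rule add_right_mono)
        have "ennreal (2 / \<eta>) * V \<omega> < 1" using \<omega> \<omega>M by (auto simp: E_def W_def)
        hence "ennreal (\<eta> / 2) * (ennreal (2 / \<eta>) * V \<omega>) \<le> ennreal (\<eta> / 2) * 1" by (intro mult_left_mono) auto
        moreover have "ennreal (\<eta> / 2) * (ennreal (2 / \<eta>) * V \<omega>) = V \<omega>"
          using \<eta> by (simp add: mult.assoc[symmetric] ennreal_mult'[symmetric])
        ultimately show "V \<omega> \<le> ennreal (\<eta> / 2)" by simp
      qed
      also have "\<dots> = ennreal \<eta>" using \<eta> by (simp add: ennreal_plus[symmetric] del: ennreal_plus)
      finally show "ennreal (real n) * (\<integral>\<^sup>+x. \<integral>\<^sup>+y. ennreal (max 0 (emp n (A x) \<omega> - emp n (B y) \<omega>)) * indicator {(x, y). x < y \<and> y < c} (x, y) \<partial>lborel \<partial>lborel) \<le> ennreal \<eta>" .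
      fix x assume x: "x < c"
      show "emp n (A x) \<omega> \<le> emp n (B (x + d)) \<omega>"
      proof (cases "emp n (A x) \<omega> = 0")
        case False
        \<comment> \<open>If the frequency is not 0, at least one sample point is counted, hence
          \<open>1 <= n K F x\<close>. This puts \<open>F (x + d)\<close> above
          \<open>K / n\<close>, where the lower ratio bound for \<open>B\<close> is
          available.\<close>
        define N where "N = card {i\<in>{1..n}. Z i \<omega> \<in> A x}"
        have e: "real n * emp n (A x) \<omega> = real N"
          using n by (simp add: emp_def N_def indicator_def sum.If_cases Int_def)
        have "real N \<noteq> 0" unfolding e[symmetric] using False n by simp
        hence "1 \<le> real n * emp n (A x) \<omega>" unfolding e by simp
        also have "\<dots> \<le> real n * (K * F x)" using E1(3)[OF \<omega>12(1)] by (intro mult_left_mono) auto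
        finally have 1: "1 \<le> real n * (K * F x)" .
        have 2: "K\<^sup>2 * F x \<le> F (x + d)" using x c by (intro c3) (simp add: c0_def)
        have "K / real n \<le> K\<^sup>2 * F x" using mult_left_mono[OF 1, of K] K n by (simp add: field_simps power2_eq_square)
        hence "F (x + d) \<le> K * emp n (B (x + d)) \<omega>" using 2 by (intro E2(3)[OF \<omega>12(2)]) simp
        hence "K * (K * F x) \<le> K * emp n (B (x + d)) \<omega>" using 2 by (simp add: power2_eq_square)
        hence "K * F x \<le> emp n (B (x + d)) \<omega>" using K by simp
        thus ?thesis using E1(3)[OF \<omega>12(1), of x] by simp
      qed (simp add: emp_nonneg)
    qed simp
  qed
qed

end

section \<open>Local linearisation\<close>

context iid_sample begin

lemma emp_Diff:
  assumes "A \<subseteq> B" shows "emp n (B - A) \<omega> = emp n B \<omega> - emp n A \<omega>"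
proof -
  have "indicator (B - A) z = (indicator B z - indicator A z :: real)" for z
    using assms by (auto simp: indicator_def)
  thus ?thesis by (simp add: emp_def sum_subtractf diff_divide_distrib)
qed

text \<open>The increment is \<open>cemp\<close> of the difference set, whose second moment is at
  most \<open>s^2\<close>. The inequality \<open>|t| <= s/2 + t^2 / (2 s)\<close> with this
  \<open>s\<close> has the effect of the Cauchy-Schwarz inequality.\<close>

lemma nn_integral_abs_increment:
  assumes [measurable]: "A \<in> sets S" "B \<in> sets S" and sub: "A \<subseteq> B" and lt: "measure law A < measure law B"
  shows "(\<integral>\<^sup>+\<omega>. ennreal \<bar>cemp n (indicator B) \<omega> - cemp n (indicator A) \<omega>\<bar> \<partial>M) \<le> ennreal (sqrt (measure law B - measure law A))"
proof -
  interpret L: prob_space law by (rule prob_space_law)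
  define s where "s = sqrt (measure law B - measure law A)"
  have s: "0 < s" "measure law B - measure law A = s * s" using lt by (auto simp: s_def)
  have D: "measure law (B - A) = s * s" using sub by (subst L.finite_measure_Diff) (auto simp: s(2))
  define h where "h = cemp n (indicator (B - A))"
  have h: "cemp n (indicator B) \<omega> - cemp n (indicator A) \<omega> = h \<omega>" for \<omega>
    unfolding h_def using s(2) by (simp add: cemp_indicator emp_Diff[OF sub] D algebra_simps)
  have [measurable]: "h \<in> borel_measurable M" unfolding h_def by measurable
  have le: "\<bar>t\<bar> \<le> s / 2 + 1 / (2 * s) * t\<^sup>2" for t :: real
  proof -
    have "0 \<le> (s - \<bar>t\<bar>)\<^sup>2" by simp
    hence "2 * s * \<bar>t\<bar> \<le> s\<^sup>2 + t\<^sup>2" by (simp add: power2_diff)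
    thus ?thesis using s(1) by (simp add: field_simps power2_eq_square)
  qed
  have "(\<integral>\<^sup>+\<omega>. ennreal \<bar>h \<omega>\<bar> \<partial>M) \<le> (\<integral>\<^sup>+\<omega>. ennreal (s / 2) + ennreal (1 / (2 * s)) * ennreal ((h \<omega>)\<^sup>2) \<partial>M)"
    using le s(1) by (intro nn_integral_mono) (auto simp: ennreal_mult'[symmetric] ennreal_plus[symmetric] intro!: ennreal_leI simp del: ennreal_plus)
  also have "\<dots> = ennreal (s / 2) + ennreal (1 / (2 * s)) * (\<integral>\<^sup>+\<omega>. ennreal ((h \<omega>)\<^sup>2) \<partial>M)"
    by (subst nn_integral_add) (auto simp: nn_integral_cmult emeasure_space_1)
  also have "\<dots> \<le> ennreal (s / 2) + ennreal (1 / (2 * s)) * ennreal (s * s)"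
    unfolding h_def using nn_integral_cemp_indicator_sq[of "B - A" n] D by (intro add_left_mono mult_left_mono) auto
  also have "\<dots> = ennreal s"
    using s(1) by (simp add: ennreal_mult'[symmetric] ennreal_plus[symmetric] del: ennreal_plus)
  finally show ?thesis by (simp add: h s_def)
qed

text \<open>The two counts are dependent;
  \<open>exp (x - y) <= (exp (2 x) + exp (- 2 y)) / 2\<close> decouples them. The constant
  \<open>exp (1/2)\<close> is the sub-Gaussian bound at \<open>t = 2\<close> and
  \<open>t = - 2\<close>.\<close>

lemma nn_integral_exp_difference:
  assumes [measurable]: "A \<in> sets S" "B \<in> sets S" and n: "1 \<le> n"
  shows "(\<integral>\<^sup>+\<omega>. ennreal (exp (cemp n (indicator A) \<omega> - cemp n (indicator B) \<omega> - t)) \<partial>M) \<le> ennreal (exp (1/2) * exp (- t))"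
proof -
  have le: "exp (x - y - t) \<le> exp (- t) / 2 * exp (2 * x) + exp (- t) / 2 * exp (-2 * y)" for x y :: real
  proof -
    have "0 \<le> (exp x - exp (- y))\<^sup>2" by simp
    hence "2 * (exp x * exp (- y)) \<le> exp (2 * x) + exp (-2 * y)"
      by (simp add: power2_diff exp_double[symmetric] exp_of_nat_mult[symmetric] mult.assoc)
    hence "exp (- t) * (2 * (exp x * exp (- y))) \<le> exp (- t) * (exp (2 * x) + exp (-2 * y))" by (rule mult_left_mono) simp
    moreover have "exp (x - y - t) = exp (- t) * (exp x * exp (- y))" by (simp add: exp_add[symmetric])
    ultimately show ?thesis by (simp add: algebra_simps)
  qed
  have "(\<integral>\<^sup>+\<omega>. ennreal (exp (cemp n (indicator A) \<omega> - cemp n (indicator B) \<omega> - t)) \<partial>M)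
    \<le> (\<integral>\<^sup>+\<omega>. ennreal (exp (- t) / 2) * ennreal (exp (2 * cemp n (indicator A) \<omega>)) + ennreal (exp (- t) / 2) * ennreal (exp (-2 * cemp n (indicator B) \<omega>)) \<partial>M)"
    using le by (intro nn_integral_mono) (simp add: ennreal_mult'[symmetric] ennreal_plus[symmetric] ennreal_leI del: ennreal_plus)
  also have "\<dots> = ennreal (exp (- t) / 2) * (\<integral>\<^sup>+\<omega>. ennreal (exp (2 * cemp n (indicator A) \<omega>)) \<partial>M) + ennreal (exp (- t) / 2) * (\<integral>\<^sup>+\<omega>. ennreal (exp (-2 * cemp n (indicator B) \<omega>)) \<partial>M)"
    by (subst nn_integral_add) (auto simp: nn_integral_cmult)
  also have "\<dots> \<le> ennreal (exp (- t) / 2) * ennreal (exp (1/2)) + ennreal (exp (- t) / 2) * ennreal (exp (1/2))"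
    using cemp_hoeffding[OF _ n, of A 2] cemp_hoeffding[OF _ n, of B "-2"] by (intro add_mono mult_left_mono) auto
  also have "\<dots> = ennreal (exp (1/2) * exp (- t))"
    by (simp add: ennreal_mult'[symmetric] ennreal_plus[symmetric] mult.commute del: ennreal_plus)
  finally show ?thesis .
qed

text \<open>The point \<open>p = (x, r)\<close> stands for the pair \<open>x < y = x + r / sqrt n\<close> with \<open>y < x + 1\<close>.\<close>
lemma local_difference_tendsto:
  fixes F f :: "real \<Rightarrow> real" and A B :: "real \<Rightarrow> 'c set"
  assumes F_deriv: "\<And>x. (F has_real_derivative f x) (at x)" and f_cont: "continuous_on UNIV f" and f_pos: "\<And>x. 0 < f x"
    and A [measurable]: "\<And>x. A x \<in> sets S"
    and Am: "(\<lambda>(x, z). indicator (A x) z :: real) \<in> borel_measurable (borel \<Otimes>\<^sub>M S)"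
    and FA: "\<And>x. measure law (A x) = F x"
    and B [measurable]: "\<And>x. B x \<in> sets S" and Bmono: "\<And>x y. x \<le> y \<Longrightarrow> B x \<subseteq> B y"
    and Bm: "(\<lambda>(x, z). indicator (B x) z :: real) \<in> borel_measurable (borel \<Otimes>\<^sub>M S)"
    and FB: "\<And>x. measure law (B x) = F x"
  shows "(\<lambda>n. \<integral>\<^sup>+\<omega>. \<integral>\<^sup>+p. ennreal \<bar>max 0 (sqrt (real n) * (emp n (A (fst p)) \<omega> - emp n (B (fst p + snd p / sqrt (real n))) \<omega>)) * indicator {..<sqrt (real n)} (snd p)
            - max 0 (sqrt (real n) * (emp n (A (fst p)) \<omega> - emp n (B (fst p)) \<omega>) - f (fst p) * snd p)\<bar>
          * indicator ({-L..L} \<times> {0<..}) p \<partial>(lborel \<Otimes>\<^sub>M lborel) \<partial>M) \<longlonglongrightarrow> 0"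
proof -
  interpret LL: sigma_finite_measure "lborel \<Otimes>\<^sub>M lborel :: (real \<times> real) measure"
    by (rule lborel_pair.sigma_finite_measure_axioms)
  interpret P: pair_sigma_finite "lborel \<Otimes>\<^sub>M lborel :: (real \<times> real) measure" M ..
  have F_strict: "F x < F y" if "x < y" for x y
    using DERIV_pos_imp_increasing[OF that, of F] F_deriv f_pos by blast
  have F_cont: "isCont F x" for x using F_deriv DERIV_isCont by blast
  have [measurable]: "f \<in> borel_measurable borel" using f_cont by (rule borel_measurable_continuous_onI)
  have jA [measurable]: "(\<lambda>(x, \<omega>). emp n (A x) \<omega>) \<in> borel_measurable (borel \<Otimes>\<^sub>M M)" for n by (rule emp_joint_measurable[OF Am])
  have jB [measurable]: "(\<lambda>(x, \<omega>). emp n (B x) \<omega>) \<in> borel_measurable (borel \<Otimes>\<^sub>M M)" for n by (rule emp_joint_measurable[OF Bm])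
  define p where "p n x r \<omega> = max 0 (sqrt (real n) * (emp n (A x) \<omega> - emp n (B (x + r / sqrt (real n))) \<omega>)) * indicator {..<sqrt (real n)} r" for n x r \<omega>
  define q where "q n x r \<omega> = max 0 (sqrt (real n) * (emp n (A x) \<omega> - emp n (B x) \<omega>) - f x * r)" for n x r \<omega>
  have pm [measurable]: "(\<lambda>(z, \<omega>). p n (fst z) (snd z) \<omega>) \<in> borel_measurable ((borel \<Otimes>\<^sub>M borel) \<Otimes>\<^sub>M M)"
    "(\<lambda>(z, \<omega>). q n (fst z) (snd z) \<omega>) \<in> borel_measurable ((borel \<Otimes>\<^sub>M borel) \<Otimes>\<^sub>M M)" for n
    unfolding p_def q_def by measurable
  have pm' [measurable]: "p n x r \<in> borel_measurable M" "q n x r \<in> borel_measurable M" for n x r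
    unfolding p_def[abs_def] q_def[abs_def] by measurable
  \<comment> \<open>The interval extends to \<open>L + 1\<close> because \<open>y\<close> may lie up
    to 1 to the right of \<open>x\<close>.\<close>
  obtain c where c: "0 < c" "\<And>x. x \<in> {-L..L+1} \<Longrightarrow> c \<le> f x"
  proof (cases "{-L..L+1} = {}")
    case True thus ?thesis using that[of 1] by auto
  next
    case False
    then obtain x0 where "x0 \<in> {-L..L+1}" "\<And>x. x \<in> {-L..L+1} \<Longrightarrow> f x0 \<le> f x"
      using continuous_attains_inf[of "{-L..L+1}" f] continuous_on_subset[OF f_cont] by auto
    thus ?thesis using that[of "f x0"] f_pos by blast
  qed
  have alpha: "sqrt (real n) * (emp n (A x) \<omega> - emp n (B y) \<omega>) = cemp n (indicator (A x)) \<omega> - cemp n (indicator (B y)) \<omega> - sqrt (real n) * (F y - F x)" for n x y \<omega>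
    by (simp add: cemp_indicator FA FB algebra_simps)
  have max_exp: "max 0 t \<le> exp t" for t :: real using exp_ge_add_one_self[of t] by (auto simp: max_def intro: order_trans[of _ "1 + t"])
  \<comment> \<open>The dominating function: \<open>max 0 t <= exp t\<close>, and both drifts,
    \<open>sqrt n (F y - F x)\<close> and \<open>f x * r\<close>, are at least \<open>c * r\<close>,
    so both terms decay exponentially in \<open>r\<close> uniformly in \<open>n\<close>.\<close>
  have bound: "(\<integral>\<^sup>+\<omega>. ennreal \<bar>p n x r \<omega> - q n x r \<omega>\<bar> \<partial>M) \<le> ennreal (2 * exp (1/2) * exp (- (c * r)))"
    if n: "1 \<le> n" and x: "x \<in> {-L..L}" and r: "0 < r" for n x r
  proof -
    have Ep: "(\<integral>\<^sup>+\<omega>. ennreal (p n x r \<omega>) \<partial>M) \<le> ennreal (exp (1/2) * exp (- (c * r)))"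
    proof (cases "r < sqrt (real n)")
      case True
      define y where "y = x + r / sqrt (real n)"
      have y: "x < y" "y \<le> x + 1" using True r n by (auto simp: y_def)
      obtain z where z: "x < z" "z < y" "F y - F x = (y - x) * f z" using MVT2[OF y(1), of F f] F_deriv by auto
      have "c \<le> f z" using z y x by (intro c) auto
      hence "(y - x) * c \<le> F y - F x" using y z by simp
      hence "sqrt (real n) * ((y - x) * c) \<le> sqrt (real n) * (F y - F x)" by (intro mult_left_mono) auto
      moreover have "sqrt (real n) * ((y - x) * c) = c * r" using n by (simp add: y_def)
      ultimately have cr: "c * r \<le> sqrt (real n) * (F y - F x)" by simp
      have "p n x r \<omega> \<le> exp (cemp n (indicator (A x)) \<omega> - cemp n (indicator (B y)) \<omega> - c * r)" for \<omega>
      proof -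
        have "p n x r \<omega> = max 0 (sqrt (real n) * (emp n (A x) \<omega> - emp n (B y) \<omega>))" using True by (simp add: p_def y_def)
        also have "\<dots> \<le> exp (sqrt (real n) * (emp n (A x) \<omega> - emp n (B y) \<omega>))" by (rule max_exp)
        also have "\<dots> \<le> exp (cemp n (indicator (A x)) \<omega> - cemp n (indicator (B y)) \<omega> - c * r)"
          unfolding alpha using cr by simp
        finally show ?thesis .
      qed
      hence "(\<integral>\<^sup>+\<omega>. ennreal (p n x r \<omega>) \<partial>M) \<le> (\<integral>\<^sup>+\<omega>. ennreal (exp (cemp n (indicator (A x)) \<omega> - cemp n (indicator (B y)) \<omega> - c * r)) \<partial>M)"
        by (intro nn_integral_mono ennreal_leI)
      also have "\<dots> \<le> ennreal (exp (1/2) * exp (- (c * r)))" by (rule nn_integral_exp_difference[OF A B n])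
      finally show ?thesis .
    qed (simp add: p_def)
    have "q n x r \<omega> \<le> exp (cemp n (indicator (A x)) \<omega> - cemp n (indicator (B x)) \<omega> - c * r)" for \<omega>
    proof -
      have "q n x r \<omega> \<le> exp (sqrt (real n) * (emp n (A x) \<omega> - emp n (B x) \<omega>) - f x * r)" unfolding q_def by (rule max_exp)
      also have "\<dots> \<le> exp (cemp n (indicator (A x)) \<omega> - cemp n (indicator (B x)) \<omega> - c * r)"
        unfolding alpha using c(2)[of x] x r by (simp add: mult_right_mono)
      finally show ?thesis .
    qed
    hence "(\<integral>\<^sup>+\<omega>. ennreal (q n x r \<omega>) \<partial>M) \<le> (\<integral>\<^sup>+\<omega>. ennreal (exp (cemp n (indicator (A x)) \<omega> - cemp n (indicator (B x)) \<omega> - c * r)) \<partial>M)"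
      by (intro nn_integral_mono ennreal_leI)
    also have "\<dots> \<le> ennreal (exp (1/2) * exp (- (c * r)))" by (rule nn_integral_exp_difference[OF A B n])
    finally have Eq: "(\<integral>\<^sup>+\<omega>. ennreal (q n x r \<omega>) \<partial>M) \<le> ennreal (exp (1/2) * exp (- (c * r)))" .
    have pq: "0 \<le> p n x r \<omega>" "0 \<le> q n x r \<omega>" for \<omega> by (auto simp: p_def q_def)
    have "(\<integral>\<^sup>+\<omega>. ennreal \<bar>p n x r \<omega> - q n x r \<omega>\<bar> \<partial>M) \<le> (\<integral>\<^sup>+\<omega>. ennreal (p n x r \<omega>) + ennreal (q n x r \<omega>) \<partial>M)"
      using pq by (intro nn_integral_mono) (auto simp: ennreal_plus[symmetric] abs_if intro!: ennreal_leI simp del: ennreal_plus)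
    also have "\<dots> = (\<integral>\<^sup>+\<omega>. ennreal (p n x r \<omega>) \<partial>M) + (\<integral>\<^sup>+\<omega>. ennreal (q n x r \<omega>) \<partial>M)" by (rule nn_integral_add) measurable
    also have "\<dots> \<le> ennreal (exp (1/2) * exp (- (c * r))) + ennreal (exp (1/2) * exp (- (c * r)))" by (intro add_mono Ep Eq)
    also have "\<dots> = ennreal (2 * exp (1/2) * exp (- (c * r)))" by (simp add: ennreal_plus[symmetric] del: ennreal_plus)
    finally show ?thesis .
  qed
  \<comment> \<open>For fixed \<open>(x, r)\<close> the error splits into a random increment of the
    empirical process over an interval shrinking to a point and the deterministic error of a
    difference quotient of \<open>F\<close>.\<close>
  have lim: "(\<lambda>n. \<integral>\<^sup>+\<omega>. ennreal \<bar>p n x r \<omega> - q n x r \<omega>\<bar> \<partial>M) \<longlonglongrightarrow> 0" if r: "0 < r" for x r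
  proof -
    define y where "y n = x + r / sqrt (real n)" for n :: nat
    define e where "e n = sqrt (F (y n) - F x) + \<bar>sqrt (real n) * (F (y n) - F x) - f x * r\<bar>" for n
    have h0: "(\<lambda>n. r / sqrt (real n)) \<longlonglongrightarrow> 0"
      by (intro tendsto_divide_0[OF tendsto_const] filterlim_at_top_imp_at_infinity filterlim_compose[OF sqrt_at_top filterlim_real_sequentially])
    hence y0: "y \<longlonglongrightarrow> x" unfolding y_def using tendsto_add[OF tendsto_const[of x] h0] by simp
    hence 1: "(\<lambda>n. sqrt (F (y n) - F x)) \<longlonglongrightarrow> 0"
      using tendsto_real_sqrt[OF tendsto_diff[OF isCont_tendsto_compose[OF F_cont[of x] y0] tendsto_const[of "F x"]]] by simp
    have "((\<lambda>h. (F (x + h) - F x) / h) \<longlongrightarrow> f x) (at 0)" using F_deriv[of x] by (simp add: DERIV_def)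
    moreover have "filterlim (\<lambda>n. r / sqrt (real n)) (at 0) sequentially"
      using h0 r by (auto simp: filterlim_at intro!: eventually_sequentiallyI[of 1])
    ultimately have "(\<lambda>n. (F (x + r / sqrt (real n)) - F x) / (r / sqrt (real n))) \<longlonglongrightarrow> f x" by (rule filterlim_compose)
    hence "(\<lambda>n. (F (y n) - F x) / (r / sqrt (real n)) * r) \<longlonglongrightarrow> f x * r" unfolding y_def by (intro tendsto_mult tendsto_const)
    moreover have "(F (y n) - F x) / (r / sqrt (real n)) * r = sqrt (real n) * (F (y n) - F x)" for n using r by simp
    ultimately have "(\<lambda>n. sqrt (real n) * (F (y n) - F x) - f x * r) \<longlonglongrightarrow> 0" by (simp add: LIM_zero)
    hence e0: "e \<longlonglongrightarrow> 0" unfolding e_def using tendsto_add[OF 1 tendsto_rabs_zero] by simp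
    have le: "(\<integral>\<^sup>+\<omega>. ennreal \<bar>p n x r \<omega> - q n x r \<omega>\<bar> \<partial>M) \<le> ennreal (e n)" if n: "1 \<le> n" "r < sqrt (real n)" for n
    proof -
      have xy: "x < y n" using r n by (simp add: y_def)
      have "\<bar>p n x r \<omega> - q n x r \<omega>\<bar> \<le> \<bar>cemp n (indicator (B (y n))) \<omega> - cemp n (indicator (B x)) \<omega>\<bar> + \<bar>sqrt (real n) * (F (y n) - F x) - f x * r\<bar>" for \<omega>
      proof -
        have "p n x r \<omega> = max 0 (sqrt (real n) * (emp n (A x) \<omega> - emp n (B (y n)) \<omega>))" using n by (simp add: p_def y_def)
        moreover have "\<bar>max 0 a - max 0 b\<bar> \<le> \<bar>a - b\<bar>" for a b :: real by auto
        ultimately have "\<bar>p n x r \<omega> - q n x r \<omega>\<bar> \<le> \<bar>sqrt (real n) * (emp n (A x) \<omega> - emp n (B (y n)) \<omega>) - (sqrt (real n) * (emp n (A x) \<omega> - emp n (B x) \<omega>) - f x * r)\<bar>"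
          by (simp add: q_def)
        thus ?thesis unfolding alpha diff_self mult_zero_right by linarith
      qed
      hence "(\<integral>\<^sup>+\<omega>. ennreal \<bar>p n x r \<omega> - q n x r \<omega>\<bar> \<partial>M) \<le> (\<integral>\<^sup>+\<omega>. ennreal \<bar>cemp n (indicator (B (y n))) \<omega> - cemp n (indicator (B x)) \<omega>\<bar> + ennreal \<bar>sqrt (real n) * (F (y n) - F x) - f x * r\<bar> \<partial>M)"
        by (intro nn_integral_mono) (simp add: ennreal_plus[symmetric] ennreal_leI del: ennreal_plus)
      also have "\<dots> = (\<integral>\<^sup>+\<omega>. ennreal \<bar>cemp n (indicator (B (y n))) \<omega> - cemp n (indicator (B x)) \<omega>\<bar> \<partial>M) + ennreal \<bar>sqrt (real n) * (F (y n) - F x) - f x * r\<bar>"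
        by (subst nn_integral_add) (auto simp: emeasure_space_1)
      also have "\<dots> \<le> ennreal (sqrt (F (y n) - F x)) + ennreal \<bar>sqrt (real n) * (F (y n) - F x) - f x * r\<bar>"
        using nn_integral_abs_increment[OF B B Bmono, of x "y n" n] F_strict[OF xy] xy by (intro add_right_mono) (simp add: FB)
      also have "\<dots> = ennreal (e n)" using F_strict[OF xy] by (simp add: e_def ennreal_plus)
      finally show ?thesis .
    qed
    have "eventually (\<lambda>n. r < sqrt (real n)) sequentially"
      using filterlim_compose[OF sqrt_at_top filterlim_real_sequentially] by (auto simp: filterlim_at_top_dense)
    hence ev: "eventually (\<lambda>n. (\<integral>\<^sup>+\<omega>. ennreal \<bar>p n x r \<omega> - q n x r \<omega>\<bar> \<partial>M) \<le> ennreal (e n)) sequentially"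
      using eventually_ge_at_top[of 1] by eventually_elim (rule le)
    have el: "(\<lambda>n. ennreal (e n)) \<longlonglongrightarrow> 0" using tendsto_ennrealI[OF e0] by simp
    show ?thesis by (rule tendsto_sandwich[OF _ ev tendsto_const el]) simp
  qed
  define u where "u n z = (\<integral>\<^sup>+\<omega>. ennreal \<bar>p n (fst z) (snd z) \<omega> - q n (fst z) (snd z) \<omega>\<bar> * indicator ({-L..L} \<times> {0<..}) z \<partial>M)" for n z
  have u: "u n z = (\<integral>\<^sup>+\<omega>. ennreal \<bar>p n (fst z) (snd z) \<omega> - q n (fst z) (snd z) \<omega>\<bar> \<partial>M) * indicator ({-L..L} \<times> {0<..}) z" for n z
    unfolding u_def by (rule nn_integral_multc) measurable
  have jm: "(\<lambda>(z, \<omega>). ennreal \<bar>p n (fst z) (snd z) \<omega> - q n (fst z) (snd z) \<omega>\<bar> * indicator ({-L..L} \<times> {0<..}) z) \<in> borel_measurable ((lborel \<Otimes>\<^sub>M lborel) \<Otimes>\<^sub>M M)" for n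
    by measurable
  define w where "w z = ennreal (2 * exp (1/2) * exp (- (c * snd z))) * indicator ({-L..L} \<times> {0<..}) z" for z :: "real \<times> real"
  have wfin: "(\<integral>\<^sup>+z. w z \<partial>(lborel \<Otimes>\<^sub>M lborel)) < \<infinity>"
  proof -
    have "(\<integral>\<^sup>+r. ennreal (2 * exp (1/2) * exp (- (c * r))) * indicator {0<..} r \<partial>lborel) \<le> (\<integral>\<^sup>+r. ennreal (2 * exp (1/2) * exp (- (c * r))) * indicator {0..} r \<partial>lborel)"
      by (intro nn_integral_mono) (auto simp: indicator_def)
    also have "\<dots> = ennreal (0 - (- (2 * exp (1/2) / c) * exp (- (c * 0))))"
    proof (rule nn_integral_FTC_atLeast)
      show "((\<lambda>r. - (2 * exp (1/2) / c) * exp (- (c * r))) has_real_derivative 2 * exp (1/2) * exp (- (c * r))) (at r)" for r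
        using c(1) by (auto intro!: derivative_eq_intros simp: field_simps)
      have "((\<lambda>r. exp (- (c * r))) \<longlongrightarrow> 0) at_top"
        using c(1) by (intro filterlim_compose[OF exp_at_bot] filterlim_compose[OF filterlim_uminus_at_bot_at_top] filterlim_tendsto_pos_mult_at_top[OF tendsto_const] filterlim_ident)
      from tendsto_mult[OF tendsto_const[of "- (2 * exp (1/2) / c)"] this]
      show "((\<lambda>r. - (2 * exp (1/2) / c) * exp (- (c * r))) \<longlongrightarrow> 0) at_top" by simp
    qed auto
    also have "\<dots> < \<infinity>" by simp
    finally have rfin: "(\<integral>\<^sup>+r. ennreal (2 * exp (1/2) * exp (- (c * r))) * indicator {0<..} r \<partial>lborel) < \<infinity>" .
    have [measurable]: "w \<in> borel_measurable (borel \<Otimes>\<^sub>M borel)" unfolding w_def by measurable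
    have "(\<integral>\<^sup>+z. w z \<partial>(lborel \<Otimes>\<^sub>M lborel)) = (\<integral>\<^sup>+x. \<integral>\<^sup>+r. w (x, r) \<partial>lborel \<partial>lborel)"
      by (rule lborel.nn_integral_fst[symmetric]) measurable
    also have "\<dots> = (\<integral>\<^sup>+x. indicator {-L..L} x * (\<integral>\<^sup>+r. ennreal (2 * exp (1/2) * exp (- (c * r))) * indicator {0<..} r \<partial>lborel) \<partial>lborel)"
      by (intro nn_integral_cong) (auto simp: w_def indicator_times indicator_def)
    also have "\<dots> = emeasure lborel {-L..L} * (\<integral>\<^sup>+r. ennreal (2 * exp (1/2) * exp (- (c * r))) * indicator {0<..} r \<partial>lborel)"
      by (subst nn_integral_multc) auto
    also have "\<dots> < \<infinity>" using rfin by (auto simp: ennreal_mult_less_top emeasure_lborel_Icc_eq)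
    finally show ?thesis .
  qed
  \<comment> \<open>The shift to \<open>Suc n\<close> is there because the dominating bound requires
    \<open>1 <= n\<close>.\<close>
  have uS: "(\<lambda>n. \<integral>\<^sup>+z. u (Suc n) z \<partial>(lborel \<Otimes>\<^sub>M lborel)) \<longlonglongrightarrow> (\<integral>\<^sup>+z. 0 \<partial>(lborel \<Otimes>\<^sub>M lborel :: (real \<times> real) measure))"
  proof (rule nn_integral_dominated_convergence[where w=w])
    show "u (Suc n) \<in> borel_measurable (lborel \<Otimes>\<^sub>M lborel)" for n
      unfolding u_def using borel_measurable_nn_integral[OF jm] by simp
    show "w \<in> borel_measurable (lborel \<Otimes>\<^sub>M lborel)" unfolding w_def by measurable
    show "AE z in lborel \<Otimes>\<^sub>M lborel. u (Suc n) z \<le> w z" for n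
    proof (rule AE_I2)
      fix z
      show "u (Suc n) z \<le> w z"
        using bound[of "Suc n" "fst z" "snd z"] by (cases z) (auto simp: u w_def indicator_def)
    qed
    show "AE z in lborel \<Otimes>\<^sub>M lborel. (\<lambda>n. u (Suc n) z) \<longlonglongrightarrow> 0"
    proof (rule AE_I2)
      fix z
      show "(\<lambda>n. u (Suc n) z) \<longlonglongrightarrow> 0"
        using LIMSEQ_Suc[OF lim[of "snd z" "fst z"]] by (cases z) (auto simp: u indicator_def)
    qed
  qed (use wfin in auto)
  have "(\<lambda>n. \<integral>\<^sup>+z. u n z \<partial>(lborel \<Otimes>\<^sub>M lborel)) \<longlonglongrightarrow> 0" by (rule LIMSEQ_imp_Suc) (use uS in simp)
  moreover have "(\<integral>\<^sup>+z. u n z \<partial>(lborel \<Otimes>\<^sub>M lborel)) = (\<integral>\<^sup>+\<omega>. \<integral>\<^sup>+z. ennreal \<bar>p n (fst z) (snd z) \<omega> - q n (fst z) (snd z) \<omega>\<bar> * indicator ({-L..L} \<times> {0<..}) z \<partial>(lborel \<Otimes>\<^sub>M lborel) \<partial>M)" for n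
    unfolding u_def using P.Fubini'[OF jm] by simp
  ultimately show ?thesis unfolding p_def q_def by simp
qed

end

section \<open>Riemann sums of quadratic functionals\<close>

definition grid :: "nat \<Rightarrow> real \<Rightarrow> real" where
  "grid m x = real_of_int \<lfloor>real m * x\<rfloor> / real m"

lemma grid_measurable [measurable]: "grid m \<in> borel_measurable borel"
  unfolding grid_def[abs_def] by measurable

lemma grid_bounds:
  assumes "1 \<le> m" shows "x - 1 / real m < grid m x" "grid m x \<le> x"
proof -
  have m: "0 < real m" using assms by simp
  have "grid m x \<le> real m * x / real m" unfolding grid_def by (intro divide_right_mono) auto
  thus "grid m x \<le> x" using m by simp
  have "(real m * x - 1) / real m < grid m x" unfolding grid_def using m by (intro divide_strict_right_mono) linarith+
  thus "x - 1 / real m < grid m x" using m by (simp add: diff_divide_distrib)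
qed

lemma grid_tendsto: "(\<lambda>m. grid m x) \<longlonglongrightarrow> x"
proof (rule tendsto_sandwich)
  have "(\<lambda>m. x - 1 / real m) \<longlonglongrightarrow> x - 0" by (intro tendsto_diff tendsto_const lim_1_over_n)
  thus "(\<lambda>m. x - 1 / real m) \<longlonglongrightarrow> x" by simp
  show "eventually (\<lambda>m. x - 1 / real m \<le> grid m x) sequentially"
    by (rule eventually_sequentiallyI[of 1]) (rule less_imp_le[OF grid_bounds(1)])
  show "eventually (\<lambda>m. grid m x \<le> x) sequentially"
    by (rule eventually_sequentiallyI[of 1]) (rule grid_bounds(2))
qed (rule tendsto_const)

lemma finite_grid_image: "finite (grid m ` {-L..L})"
proof (rule finite_subset)
  show "grid m ` {-L..L} \<subseteq> (\<lambda>k::int. real_of_int k / real m) ` {\<lfloor>real m * (-L)\<rfloor>..\<lfloor>real m * L\<rfloor>}"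
  proof
    fix v assume "v \<in> grid m ` {-L..L}"
    then obtain x where x: "x \<in> {-L..L}" "v = grid m x" by blast
    have "\<lfloor>real m * (-L)\<rfloor> \<le> \<lfloor>real m * x\<rfloor>" "\<lfloor>real m * x\<rfloor> \<le> \<lfloor>real m * L\<rfloor>"
      by (intro floor_mono mult_left_mono; use x in simp)+
    thus "v \<in> (\<lambda>k::int. real_of_int k / real m) ` {\<lfloor>real m * (-L)\<rfloor>..\<lfloor>real m * L\<rfloor>}"
      using x by (auto simp: grid_def)
  qed
qed simp

text \<open>Rounding \<open>x\<close> down to the grid leaves countably many random variables, which
  gives joint measurability; continuity of the paths makes the rounded processes converge
  pointwise.\<close>

lemma continuous_process_measurable:
  fixes D :: "real \<Rightarrow> 'w \<Rightarrow> real"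
  assumes D [measurable]: "\<And>x. D x \<in> borel_measurable M" and cont: "\<And>\<omega>. \<omega> \<in> space M \<Longrightarrow> continuous_on UNIV (\<lambda>x. D x \<omega>)"
  shows "(\<lambda>(x, \<omega>). D x \<omega>) \<in> borel_measurable (borel \<Otimes>\<^sub>M M)"
proof (rule borel_measurable_LIMSEQ_real)
  fix p assume "p \<in> space (borel \<Otimes>\<^sub>M M :: (real \<times> 'w) measure)"
  then obtain x \<omega> where p: "p = (x, \<omega>)" "\<omega> \<in> space M" by (cases p) (auto simp: space_pair_measure)
  have "isCont (\<lambda>x. D x \<omega>) x" using cont[OF p(2)] by (simp add: continuous_on_eq_continuous_at)
  hence "(\<lambda>m. D (grid m x) \<omega>) \<longlonglongrightarrow> D x \<omega>" by (rule isCont_tendsto_compose) (rule grid_tendsto)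
  thus "(\<lambda>m. (\<lambda>(x, \<omega>). D (grid m x) \<omega>) p) \<longlonglongrightarrow> (case p of (x, \<omega>) \<Rightarrow> D x \<omega>)" by (simp add: p)
next
  fix m
  show "(\<lambda>(x, \<omega>). D (grid m x) \<omega>) \<in> borel_measurable (borel \<Otimes>\<^sub>M M)"
    unfolding split_beta' grid_def
    by (rule measurable_compose_countable[where f="\<lambda>k p. D (real_of_int k / real m) (snd p)" and g="\<lambda>p. \<lfloor>real m * fst p\<rfloor>"]) measurable
qed

text \<open>The first summand is the error of the weight \<open>1 / f\<close> when
  \<open>E D^2 <= 1\<close>. The second is the error of \<open>D^2\<close>: its factor 4 is
  \<open>sqrt (4 * 4)\<close>, from \<open>E (D x - D y)^2 <= 4 |F x - F y|\<close> and
  \<open>E (D x + D y)^2 <= 4\<close>. Nothing in it refers to a particular process.\<close>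

definition grid_error :: "(real \<Rightarrow> real) \<Rightarrow> (real \<Rightarrow> real) \<Rightarrow> real \<Rightarrow> nat \<Rightarrow> ennreal" where
  "grid_error F f L m = (\<integral>\<^sup>+x. ennreal (\<bar>1 / f x - 1 / f (grid m x)\<bar> + 4 / f (grid m x) * sqrt \<bar>F x - F (grid m x)\<bar>)
     * indicator {-L..L} x \<partial>lborel)"

lemma grid_error_tendsto:
  assumes F: "continuous_on UNIV F" "\<And>x. 0 \<le> F x" "\<And>x. F x \<le> 1"
    and f: "continuous_on UNIV f" "\<And>x. 0 < f x"
  shows "(\<lambda>m. grid_error F f L m) \<longlonglongrightarrow> 0"
proof -
  have [measurable]: "F \<in> borel_measurable borel" "f \<in> borel_measurable borel"
    using F(1) f(1) by (auto intro: borel_measurable_continuous_onI)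
  \<comment> \<open>Rounding down can leave the interval on the left, by at most 1 when the mesh is
    at least 1.\<close>
  obtain c where c: "0 < c" "\<And>x. x \<in> {-L-1..L} \<Longrightarrow> c \<le> f x"
  proof (cases "{-L-1..L} = {}")
    case True thus ?thesis using that[of 1] by auto
  next
    case False
    then obtain x0 where "x0 \<in> {-L-1..L}" "\<And>x. x \<in> {-L-1..L} \<Longrightarrow> f x0 \<le> f x"
      using continuous_attains_inf[of "{-L-1..L}" f] continuous_on_subset[OF f(1)] by auto
    thus ?thesis using that[of "f x0"] f(2) by blast
  qed
  define u where "u m x = ennreal (\<bar>1 / f x - 1 / f (grid m x)\<bar> + 4 / f (grid m x) * sqrt \<bar>F x - F (grid m x)\<bar>) * indicator {-L..L} x" for m x
  have uS: "(\<lambda>m. \<integral>\<^sup>+x. u (Suc m) x \<partial>lborel) \<longlonglongrightarrow> (\<integral>\<^sup>+x. 0 \<partial>(lborel :: real measure))"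
  proof (rule nn_integral_dominated_convergence[where w="\<lambda>x. ennreal (6 / c) * indicator {-L..L} x"])
    show "u (Suc m) \<in> borel_measurable lborel" for m unfolding u_def by measurable
    show "(\<integral>\<^sup>+x. ennreal (6 / c) * indicator {-L..L} x \<partial>lborel) < \<infinity>"
      by (subst nn_integral_cmult_indicator) (auto simp: ennreal_mult_less_top emeasure_lborel_Icc_eq)
    show "AE x in lborel. u (Suc m) x \<le> ennreal (6 / c) * indicator {-L..L} x" for m
    proof (rule AE_I2)
      fix x
      show "u (Suc m) x \<le> ennreal (6 / c) * indicator {-L..L} x"
      proof (cases "x \<in> {-L..L}")
        case True
        have "x - 1 < grid (Suc m) x" "grid (Suc m) x \<le> x"
        proof -
          have "1 / real (Suc m) \<le> 1" by simp
          thus "x - 1 < grid (Suc m) x" "grid (Suc m) x \<le> x" using grid_bounds[of "Suc m" x] by linarith+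
        qed
        hence fg: "c \<le> f x" "c \<le> f (grid (Suc m) x)" using True by (auto intro!: c(2))
        have 1: "1 / f x \<le> 1 / c" "1 / f (grid (Suc m) x) \<le> 1 / c" using fg c(1) by (auto intro!: divide_left_mono)
        have "sqrt \<bar>F x - F (grid (Suc m) x)\<bar> \<le> sqrt 1" using F(2,3) by (intro real_sqrt_le_mono) (smt (verit))
        hence "4 / f (grid (Suc m) x) * sqrt \<bar>F x - F (grid (Suc m) x)\<bar> \<le> 4 / c * 1"
          using fg c(1) by (intro mult_mono divide_left_mono) auto
        moreover have "\<bar>1 / f x - 1 / f (grid (Suc m) x)\<bar> \<le> 1 / c + 1 / c"
          using 1 f(2)[of x] f(2)[of "grid (Suc m) x"] by (intro order_trans[OF abs_triangle_ineq4] add_mono) auto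
        ultimately have "\<bar>1 / f x - 1 / f (grid (Suc m) x)\<bar> + 4 / f (grid (Suc m) x) * sqrt \<bar>F x - F (grid (Suc m) x)\<bar> \<le> 6 / c" by simp
        thus ?thesis using True by (simp add: u_def ennreal_leI)
      qed (simp add: u_def)
    qed
    show "AE x in lborel. (\<lambda>m. u (Suc m) x) \<longlonglongrightarrow> 0"
    proof (rule AE_I2)
      fix x
      have cF: "(\<lambda>m. F (grid m x)) \<longlonglongrightarrow> F x" and cf: "(\<lambda>m. f (grid m x)) \<longlonglongrightarrow> f x"
        using F(1) f(1) by (auto intro!: isCont_tendsto_compose[OF _ grid_tendsto] simp: continuous_on_eq_continuous_at)
      have "f x \<noteq> 0" using f(2)[of x] by simp
      hence "(\<lambda>m. \<bar>1 / f x - 1 / f (grid m x)\<bar> + 4 / f (grid m x) * sqrt \<bar>F x - F (grid m x)\<bar>) \<longlonglongrightarrow> \<bar>1 / f x - 1 / f x\<bar> + 4 / f x * sqrt \<bar>F x - F x\<bar>"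
        by (intro tendsto_intros cF cf)
      hence "(\<lambda>m. ennreal (\<bar>1 / f x - 1 / f (grid m x)\<bar> + 4 / f (grid m x) * sqrt \<bar>F x - F (grid m x)\<bar>)) \<longlonglongrightarrow> ennreal 0"
        by (intro tendsto_ennrealI) simp
      hence "(\<lambda>m. u m x) \<longlonglongrightarrow> 0" by (cases "x \<in> {-L..L}") (auto simp: u_def)
      thus "(\<lambda>m. u (Suc m) x) \<longlonglongrightarrow> 0" by (rule LIMSEQ_Suc)
    qed
  qed auto
  have "(\<lambda>m. \<integral>\<^sup>+x. u m x \<partial>lborel) \<longlonglongrightarrow> 0" by (rule LIMSEQ_imp_Suc) (use uS in simp)
  thus ?thesis by (simp add: u_def grid_error_def)
qed

lemma grid_integral_sum:
  fixes h :: "real \<Rightarrow> real"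
  shows "(LBINT x:{-L..L}. h (grid m x)) = (\<Sum>v\<in>grid m ` {-L..L}. measure lborel {x\<in>{-L..L}. grid m x = v} * h v)"
    and "set_integrable lborel {-L..L} (\<lambda>x. h (grid m x))"
proof -
  have eq: "indicator {-L..L} x *\<^sub>R h (grid m x) = (\<Sum>v\<in>grid m ` {-L..L}. indicator {x\<in>{-L..L}. grid m x = v} x *\<^sub>R h v)" for x
  proof (cases "x \<in> {-L..L}")
    case True
    have "(\<Sum>v\<in>grid m ` {-L..L}. indicator {x\<in>{-L..L}. grid m x = v} x *\<^sub>R h v) = (\<Sum>v\<in>grid m ` {-L..L}. if v = grid m x then h v else 0)"
      using True by (intro sum.cong) (auto simp: indicator_def)
    thus ?thesis using True finite_grid_image[of m L] by (simp add: sum.delta)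
  qed (auto simp: indicator_def intro!: sum.neutral[symmetric])
  have S: "{x\<in>{-L..L}. grid m x = v} \<in> sets lborel" for v by measurable
  have "emeasure lborel {x\<in>{-L..L}. grid m x = v} \<le> emeasure lborel {-L..L}" for v by (intro emeasure_mono) auto
  hence fin: "emeasure lborel {x\<in>{-L..L}. grid m x = v} < \<infinity>" for v
    by (rule le_less_trans) (simp add: emeasure_lborel_Icc_eq)
  have int: "integrable lborel (\<lambda>x. indicator {x\<in>{-L..L}. grid m x = v} x *\<^sub>R h v)" for v
    using S fin by (intro integrable_scaleR_left integrable_real_indicator) auto
  show "set_integrable lborel {-L..L} (\<lambda>x. h (grid m x))"
    unfolding set_integrable_def eq by (intro Bochner_Integration.integrable_sum int)
  show "(LBINT x:{-L..L}. h (grid m x)) = (\<Sum>v\<in>grid m ` {-L..L}. measure lborel {x\<in>{-L..L}. grid m x = v} * h v)"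
    unfolding set_lebesgue_integral_def eq
  proof (subst Bochner_Integration.integral_sum[OF int], intro sum.cong refl)
    fix v
    have "(LINT x|lborel. indicator {x\<in>{-L..L}. grid m x = v} x *\<^sub>R h v) = (LINT x|lborel. indicator {x\<in>{-L..L}. grid m x = v} x) *\<^sub>R h v"
      by (rule integral_scaleR_left) (use S fin in \<open>auto intro: integrable_real_indicator\<close>)
    thus "(LINT x|lborel. indicator {x\<in>{-L..L}. grid m x = v} x *\<^sub>R h v) = measure lborel {x\<in>{-L..L}. grid m x = v} * h v" by simp
  qed
qed

lemma abs_exp_minus_diff_le:
  fixes s t :: real assumes "0 \<le> s" "0 \<le> t" shows "\<bar>exp (- s) - exp (- t)\<bar> \<le> \<bar>s - t\<bar>"
proof -
  have "\<bar>exp (- s) - exp (- t)\<bar> \<le> \<bar>s - t\<bar>" if "s \<le> t" "0 \<le> s" for s t :: real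
  proof -
    have "exp (- s) - exp (- t) = exp (- s) * (1 - exp (s - t))" by (simp add: right_diff_distrib exp_add[symmetric])
    also have "\<dots> \<le> 1 * (1 - exp (s - t))" using that by (intro mult_right_mono) auto
    also have "\<dots> \<le> t - s"
    proof -
      have "1 - exp d \<le> - d" for d :: real using exp_ge_add_one_self[of d] by linarith
      from this[of "s - t"] show ?thesis by simp
    qed
    finally show ?thesis using that by simp
  qed
  from this[of s t] this[of t s] assms show ?thesis by (cases "s \<le> t") (auto simp: abs_minus_commute)
qed

text \<open>Since \<open>t \<mapsto> exp (- l t)\<close> is Lipschitz with constant \<open>l\<close>
  on the nonnegative reals, it suffices to bound the mean absolute difference of the two integrals.
  By Fubini this reduces to an estimate at each single \<open>x\<close>.\<close>

lemma discretization_error: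
  fixes D :: "real \<Rightarrow> 'w \<Rightarrow> real"
  assumes M: "prob_space M" and Dm [measurable]: "(\<lambda>(x, \<omega>). D x \<omega>) \<in> borel_measurable (borel \<Otimes>\<^sub>M M)"
    and F: "\<And>x y. x < y \<Longrightarrow> F x < F y" and [measurable]: "F \<in> borel_measurable borel" "f \<in> borel_measurable borel" and f: "\<And>x. 0 < f x"
    and D2: "\<And>x. integrable M (\<lambda>\<omega>. (D x \<omega>)\<^sup>2)" "\<And>x. (LINT \<omega>|M. (D x \<omega>)\<^sup>2) \<le> 1"
    and Dd: "\<And>x y. (LINT \<omega>|M. (D x \<omega> - D y \<omega>)\<^sup>2) \<le> 4 * \<bar>F x - F y\<bar>"
    and int: "\<And>\<omega>. \<omega> \<in> space M \<Longrightarrow> set_integrable lborel {-L..L} (\<lambda>x. (D x \<omega>)\<^sup>2 / f x)" and l: "0 \<le> l"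
  shows "ennreal \<bar>(LINT \<omega>|M. exp (- (l * (LBINT x:{-L..L}. (D x \<omega>)\<^sup>2 / f x)))) - (LINT \<omega>|M. exp (- (l * (LBINT x:{-L..L}. (D (grid m x) \<omega>)\<^sup>2 / f (grid m x)))))\<bar>
    \<le> ennreal l * grid_error F f L m"
proof -
  interpret M: prob_space M by fact
  interpret P: pair_sigma_finite lborel M ..
  note Dm' = measurable_compose[OF measurable_pair_swap' Dm]
  have [measurable]: "(\<lambda>(\<omega>, x). D x \<omega>) \<in> borel_measurable (M \<Otimes>\<^sub>M borel)" using Dm' by (simp add: split_beta')
  have [measurable]: "D x \<in> borel_measurable M" for x using measurable_Pair2[OF Dm, of x] by simp
  define u where "u x \<omega> = (D x \<omega>)\<^sup>2 / f x" for x \<omega>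
  have [measurable]: "(\<lambda>(x, \<omega>). u x \<omega>) \<in> borel_measurable (borel \<Otimes>\<^sub>M M)" "(\<lambda>(\<omega>, x). u x \<omega>) \<in> borel_measurable (M \<Otimes>\<^sub>M borel)"
    unfolding u_def by measurable
  have [measurable]: "(\<lambda>(x, \<omega>). u (grid m x) \<omega>) \<in> borel_measurable (borel \<Otimes>\<^sub>M M)" "(\<lambda>(\<omega>, x). u (grid m x) \<omega>) \<in> borel_measurable (M \<Otimes>\<^sub>M borel)"
    unfolding u_def by measurable
  have u0: "0 \<le> u x \<omega>" for x \<omega> using f[of x] by (simp add: u_def)
  define P where "P \<omega> = (LBINT x:{-L..L}. u x \<omega>)" for \<omega>
  define Q where "Q \<omega> = (LBINT x:{-L..L}. u (grid m x) \<omega>)" for \<omega>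
  have PQm [measurable]: "P \<in> borel_measurable M" "Q \<in> borel_measurable M"
    unfolding P_def[abs_def] Q_def[abs_def] set_lebesgue_integral_def by measurable
  have P0: "0 \<le> P \<omega>" "0 \<le> Q \<omega>" for \<omega>
    unfolding P_def Q_def set_lebesgue_integral_def using u0 by (auto intro!: Bochner_Integration.integral_nonneg)
  have ei: "integrable M (\<lambda>\<omega>. exp (- (l * P \<omega>)))" "integrable M (\<lambda>\<omega>. exp (- (l * Q \<omega>)))"
    using P0 l by (auto intro!: M.integrable_const_bound[of _ 1] mult_nonneg_nonneg)
  have PQ: "ennreal \<bar>P \<omega> - Q \<omega>\<bar> \<le> (\<integral>\<^sup>+x. ennreal \<bar>u x \<omega> - u (grid m x) \<omega>\<bar> * indicator {-L..L} x \<partial>lborel)" if \<omega>: "\<omega> \<in> space M" for \<omega>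
  proof -
    have i1: "set_integrable lborel {-L..L} (\<lambda>x. u x \<omega>)" using int[OF \<omega>] by (simp add: u_def)
    have i2: "set_integrable lborel {-L..L} (\<lambda>x. u (grid m x) \<omega>)" by (rule grid_integral_sum(2)[of L "\<lambda>v. u v \<omega>" m])
    have "P \<omega> - Q \<omega> = (LBINT x:{-L..L}. u x \<omega> - u (grid m x) \<omega>)" unfolding P_def Q_def using i1 i2 by (simp add: set_integral_diff)
    hence "ennreal \<bar>P \<omega> - Q \<omega>\<bar> \<le> (\<integral>\<^sup>+x. norm (indicator {-L..L} x *\<^sub>R (u x \<omega> - u (grid m x) \<omega>)) \<partial>lborel)"
      unfolding set_lebesgue_integral_def using integral_norm_bound_ennreal[OF set_integral_diff(1)[OF i1 i2, unfolded set_integrable_def]] by simp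
    also have "\<dots> = (\<integral>\<^sup>+x. ennreal \<bar>u x \<omega> - u (grid m x) \<omega>\<bar> * indicator {-L..L} x \<partial>lborel)"
      by (intro nn_integral_cong) (auto simp: indicator_def)
    finally show ?thesis .
  qed
  \<comment> \<open>The difference of squares is \<open>(D x - D y) (D x + D y)\<close>. Weighting
    the two factors with \<open>s = sqrt |F x - F y|\<close> bounds its mean by
    \<open>4 s^2 / (2 s) + 4 s / 2 = 4 s\<close>; for \<open>x = y\<close> both sides are 0.\<close>
  have E: "(\<integral>\<^sup>+\<omega>. ennreal \<bar>u x \<omega> - u y \<omega>\<bar> \<partial>M) \<le> ennreal (\<bar>1 / f x - 1 / f y\<bar> + 4 / f y * sqrt \<bar>F x - F y\<bar>)" for x y
  proof (cases "x = y")
    case False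
    define s where "s = sqrt \<bar>F x - F y\<bar>"
    have s: "0 < s" "\<bar>F x - F y\<bar> = s\<^sup>2" using F[of x y] F[of y x] False by (auto simp: s_def neq_iff)
    have iP: "integrable M (\<lambda>\<omega>. D x \<omega> * D y \<omega>)"
    proof (rule Bochner_Integration.integrable_bound)
      show "integrable M (\<lambda>\<omega>. (D x \<omega>)\<^sup>2 + (D y \<omega>)\<^sup>2)" using D2(1) by auto
      have "\<bar>a * b\<bar> \<le> a\<^sup>2 + b\<^sup>2" for a b :: real
      proof -
        have "2 * (\<bar>a\<bar> * \<bar>b\<bar>) \<le> a\<^sup>2 + b\<^sup>2" using sum_squares_bound[of "\<bar>a\<bar>" "\<bar>b\<bar>"] by (simp add: mult.assoc)
        moreover have "0 \<le> \<bar>a\<bar> * \<bar>b\<bar>" by simp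
        ultimately show ?thesis unfolding abs_mult by linarith
      qed
      thus "AE \<omega> in M. norm (D x \<omega> * D y \<omega>) \<le> norm ((D x \<omega>)\<^sup>2 + (D y \<omega>)\<^sup>2)" by (intro AE_I2) simp
    qed measurable
    have id: "integrable M (\<lambda>\<omega>. (D x \<omega> - D y \<omega>)\<^sup>2)" "integrable M (\<lambda>\<omega>. (D x \<omega> + D y \<omega>)\<^sup>2)"
      using D2(1)[of x] D2(1)[of y] iP by (auto simp: power2_diff power2_sum mult.assoc)
    have "(LINT \<omega>|M. (D x \<omega> + D y \<omega>)\<^sup>2) \<le> (LINT \<omega>|M. 2 * (D x \<omega>)\<^sup>2 + 2 * (D y \<omega>)\<^sup>2)"
    proof (rule integral_mono)
      fix \<omega>
      have "0 \<le> (D x \<omega> - D y \<omega>)\<^sup>2" by simp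
      thus "(D x \<omega> + D y \<omega>)\<^sup>2 \<le> 2 * (D x \<omega>)\<^sup>2 + 2 * (D y \<omega>)\<^sup>2" by (simp add: power2_diff power2_sum)
    qed (use id D2(1) in auto)
    also have "\<dots> \<le> 4" using D2[of x] D2[of y] by simp
    finally have Es: "(LINT \<omega>|M. (D x \<omega> + D y \<omega>)\<^sup>2) \<le> 4" .
    define R where "R \<omega> = \<bar>1 / f x - 1 / f y\<bar> * (D x \<omega>)\<^sup>2 + 1 / f y * ((D x \<omega> - D y \<omega>)\<^sup>2 / (2 * s) + s * (D x \<omega> + D y \<omega>)\<^sup>2 / 2)" for \<omega>
    have iR: "integrable M R" unfolding R_def using id D2(1) by auto
    have "\<bar>u x \<omega> - u y \<omega>\<bar> \<le> R \<omega>" for \<omega>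
    proof -
      have "u x \<omega> - u y \<omega> = (1 / f x - 1 / f y) * (D x \<omega>)\<^sup>2 + 1 / f y * ((D x \<omega>)\<^sup>2 - (D y \<omega>)\<^sup>2)"
        by (simp add: u_def left_diff_distrib right_diff_distrib)
      hence "\<bar>u x \<omega> - u y \<omega>\<bar> \<le> \<bar>1 / f x - 1 / f y\<bar> * (D x \<omega>)\<^sup>2 + 1 / f y * \<bar>(D x \<omega>)\<^sup>2 - (D y \<omega>)\<^sup>2\<bar>"
        using f[of y] abs_triangle_ineq[of "(1 / f x - 1 / f y) * (D x \<omega>)\<^sup>2" "1 / f y * ((D x \<omega>)\<^sup>2 - (D y \<omega>)\<^sup>2)"]
        by (simp add: abs_mult)
      moreover have "\<bar>(D x \<omega>)\<^sup>2 - (D y \<omega>)\<^sup>2\<bar> \<le> (D x \<omega> - D y \<omega>)\<^sup>2 / (2 * s) + s * (D x \<omega> + D y \<omega>)\<^sup>2 / 2"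
      proof -
        define a b where "a = \<bar>D x \<omega> - D y \<omega>\<bar>" and "b = \<bar>D x \<omega> + D y \<omega>\<bar>"
        have "\<bar>(D x \<omega>)\<^sup>2 - (D y \<omega>)\<^sup>2\<bar> = a * b" by (simp add: a_def b_def abs_mult[symmetric] power2_eq_square algebra_simps)
        moreover have "a * b \<le> a\<^sup>2 / (2 * s) + s * b\<^sup>2 / 2"
        proof -
          have "0 \<le> (a - s * b)\<^sup>2" by simp
          thus ?thesis using s(1) by (simp add: power2_diff field_simps power2_eq_square)
        qed
        ultimately show ?thesis by (simp add: a_def b_def)
      qed
      ultimately show ?thesis unfolding R_def using f[of y] by (smt (verit) mult_left_mono divide_nonneg_pos zero_le_one)
    qed
    hence "(\<integral>\<^sup>+\<omega>. ennreal \<bar>u x \<omega> - u y \<omega>\<bar> \<partial>M) \<le> (\<integral>\<^sup>+\<omega>. ennreal (R \<omega>) \<partial>M)" by (intro nn_integral_mono ennreal_leI)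
    also have "\<dots> = ennreal (LINT \<omega>|M. R \<omega>)"
    proof (rule nn_integral_eq_integral[OF iR])
      have "0 \<le> R \<omega>" for \<omega> unfolding R_def using s(1) f[of y]
        by (intro add_nonneg_nonneg mult_nonneg_nonneg divide_nonneg_pos) auto
      thus "AE \<omega> in M. 0 \<le> R \<omega>" by simp
    qed
    also have "(LINT \<omega>|M. R \<omega>) = \<bar>1 / f x - 1 / f y\<bar> * (LINT \<omega>|M. (D x \<omega>)\<^sup>2) + 1 / f y * ((LINT \<omega>|M. (D x \<omega> - D y \<omega>)\<^sup>2) / (2 * s) + s * (LINT \<omega>|M. (D x \<omega> + D y \<omega>)\<^sup>2) / 2)"
      unfolding R_def using id D2(1) by simp
    also have "\<dots> \<le> \<bar>1 / f x - 1 / f y\<bar> * 1 + 1 / f y * (4 * s\<^sup>2 / (2 * s) + s * 4 / 2)"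
      using D2(2)[of x] Dd[of x y] Es s f[of y] by (intro add_mono mult_left_mono divide_right_mono) auto
    also have "\<dots> = \<bar>1 / f x - 1 / f y\<bar> + 4 / f y * sqrt \<bar>F x - F y\<bar>" using s(1) by (simp add: s_def[symmetric] power2_eq_square)
    finally show ?thesis by (simp add: ennreal_leI)
  qed simp
  have "ennreal \<bar>(LINT \<omega>|M. exp (- (l * P \<omega>))) - (LINT \<omega>|M. exp (- (l * Q \<omega>)))\<bar> \<le> (\<integral>\<^sup>+\<omega>. norm (exp (- (l * P \<omega>)) - exp (- (l * Q \<omega>))) \<partial>M)"
    using integral_norm_bound_ennreal[OF Bochner_Integration.integrable_diff[OF ei]] ei by simp
  also have "\<dots> \<le> (\<integral>\<^sup>+\<omega>. ennreal l * (\<integral>\<^sup>+x. ennreal \<bar>u x \<omega> - u (grid m x) \<omega>\<bar> * indicator {-L..L} x \<partial>lborel) \<partial>M)"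
  proof (intro nn_integral_mono)
    fix \<omega> assume \<omega>: "\<omega> \<in> space M"
    have "\<bar>exp (- (l * P \<omega>)) - exp (- (l * Q \<omega>))\<bar> \<le> \<bar>l * P \<omega> - l * Q \<omega>\<bar>" using l P0 by (intro abs_exp_minus_diff_le) auto
    also have "\<dots> = l * \<bar>P \<omega> - Q \<omega>\<bar>" using l by (simp add: right_diff_distrib[symmetric] abs_mult)
    finally have "ennreal (norm (exp (- (l * P \<omega>)) - exp (- (l * Q \<omega>)))) \<le> ennreal l * ennreal \<bar>P \<omega> - Q \<omega>\<bar>"
      using l by (simp add: ennreal_mult'[symmetric] ennreal_leI)
    also have "\<dots> \<le> ennreal l * (\<integral>\<^sup>+x. ennreal \<bar>u x \<omega> - u (grid m x) \<omega>\<bar> * indicator {-L..L} x \<partial>lborel)" by (intro mult_left_mono PQ[OF \<omega>]) simp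
    finally show "ennreal (norm (exp (- (l * P \<omega>)) - exp (- (l * Q \<omega>)))) \<le> \<dots>" .
  qed
  also have "\<dots> = ennreal l * (\<integral>\<^sup>+\<omega>. \<integral>\<^sup>+x. ennreal \<bar>u x \<omega> - u (grid m x) \<omega>\<bar> * indicator {-L..L} x \<partial>lborel \<partial>M)"
    by (rule nn_integral_cmult) measurable
  also have "(\<integral>\<^sup>+\<omega>. \<integral>\<^sup>+x. ennreal \<bar>u x \<omega> - u (grid m x) \<omega>\<bar> * indicator {-L..L} x \<partial>lborel \<partial>M) = (\<integral>\<^sup>+x. \<integral>\<^sup>+\<omega>. ennreal \<bar>u x \<omega> - u (grid m x) \<omega>\<bar> * indicator {-L..L} x \<partial>M \<partial>lborel)"
    by (rule P.Fubini') measurable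
  also have "\<dots> \<le> grid_error F f L m" unfolding grid_error_def
  proof (intro nn_integral_mono)
    fix x
    have "(\<lambda>\<omega>. ennreal \<bar>u x \<omega> - u (grid m x) \<omega>\<bar>) \<in> borel_measurable M" unfolding u_def by measurable
    hence "(\<integral>\<^sup>+\<omega>. ennreal \<bar>u x \<omega> - u (grid m x) \<omega>\<bar> * indicator {-L..L} x \<partial>M) = (\<integral>\<^sup>+\<omega>. ennreal \<bar>u x \<omega> - u (grid m x) \<omega>\<bar> \<partial>M) * indicator {-L..L} x"
      by (rule nn_integral_multc)
    also have "\<dots> \<le> ennreal (\<bar>1 / f x - 1 / f (grid m x)\<bar> + 4 / f (grid m x) * sqrt \<bar>F x - F (grid m x)\<bar>) * indicator {-L..L} x"
      by (intro mult_right_mono E) simp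
    finally show "(\<integral>\<^sup>+\<omega>. ennreal \<bar>u x \<omega> - u (grid m x) \<omega>\<bar> * indicator {-L..L} x \<partial>M) \<le> \<dots>" .
  qed
  finally show ?thesis by (simp add: P_def Q_def u_def mult_left_mono)
qed

lemma laplace_truncated_tendsto:
  fixes D :: "nat \<Rightarrow> real \<Rightarrow> 'w \<Rightarrow> real" and D0 :: "real \<Rightarrow> 'v \<Rightarrow> real"
  assumes M: "prob_space M" and N: "prob_space N"
    and Dm: "\<And>n. (\<lambda>(x, \<omega>). D n x \<omega>) \<in> borel_measurable (borel \<Otimes>\<^sub>M M)"
    and D0m: "(\<lambda>(x, \<omega>). D0 x \<omega>) \<in> borel_measurable (borel \<Otimes>\<^sub>M N)"
    and F: "\<And>x y. x < y \<Longrightarrow> F x < F y" "continuous_on UNIV F" "\<And>x. 0 \<le> F x" "\<And>x. F x \<le> 1"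
    and f: "continuous_on UNIV f" "\<And>x. 0 < f x"
    and D2: "\<And>n x. integrable M (\<lambda>\<omega>. (D n x \<omega>)\<^sup>2)" "\<And>n x. (LINT \<omega>|M. (D n x \<omega>)\<^sup>2) \<le> 1"
      "\<And>n x y. (LINT \<omega>|M. (D n x \<omega> - D n y \<omega>)\<^sup>2) \<le> 4 * \<bar>F x - F y\<bar>"
      "\<And>n \<omega>. \<omega> \<in> space M \<Longrightarrow> set_integrable lborel {-L..L} (\<lambda>x. (D n x \<omega>)\<^sup>2 / f x)"
    and D02: "\<And>x. integrable N (\<lambda>\<omega>. (D0 x \<omega>)\<^sup>2)" "\<And>x. (LINT \<omega>|N. (D0 x \<omega>)\<^sup>2) \<le> 1"
      "\<And>x y. (LINT \<omega>|N. (D0 x \<omega> - D0 y \<omega>)\<^sup>2) \<le> 4 * \<bar>F x - F y\<bar>"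
      "\<And>\<omega>. \<omega> \<in> space N \<Longrightarrow> set_integrable lborel {-L..L} (\<lambda>x. (D0 x \<omega>)\<^sup>2 / f x)"
    and fidi: "\<And>V a. finite V \<Longrightarrow> (\<lambda>n. CLINT \<omega>|M. iexp (\<Sum>v\<in>V. a v * D n v \<omega>)) \<longlonglongrightarrow> (CLINT \<omega>|N. iexp (\<Sum>v\<in>V. a v * D0 v \<omega>))"
    and l: "0 \<le> l"
  shows "(\<lambda>n. LINT \<omega>|M. exp (- (l * (LBINT x:{-L..L}. (D n x \<omega>)\<^sup>2 / f x)))) \<longlonglongrightarrow> (LINT \<omega>|N. exp (- (l * (LBINT x:{-L..L}. (D0 x \<omega>)\<^sup>2 / f x))))"
proof (rule LIMSEQ_I)
  fix r :: real assume r: "0 < r"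
  have [measurable]: "F \<in> borel_measurable borel" "f \<in> borel_measurable borel"
    using F(2) f(1) by (auto intro: borel_measurable_continuous_onI)
  have Dm1: "D n x \<in> borel_measurable M" for n x using measurable_Pair2[OF Dm, of x] by simp
  have D0m1: "D0 x \<in> borel_measurable N" for x using measurable_Pair2[OF D0m, of x] by simp
  \<comment> \<open>One mesh \<open>m\<close> serves all \<open>n\<close> and the limit, because the
    error bound involves \<open>F\<close>, \<open>f\<close> and \<open>L\<close> only. For this
    \<open>m\<close> only finitely many points remain.\<close>
  have "(\<lambda>m. ennreal l * grid_error F f L m) \<longlonglongrightarrow> ennreal l * 0"
    by (intro ennreal_tendsto_cmult grid_error_tendsto F f) simp
  hence "eventually (\<lambda>m. ennreal l * grid_error F f L m < ennreal (r / 4)) sequentially"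
    using r by (intro order_tendstoD(2)[where y="ennreal l * 0"]) auto
  then obtain m where m: "ennreal l * grid_error F f L m < ennreal (r / 4)" by (auto simp: eventually_sequentially)
  define V where "V = grid m ` {-L..L}"
  define w where "w v = l * (measure lborel {x\<in>{-L..L}. grid m x = v} / f v)" for v
  have finV: "finite V" unfolding V_def by (rule finite_grid_image)
  have w0: "0 \<le> w v" for v using l f(2)[of v] by (simp add: w_def)
  have disc: "l * (LBINT x:{-L..L}. (d (grid m x) \<omega>)\<^sup>2 / f (grid m x)) = (\<Sum>v\<in>V. w v * (d v \<omega>)\<^sup>2)" for d :: "real \<Rightarrow> 'z \<Rightarrow> real" and \<omega>
    using grid_integral_sum(1)[of L "\<lambda>v. (d v \<omega>)\<^sup>2 / f v" m] by (simp add: V_def w_def sum_distrib_left mult_ac)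
  \<comment> \<open>The Laplace transform of the Riemann sum is the mixed transform with all
    coordinates damped and frequency 0.\<close>
  have gl: "gauss_laplace P V d w V (\<lambda>_. 0) = of_real (LINT \<omega>|P. exp (- (l * (LBINT x:{-L..L}. (d (grid m x) \<omega>)\<^sup>2 / f (grid m x)))))" for P and d :: "real \<Rightarrow> 'z \<Rightarrow> real"
    unfolding gauss_laplace_def disc by simp
  have "(\<lambda>n. gauss_laplace M V (D n) w V (\<lambda>_. 0)) \<longlonglongrightarrow> gauss_laplace N V D0 w V (\<lambda>_. 0)"
    by (rule gauss_laplace_tendsto[OF M N finV order_refl w0 Dm1 D0m1 fidi[OF finV]])
  hence "(\<lambda>n. LINT \<omega>|M. exp (- (l * (LBINT x:{-L..L}. (D n (grid m x) \<omega>)\<^sup>2 / f (grid m x))))) \<longlonglongrightarrow> (LINT \<omega>|N. exp (- (l * (LBINT x:{-L..L}. (D0 (grid m x) \<omega>)\<^sup>2 / f (grid m x)))))"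
    unfolding gl by (simp only: tendsto_of_real_iff)
  from LIMSEQ_D[OF this, of "r/4"] r obtain n0 where n0: "\<And>n. n0 \<le> n \<Longrightarrow>
    \<bar>(LINT \<omega>|M. exp (- (l * (LBINT x:{-L..L}. (D n (grid m x) \<omega>)\<^sup>2 / f (grid m x))))) - (LINT \<omega>|N. exp (- (l * (LBINT x:{-L..L}. (D0 (grid m x) \<omega>)\<^sup>2 / f (grid m x)))))\<bar> < r/4"
    by auto
  have e1: "\<bar>(LINT \<omega>|M. exp (- (l * (LBINT x:{-L..L}. (D n x \<omega>)\<^sup>2 / f x)))) - (LINT \<omega>|M. exp (- (l * (LBINT x:{-L..L}. (D n (grid m x) \<omega>)\<^sup>2 / f (grid m x)))))\<bar> < r/4" for n
    using le_less_trans[OF discretization_error[OF M Dm F(1) _ _ f(2) D2(1,2,3,4) l, of n m] m] r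
    by (simp add: ennreal_less_iff)
  have e2: "\<bar>(LINT \<omega>|N. exp (- (l * (LBINT x:{-L..L}. (D0 x \<omega>)\<^sup>2 / f x)))) - (LINT \<omega>|N. exp (- (l * (LBINT x:{-L..L}. (D0 (grid m x) \<omega>)\<^sup>2 / f (grid m x)))))\<bar> < r/4"
    using le_less_trans[OF discretization_error[OF N D0m F(1) _ _ f(2) D02(1,2,3,4) l, of m] m] r
    by (simp add: ennreal_less_iff)
  show "\<exists>n0. \<forall>n\<ge>n0. norm ((LINT \<omega>|M. exp (- (l * (LBINT x:{-L..L}. (D n x \<omega>)\<^sup>2 / f x)))) - (LINT \<omega>|N. exp (- (l * (LBINT x:{-L..L}. (D0 x \<omega>)\<^sup>2 / f x))))) < r"
  proof (intro exI[of _ n0] allI impI)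
    fix n assume "n0 \<le> n"
    from n0[OF this] e1[of n] e2 r
    show "norm ((LINT \<omega>|M. exp (- (l * (LBINT x:{-L..L}. (D n x \<omega>)\<^sup>2 / f x)))) - (LINT \<omega>|N. exp (- (l * (LBINT x:{-L..L}. (D0 x \<omega>)\<^sup>2 / f x))))) < r"
      unfolding real_norm_def by linarith
  qed
qed

section \<open>The limit process\<close>

locale smooth_cdf =
  fixes F :: "real \<Rightarrow> real"
  assumes F_diff: "\<And>x. F differentiable (at x)" and F_C1: "deriv F C1_differentiable_on UNIV"
    and f_pos: "\<And>x. 0 < deriv F x" and F_bot: "(F \<longlongrightarrow> 0) at_bot" and F_top: "(F \<longlongrightarrow> 1) at_top"
begin

abbreviation "f \<equiv> deriv F"
abbreviation "Q \<equiv> gen_inverse F"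
abbreviation "h \<equiv> density_quantile F"

lemma F_deriv: "(F has_real_derivative f x) (at x)"
  using F_diff by (metis DERIV_deriv_iff_real_differentiable)

lemma f_differentiable: "f differentiable (at x)"
  using F_C1 by (simp add: C1_differentiable_on_eq)

lemma f_cont: "continuous_on UNIV f"
  by (intro continuous_at_imp_continuous_on ballI differentiable_imp_continuous_within f_differentiable)

lemma F_isCont: "isCont F x"
  using F_deriv DERIV_isCont by blast

lemma F_cont: "continuous_on UNIV F"
  using F_isCont by (simp add: continuous_at_imp_continuous_on)

lemma F_strict: "x < y \<Longrightarrow> F x < F y"
  using DERIV_pos_imp_increasing[of x y F] F_deriv f_pos by blast

lemma F_less_iff: "F x < F y \<longleftrightarrow> x < y"
  using F_strict by (metis linorder_less_linear order_less_asym)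

lemma F_le_iff: "F x \<le> F y \<longleftrightarrow> x \<le> y"
  using F_less_iff[of y x] by (simp add: not_less[symmetric])

lemma F_measurable [measurable]: "F \<in> borel_measurable borel"
  using F_cont by (rule borel_measurable_continuous_onI)

lemma f_measurable [measurable]: "f \<in> borel_measurable borel"
  using f_cont by (rule borel_measurable_continuous_onI)

lemma F_pos: "0 < F x"
proof -
  have "eventually (\<lambda>y. F y \<le> F (x - 1)) at_bot"
    using eventually_le_at_bot[of "x - 1"] by (elim eventually_mono) (simp add: F_le_iff)
  hence "0 \<le> F (x - 1)" using F_bot by (intro tendsto_upperbound[OF F_bot]) auto
  also have "\<dots> < F x" by (rule F_strict) simp
  finally show ?thesis .
qed

lemma F_lt_1: "F x < 1"
proof -
  have "eventually (\<lambda>y. F (x + 1) \<le> F y) at_top"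
    using eventually_ge_at_top[of "x + 1"] by (elim eventually_mono) (simp add: F_le_iff)
  hence "F (x + 1) \<le> 1" by (intro tendsto_lowerbound[OF F_top]) auto
  moreover have "F x < F (x + 1)" by (rule F_strict) simp
  ultimately show ?thesis by simp
qed

lemma F_onto: assumes "0 < u" "u < 1" shows "\<exists>x. F x = u"
proof -
  have "eventually (\<lambda>x. F x < u) at_bot" using F_bot assms(1) by (rule order_tendstoD)
  then obtain x0 where x0: "F x0 < u" by (auto simp: eventually_at_bot_linorder)
  have "eventually (\<lambda>x. u < F x) at_top" using F_top assms(2) by (rule order_tendstoD)
  then obtain x1 where x1: "u < F x1" by (auto simp: eventually_at_top_linorder)
  have "x0 < x1" using x0 x1 F_less_iff[of x0 x1] by simp
  thus ?thesis using x0 x1 IVT'[of F x0 u x1] continuous_on_subset[OF F_cont] by fastforce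
qed

lemma Q_F: "Q (F x) = x"
proof -
  have "{y. F x \<le> F y} = {x..}" by (auto simp: F_le_iff)
  thus ?thesis by (simp add: gen_inverse_def)
qed

lemma F_Q: "0 < u \<Longrightarrow> u < 1 \<Longrightarrow> F (Q u) = u"
  using F_onto[of u] Q_F by auto

lemma h_F: "h (F x) = f x"
  by (simp add: density_quantile_def Q_F)

lemma Q_deriv: assumes "0 < u" "u < 1" shows "(Q has_real_derivative inverse (f (Q u))) (at u)"
proof (rule DERIV_inverse_function[of F _ _ _ 0 1])
  show "(F has_real_derivative f (Q u)) (at (Q u))" by (rule F_deriv)
  show "f (Q u) \<noteq> 0" using f_pos[of "Q u"] by simp
  have "isCont Q (F (Q u))"
    by (rule isCont_inverse_function[of 1]) (auto simp: Q_F F_isCont)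
  thus "isCont Q u" using assms by (simp add: F_Q)
qed (use assms F_Q in auto)

text \<open>Since \<open>f = h \<circ> F\<close>, the chain rule carries the hypothesis on
  \<open>(log h)'\<close> from the unit interval to the real line.\<close>

lemma ln_f_deriv: "((\<lambda>x. ln (f x)) has_real_derivative deriv (\<lambda>t. ln (h t)) (F x) * f x) (at x)"
proof -
  obtain f' where f': "(f has_real_derivative f') (at x)"
    using f_differentiable[of x] by (metis real_differentiable_def)
  have "((\<lambda>u. f (Q u)) has_real_derivative f' * inverse (f (Q (F x)))) (at (F x))"
    by (rule DERIV_chain2[OF _ Q_deriv]) (use f' F_pos F_lt_1 in \<open>auto simp: Q_F\<close>)
  hence "(h has_real_derivative f' * inverse (f x)) (at (F x))"
    by (simp add: density_quantile_def Q_F comp_def)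
  hence "((\<lambda>t. ln (h t)) has_real_derivative inverse (h (F x)) * (f' * inverse (f x))) (at (F x))"
    by (rule DERIV_chain2[rotated]) (rule DERIV_ln, simp add: h_F f_pos)
  hence "((\<lambda>t. ln (h t)) has_real_derivative deriv (\<lambda>t. ln (h t)) (F x)) (at (F x))"
    by (metis DERIV_imp_deriv)
  from DERIV_chain2[OF this F_deriv[of x]] show ?thesis by (simp add: h_F)
qed

text \<open>The change of variables \<open>u = F x\<close> on compact intervals, followed by
  monotone exhaustion. Using \<open>Suc n\<close> keeps the intervals nondegenerate.\<close>

lemma substitution:
  fixes g :: "real \<Rightarrow> ennreal"
  assumes [measurable]: "g \<in> borel_measurable borel"
  shows "(\<integral>\<^sup>+u. g u * indicator {0<..<1} u \<partial>lborel) = (\<integral>\<^sup>+x. g (F x) * ennreal (f x) \<partial>lborel)"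
proof -
  have eq: "(\<integral>\<^sup>+u. g u * indicator {F (- real (Suc n))..F (real (Suc n))} u \<partial>lborel) = (\<integral>\<^sup>+x. g (F x) * ennreal (f x) * indicator {- real (Suc n)..real (Suc n)} x \<partial>lborel)" for n
    by (rule nn_integral_substitution_aux)
       (use F_deriv f_pos in \<open>auto intro: less_imp_le continuous_on_subset[OF f_cont]\<close>)
  have "(\<lambda>n. \<integral>\<^sup>+u. g u * indicator {F (- real (Suc n))..F (real (Suc n))} u \<partial>lborel) \<longlonglongrightarrow> (\<integral>\<^sup>+u. g u * indicator {0<..<1} u \<partial>lborel)"
  proof (rule nn_integral_LIMSEQ)
    show "incseq (\<lambda>n u. g u * indicator {F (- real (Suc n))..F (real (Suc n))} u)"
    proof (intro incseq_SucI le_funI mult_left_mono)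
      fix n u
      have "{F (- real (Suc n))..F (real (Suc n))} \<subseteq> {F (- real (Suc (Suc n)))..F (real (Suc (Suc n)))}"
        by (intro atLeastatMost_subset_iff[THEN iffD2]) (simp add: F_le_iff)
      thus "indicator {F (- real (Suc n))..F (real (Suc n))} u \<le> (indicator {F (- real (Suc (Suc n)))..F (real (Suc (Suc n)))} u :: ennreal)"
        by (auto simp: indicator_def)
    qed simp
    fix u :: real
    show "(\<lambda>n. g u * indicator {F (- real (Suc n))..F (real (Suc n))} u) \<longlonglongrightarrow> g u * indicator {0<..<1} u"
    proof (cases "0 < u \<and> u < 1")
      case True
      then obtain x where x: "u = F x" using F_onto[of u] by auto
      have "eventually (\<lambda>n. \<bar>x\<bar> \<le> real (Suc n)) sequentially"
        using filterlim_compose[OF filterlim_real_sequentially filterlim_Suc] by (auto simp: filterlim_at_top)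
      hence "eventually (\<lambda>n. g u * indicator {F (- real (Suc n))..F (real (Suc n))} u = g u * indicator {0<..<1} u) sequentially"
        by eventually_elim (use True x in \<open>auto simp: F_le_iff indicator_def\<close>)
      thus ?thesis by (rule tendsto_eventually)
    next
      case False
      have "u \<notin> {F (- real (Suc n))..F (real (Suc n))}" for n
        using False F_pos[of "- real (Suc n)"] F_lt_1[of "real (Suc n)"] by (auto simp del: of_nat_Suc)
      hence "g u * indicator {F (- real (Suc n))..F (real (Suc n))} u = 0" for n by simp
      moreover have "g u * indicator {0<..<1} u = 0" using False by (simp add: indicator_def)
      ultimately show ?thesis by (simp only: tendsto_const)
    qed
  qed measurable
  moreover have "(\<lambda>n. \<integral>\<^sup>+x. g (F x) * ennreal (f x) * indicator {- real (Suc n)..real (Suc n)} x \<partial>lborel) \<longlonglongrightarrow> (\<integral>\<^sup>+x. g (F x) * ennreal (f x) \<partial>lborel)"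
  proof (rule nn_integral_LIMSEQ)
    show "incseq (\<lambda>n x. g (F x) * ennreal (f x) * indicator {- real (Suc n)..real (Suc n)} x)"
      by (intro incseq_SucI le_funI mult_left_mono) (auto simp: indicator_def)
    fix x :: real
    have "eventually (\<lambda>n. \<bar>x\<bar> \<le> real (Suc n)) sequentially"
      using filterlim_compose[OF filterlim_real_sequentially filterlim_Suc] by (auto simp: filterlim_at_top)
    hence "eventually (\<lambda>n. g (F x) * ennreal (f x) * indicator {- real (Suc n)..real (Suc n)} x = g (F x) * ennreal (f x)) sequentially"
      by eventually_elim (auto simp: indicator_def)
    thus "(\<lambda>n. g (F x) * ennreal (f x) * indicator {- real (Suc n)..real (Suc n)} x) \<longlonglongrightarrow> g (F x) * ennreal (f x)" by (rule tendsto_eventually)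
  qed measurable
  ultimately show ?thesis unfolding eq by (rule LIMSEQ_unique)
qed

text \<open>Outside the unit interval \<open>gen_inverse\<close> is the infimum of an empty or
  unbounded set, so only the function cut off there is controlled.\<close>

lemma h_measurable: "(\<lambda>u. h u * indicator {0<..<1} u) \<in> borel_measurable borel"
proof -
  have "continuous_on {0<..<1} (\<lambda>u. f (Q u))"
  proof (intro continuous_at_imp_continuous_on ballI)
    fix u :: real assume "u \<in> {0<..<1}"
    hence "isCont Q u" using Q_deriv[of u] DERIV_isCont by auto
    thus "isCont (\<lambda>u. f (Q u)) u" using f_cont by (intro isCont_o2[where f=Q and g=f]) (auto simp: continuous_on_eq_continuous_at)
  qed
  hence "set_borel_measurable borel {0<..<1} (\<lambda>u. f (Q u))" by (intro set_measurable_continuous_on) auto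
  thus ?thesis by (simp add: set_borel_measurable_def density_quantile_def mult.commute)
qed

end

section \<open>The tail and smoothness conditions on h_X, carried over to the real line\<close>

locale regular_cdf = smooth_cdf +
  fixes \<gamma> :: real
  assumes gam: "0 \<le> \<gamma>" and log_deriv: "\<And>u. 0 < u \<Longrightarrow> u < 1 \<Longrightarrow> min u (1 - u) * \<bar>deriv (\<lambda>t. ln (density_quantile F t)) u\<bar> \<le> \<gamma>"
    and lim0: "((\<lambda>u. u / density_quantile F u) \<longlongrightarrow> 0) (at_right 0)"
    and lim1: "((\<lambda>u. (1 - u) / density_quantile F u) \<longlongrightarrow> 0) (at_left 1)"
    and int: "set_integrable lborel {0<..<1} (\<lambda>u. u * (1 - u) / (density_quantile F u)\<^sup>2)"
begin

text \<open>The bound on the logarithmic derivative says that \<open>\<gamma> ln F + ln f\<close>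
  and \<open>\<gamma> ln F - ln f\<close> are both nondecreasing where
  \<open>F <= 1/2\<close>.\<close>

lemma ratio_left:
  assumes "x \<le> y" "F y \<le> 1/2" shows "\<bar>ln (f y) - ln (f x)\<bar> \<le> \<gamma> * (ln (F y) - ln (F x))"
proof -
  have D: "\<bar>deriv (\<lambda>t. ln (h t)) (F z) * f z\<bar> \<le> \<gamma> * (f z / F z)" if "z \<le> y" for z
  proof -
    have "F z \<le> 1/2" using that assms(2) F_le_iff[of z y] by simp
    hence "F z * \<bar>deriv (\<lambda>t. ln (h t)) (F z)\<bar> \<le> \<gamma>" using log_deriv[OF F_pos F_lt_1, of z] by (simp add: min_def split: if_splits)
    hence "\<bar>deriv (\<lambda>t. ln (h t)) (F z)\<bar> \<le> \<gamma> / F z" using F_pos[of z] by (simp add: pos_le_divide_eq mult.commute)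
    from mult_right_mono[OF this, of "f z"] show ?thesis using f_pos[of z] by (simp add: abs_mult)
  qed
  have dl: "((\<lambda>x. \<gamma> * ln (F x)) has_real_derivative \<gamma> * (f z / F z)) (at z)" for z
    using F_pos[of z] by (auto intro!: derivative_eq_intros F_deriv)
  have "\<gamma> * ln (F x) - ln (f x) \<le> \<gamma> * ln (F y) - ln (f y)"
    by (rule DERIV_nonneg_imp_nondecreasing[OF assms(1)])
       (use D in \<open>force intro!: exI conjI DERIV_diff[OF dl ln_f_deriv]\<close>)
  moreover have "\<gamma> * ln (F x) + ln (f x) \<le> \<gamma> * ln (F y) + ln (f y)"
    by (rule DERIV_nonneg_imp_nondecreasing[OF assms(1)])
       (use D in \<open>force intro!: exI conjI DERIV_add[OF dl ln_f_deriv]\<close>)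
  ultimately show ?thesis unfolding right_diff_distrib by linarith
qed

lemma ratio_right:
  assumes "x \<le> y" "1/2 \<le> F x" shows "\<bar>ln (f y) - ln (f x)\<bar> \<le> \<gamma> * (ln (1 - F x) - ln (1 - F y))"
proof -
  have D: "\<bar>deriv (\<lambda>t. ln (h t)) (F z) * f z\<bar> \<le> \<gamma> * (f z / (1 - F z))" if "x \<le> z" for z
  proof -
    have "1/2 \<le> F z" using that assms(2) F_le_iff[of x z] by simp
    hence "(1 - F z) * \<bar>deriv (\<lambda>t. ln (h t)) (F z)\<bar> \<le> \<gamma>" using log_deriv[OF F_pos F_lt_1, of z] min.absorb2[of "1 - F z" "F z"] by simp
    hence "\<bar>deriv (\<lambda>t. ln (h t)) (F z)\<bar> \<le> \<gamma> / (1 - F z)" using F_lt_1[of z] by (simp add: pos_le_divide_eq mult.commute)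
    from mult_right_mono[OF this, of "f z"] show ?thesis using f_pos[of z] by (simp add: abs_mult)
  qed
  have dl: "((\<lambda>x. - \<gamma> * ln (1 - F x)) has_real_derivative \<gamma> * (f z / (1 - F z))) (at z)" for z
    using F_lt_1[of z] by (auto intro!: derivative_eq_intros F_deriv)
  have "- \<gamma> * ln (1 - F x) - ln (f x) \<le> - \<gamma> * ln (1 - F y) - ln (f y)"
  proof (rule DERIV_nonneg_imp_nondecreasing[OF assms(1)], intro exI conjI)
    fix z assume z: "x \<le> z"
    show "((\<lambda>a. - \<gamma> * ln (1 - F a) - ln (f a)) has_real_derivative \<gamma> * (f z / (1 - F z)) - deriv (\<lambda>t. ln (h t)) (F z) * f z) (at z)"
      by (rule DERIV_diff[OF dl ln_f_deriv])
    show "0 \<le> \<gamma> * (f z / (1 - F z)) - deriv (\<lambda>t. ln (h t)) (F z) * f z" using D[OF z] by linarith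
  qed
  moreover have "- \<gamma> * ln (1 - F x) + ln (f x) \<le> - \<gamma> * ln (1 - F y) + ln (f y)"
  proof (rule DERIV_nonneg_imp_nondecreasing[OF assms(1)], intro exI conjI)
    fix z assume z: "x \<le> z"
    show "((\<lambda>a. - \<gamma> * ln (1 - F a) + ln (f a)) has_real_derivative \<gamma> * (f z / (1 - F z)) + deriv (\<lambda>t. ln (h t)) (F z) * f z) (at z)"
      by (rule DERIV_add[OF dl ln_f_deriv])
    show "0 \<le> \<gamma> * (f z / (1 - F z)) + deriv (\<lambda>t. ln (h t)) (F z) * f z" using D[OF z] by linarith
  qed
  ultimately show ?thesis unfolding right_diff_distrib mult_minus_left by linarith
qed

lemma left_tail: "left_tail F f \<gamma>"
proof
  have "filterlim F (at_right 0) at_bot" by (rule tendsto_imp_filterlim_at_right[OF F_bot]) (simp add: F_pos)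
  from filterlim_compose[OF lim0 this] show "((\<lambda>x. F x / f x) \<longlongrightarrow> 0) at_bot" by (simp add: h_F)
qed (use F_deriv f_cont f_pos F_pos F_bot gam ratio_left in auto)

text \<open>The reflected variable \<open>- X\<close> has distribution function
  \<open>1 - F (- x)\<close> and density \<open>f (- x)\<close>.\<close>

lemma right_tail: "left_tail (\<lambda>x. 1 - F (- x)) (\<lambda>x. f (- x)) \<gamma>"
proof
  have top: "((\<lambda>x. F (- x)) \<longlongrightarrow> 1) at_bot" by (rule filterlim_compose[OF F_top filterlim_uminus_at_top_at_bot])
  have "filterlim (\<lambda>x. F (- x)) (at_left 1) at_bot" by (rule tendsto_imp_filterlim_at_left[OF top]) (simp add: F_lt_1)
  from filterlim_compose[OF lim1 this] show "((\<lambda>x. (1 - F (- x)) / f (- x)) \<longlongrightarrow> 0) at_bot" by (simp add: h_F)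
  show "((\<lambda>x. 1 - F (- x)) \<longlongrightarrow> 0) at_bot" using tendsto_diff[OF tendsto_const[of 1] top] by simp
  show "((\<lambda>x. 1 - F (- x)) has_real_derivative f (- x)) (at x)" for x
    by (auto intro!: derivative_eq_intros DERIV_chain2[OF F_deriv])
  show "continuous_on UNIV (\<lambda>x. f (- x))"
    by (rule continuous_on_compose2[OF f_cont]) (auto intro: continuous_intros)
  fix x y :: real assume xy: "x \<le> y" "1 - F (- y) \<le> 1/2"
  show "\<bar>ln (f (- y)) - ln (f (- x))\<bar> \<le> \<gamma> * (ln (1 - F (- y)) - ln (1 - F (- x)))"
    using ratio_right[of "- y" "- x"] xy by (simp add: abs_minus_commute)
qed (use f_pos F_lt_1 gam in auto)

lemma integrable_F: "(\<integral>\<^sup>+x. ennreal (F x * (1 - F x) / f x) \<partial>lborel) < \<infinity>"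
proof -
  note [measurable] = h_measurable
  \<comment> \<open>Off the unit interval the denominator is 0, hence so is the quotient; this makes
    \<open>g\<close> measurable on the whole line.\<close>
  define g where "g u = ennreal (u * (1 - u) / (h u * indicator {0<..<1} u)\<^sup>2)" for u
  have [measurable]: "g \<in> borel_measurable borel" unfolding g_def by measurable
  have "(\<integral>\<^sup>+x. ennreal (F x * (1 - F x) / f x) \<partial>lborel) = (\<integral>\<^sup>+x. g (F x) * ennreal (f x) \<partial>lborel)"
  proof (intro nn_integral_cong)
    fix x
    have "0 \<le> F x * (1 - F x)" using F_pos[of x] F_lt_1[of x] by simp
    moreover have "F x * (1 - F x) / (f x)\<^sup>2 * f x = F x * (1 - F x) / f x" using f_pos[of x] by (simp add: power2_eq_square)
    ultimately show "ennreal (F x * (1 - F x) / f x) = g (F x) * ennreal (f x)"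
      using F_pos[of x] F_lt_1[of x] f_pos[of x] by (simp add: g_def h_F ennreal_mult'[symmetric] flip: ennreal_mult'')
  qed
  also have "\<dots> = (\<integral>\<^sup>+u. g u * indicator {0<..<1} u \<partial>lborel)" by (rule substitution[symmetric]) measurable
  also have "\<dots> = (\<integral>\<^sup>+u. norm (indicator {0<..<1} u *\<^sub>R (u * (1 - u) / (h u)\<^sup>2)) \<partial>lborel)"
    by (intro nn_integral_cong) (auto simp: g_def indicator_def)
  also have "\<dots> < \<infinity>" using int unfolding set_integrable_def integrable_iff_bounded by simp
  finally show ?thesis .
qed

lemma integrable_left: "(\<integral>\<^sup>+x. ennreal (F x / f x) * indicator {..<0} x \<partial>lborel) < \<infinity>"
proof -
  have "(\<integral>\<^sup>+x. ennreal (F x / f x) * indicator {..<0} x \<partial>lborel) \<le> (\<integral>\<^sup>+x. ennreal (1 / (1 - F 0)) * ennreal (F x * (1 - F x) / f x) \<partial>lborel)"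
  proof (intro nn_integral_mono)
    fix x
    show "ennreal (F x / f x) * indicator {..<0} x \<le> ennreal (1 / (1 - F 0)) * ennreal (F x * (1 - F x) / f x)"
    proof (cases "x < 0")
      case True
      have "F x / f x * (1 - F 0) \<le> F x / f x * (1 - F x)"
        using F_strict[OF True] F_pos[of x] f_pos[of x] by (intro mult_left_mono) auto
      hence "F x / f x \<le> F x / f x * (1 - F x) / (1 - F 0)"
        using F_lt_1[of 0] by (simp only: pos_le_divide_eq diff_gt_0_iff_gt)
      hence "F x / f x \<le> 1 / (1 - F 0) * (F x * (1 - F x) / f x)" by (simp add: mult_ac)
      thus ?thesis using True F_lt_1[of 0] by (simp add: ennreal_mult'[symmetric] ennreal_leI)
    qed simp
  qed
  also have "\<dots> = ennreal (1 / (1 - F 0)) * (\<integral>\<^sup>+x. ennreal (F x * (1 - F x) / f x) \<partial>lborel)" by (rule nn_integral_cmult) measurable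
  also have "\<dots> < \<infinity>" using integrable_F by (simp add: ennreal_mult_less_top)
  finally show ?thesis .
qed

lemma integrable_right: "(\<integral>\<^sup>+x. ennreal ((1 - F (- x)) / f (- x)) * indicator {..<0} x \<partial>lborel) < \<infinity>"
proof -
  have "(\<integral>\<^sup>+x. ennreal ((1 - F (- x)) / f (- x)) * indicator {..<0} x \<partial>lborel) \<le> (\<integral>\<^sup>+x. ennreal (1 / F 0) * ennreal (F (- x) * (1 - F (- x)) / f (- x)) \<partial>lborel)"
  proof (intro nn_integral_mono)
    fix x
    show "ennreal ((1 - F (- x)) / f (- x)) * indicator {..<0} x \<le> ennreal (1 / F 0) * ennreal (F (- x) * (1 - F (- x)) / f (- x))"
    proof (cases "x < 0")
      case True
      have "(1 - F (- x)) / f (- x) * F 0 \<le> (1 - F (- x)) / f (- x) * F (- x)"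
        using F_strict[of 0 "- x"] True F_lt_1[of "- x"] f_pos[of "- x"] by (intro mult_left_mono) auto
      hence "(1 - F (- x)) / f (- x) \<le> (1 - F (- x)) / f (- x) * F (- x) / F 0"
        using F_pos[of 0] by (simp only: pos_le_divide_eq)
      hence "(1 - F (- x)) / f (- x) \<le> 1 / F 0 * (F (- x) * (1 - F (- x)) / f (- x))" by (simp add: mult_ac)
      thus ?thesis using True F_pos[of 0] by (simp add: ennreal_mult'[symmetric] ennreal_leI)
    qed simp
  qed
  also have "\<dots> = ennreal (1 / F 0) * (\<integral>\<^sup>+x. ennreal (F (- x) * (1 - F (- x)) / f (- x)) \<partial>lborel)" by (rule nn_integral_cmult) measurable
  also have "(\<integral>\<^sup>+x. ennreal (F (- x) * (1 - F (- x)) / f (- x)) \<partial>lborel) = (\<integral>\<^sup>+x. ennreal (F x * (1 - F x) / f x) \<partial>lborel)"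
    by (subst (2) nn_integral_real_affine[of _ "-1" 0]) auto
  also have "ennreal (1 / F 0) * (\<integral>\<^sup>+x. ennreal (F x * (1 - F x) / f x) \<partial>lborel) < \<infinity>" using integrable_F by (simp add: ennreal_mult_less_top)
  finally show ?thesis .
qed

end

section \<open>Centred Gaussian variables and the pair of Brownian bridges\<close>

lemma normal_rv_centered:
  assumes N: "prob_space N" and Z: "normal_rv N Z" and Z0: "(LINT \<omega>|N. Z \<omega>) = 0"
  shows "integrable N (\<lambda>\<omega>. (Z \<omega>)\<^sup>2)" and "(CLINT \<omega>|N. iexp (Z \<omega>)) = exp (- (LINT \<omega>|N. (Z \<omega>)\<^sup>2) / 2)"
proof -
  interpret N: prob_space N by fact
  interpret G: prob_space std_normal_distribution
    using real_dist_normal_dist real_distribution_def by blast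
  have [measurable]: "Z \<in> borel_measurable N" using Z by (simp add: normal_rv_def)
  obtain m s where ms: "distr N borel Z = distr std_normal_distribution borel (\<lambda>x. m + s * x)"
    using Z unfolding normal_rv_def by blast
  have i1: "integrable std_normal_distribution (\<lambda>x. x)" using integrable_std_normal_distribution_moment[of 1] by simp
  have i2: "integrable std_normal_distribution (\<lambda>x. x\<^sup>2)" using integrable_std_normal_distribution_moment[of 2] by simp
  have e1: "(LINT x|std_normal_distribution. x) = 0" using integral_std_normal_distribution_moment_odd[of 1] by simp
  have e2: "(LINT x|std_normal_distribution. x\<^sup>2) = 1" using std_normal_distribution_even_moments[of 1] by (simp add: fact_numeral)
  have "(LINT \<omega>|N. Z \<omega>) = (LINT z|distr N borel Z. z)" by (subst integral_distr) auto
  also have "\<dots> = (LINT x|std_normal_distribution. m + s * x)" unfolding ms by (subst integral_distr) auto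
  also have "\<dots> = m" using i1 e1 G.prob_space by simp
  finally have m: "m = 0" using Z0 by simp
  have "integrable (distr N borel Z) (\<lambda>z. z\<^sup>2)"
    unfolding ms m using i2 by (subst integrable_distr_eq) (auto simp: power_mult_distrib)
  thus "integrable N (\<lambda>\<omega>. (Z \<omega>)\<^sup>2)" by (subst (asm) integrable_distr_eq) auto
  have "(LINT \<omega>|N. (Z \<omega>)\<^sup>2) = (LINT z|distr N borel Z. z\<^sup>2)" by (subst integral_distr) auto
  also have "\<dots> = (LINT x|std_normal_distribution. (s * x)\<^sup>2)" unfolding ms m by (subst integral_distr) auto
  also have "\<dots> = s\<^sup>2" using e2 by (simp add: power_mult_distrib)
  finally have s2: "(LINT \<omega>|N. (Z \<omega>)\<^sup>2) = s\<^sup>2" .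
  have "(CLINT \<omega>|N. iexp (Z \<omega>)) = (CLINT z|distr N borel Z. iexp z)" by (subst integral_distr) auto
  also have "\<dots> = (CLINT x|std_normal_distribution. iexp (s * x))" unfolding ms m by (subst integral_distr) auto
  also have "\<dots> = exp (- (s\<^sup>2) / 2)" using fun_cong[OF char_std_normal_distribution, of s] by (simp add: char_def)
  finally show "(CLINT \<omega>|N. iexp (Z \<omega>)) = exp (- (LINT \<omega>|N. (Z \<omega>)\<^sup>2) / 2)" by (simp add: s2)
qed

locale limit_process = smooth_cdf F + N: prob_space N for F :: "real \<Rightarrow> real" and N :: "'b measure" +
  fixes BX BY :: "real \<Rightarrow> 'b \<Rightarrow> real" and H :: "real \<Rightarrow> real \<Rightarrow> real"
  assumes joint: "jointly_centered_gaussian N {0<..<1} BX BY"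
    and BX: "brownian_bridge N BX" and BY: "brownian_bridge N BY"
    and cross: "\<And>u v. u \<in> {0<..<1} \<Longrightarrow> v \<in> {0<..<1} \<Longrightarrow>
           covariance N (BX u) (BY v) = H (gen_inverse F u) (gen_inverse F v) - u * v"
begin

text \<open>The difference of the bridges in the variable \<open>u = F x\<close>; it is the limit of
  \<open>sqrt n\<close> times the difference of the empirical distribution functions.\<close>

definition D0 :: "real \<Rightarrow> 'b \<Rightarrow> real" where "D0 x \<omega> = BX (F x) \<omega> - BY (F x) \<omega>"

lemma F_in: "F x \<in> {0<..<1}"
  using F_pos F_lt_1 by simp

lemma bridge_facts:
  assumes B: "brownian_bridge N B"
  shows "B (F x) \<in> borel_measurable N" "integrable N (B (F x))" "(LINT \<omega>|N. B (F x) \<omega>) = 0"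
    "integrable N (\<lambda>\<omega>. (B (F x) \<omega>)\<^sup>2)" "(LINT \<omega>|N. B (F x) \<omega> * B (F y) \<omega>) = min (F x) (F y) - F x * F y"
    "\<omega> \<in> space N \<Longrightarrow> continuous_on UNIV (\<lambda>x. B (F x) \<omega>)"
proof -
  have g: "gaussian_process N {0<..<1} B" and c: "centered_process N {0<..<1} B"
    and cov: "\<And>u v. u \<in> {0<..<1} \<Longrightarrow> v \<in> {0<..<1} \<Longrightarrow> covariance N (B u) (B v) = min u v - u * v"
    and cont: "\<And>\<omega>. \<omega> \<in> space N \<Longrightarrow> continuous_on {0<..<1} (\<lambda>u. B u \<omega>)"
    using B by (auto simp: brownian_bridge_def)
  have nrv: "normal_rv N (B (F x))" for x
    using g[unfolded gaussian_process_def, rule_format, of "{F x}" "\<lambda>_. 1"] F_in[of x] by simp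
  show "B (F x) \<in> borel_measurable N" using nrv by (simp add: normal_rv_def)
  have int: "integrable N (B (F x))" and E0: "(LINT \<omega>|N. B (F x) \<omega>) = 0" for x
    using c F_in[of x] by (auto simp: centered_process_def)
  show "integrable N (B (F x))" "(LINT \<omega>|N. B (F x) \<omega>) = 0" by fact+
  show "integrable N (\<lambda>\<omega>. (B (F x) \<omega>)\<^sup>2)" by (rule normal_rv_centered(1)[OF N.prob_space_axioms nrv E0])
  show "(LINT \<omega>|N. B (F x) \<omega> * B (F y) \<omega>) = min (F x) (F y) - F x * F y"
    using cov[OF F_in[of x] F_in[of y]] E0 by (simp add: covariance_def)
  show "continuous_on UNIV (\<lambda>x. B (F x) \<omega>)" if "\<omega> \<in> space N"
    by (rule continuous_on_compose2[OF cont[OF that] F_cont]) (use F_in in auto)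
qed

lemma cross_moment: "(LINT \<omega>|N. BX (F x) \<omega> * BY (F y) \<omega>) = H x y - F x * F y"
  using cross[OF F_in F_in, of x y] bridge_facts(3)[OF BX] bridge_facts(3)[OF BY] by (simp add: covariance_def Q_F)

lemma integrable_product:
  fixes f g :: "'b \<Rightarrow> real"
  assumes [measurable]: "f \<in> borel_measurable N" "g \<in> borel_measurable N"
    and "integrable N (\<lambda>\<omega>. (f \<omega>)\<^sup>2)" "integrable N (\<lambda>\<omega>. (g \<omega>)\<^sup>2)"
  shows "integrable N (\<lambda>\<omega>. f \<omega> * g \<omega>)"
proof (rule Bochner_Integration.integrable_bound)
  show "integrable N (\<lambda>\<omega>. (f \<omega>)\<^sup>2 + (g \<omega>)\<^sup>2)" using assms by auto
  have "\<bar>a * b\<bar> \<le> a\<^sup>2 + b\<^sup>2" for a b :: real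
  proof -
    have "2 * (\<bar>a\<bar> * \<bar>b\<bar>) \<le> a\<^sup>2 + b\<^sup>2" using sum_squares_bound[of "\<bar>a\<bar>" "\<bar>b\<bar>"] by (simp add: mult.assoc)
    moreover have "0 \<le> \<bar>a\<bar> * \<bar>b\<bar>" by simp
    ultimately show ?thesis unfolding abs_mult by linarith
  qed
  thus "AE \<omega> in N. norm (f \<omega> * g \<omega>) \<le> norm ((f \<omega>)\<^sup>2 + (g \<omega>)\<^sup>2)" by (intro AE_I2) simp
qed measurable

lemma D0_measurable: "D0 x \<in> borel_measurable N"
  unfolding D0_def[abs_def] using bridge_facts(1)[OF BX] bridge_facts(1)[OF BY] by (intro borel_measurable_diff)

lemma D0_continuous: "\<omega> \<in> space N \<Longrightarrow> continuous_on UNIV (\<lambda>x. D0 x \<omega>)"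
  unfolding D0_def using bridge_facts(6)[OF BX] bridge_facts(6)[OF BY] by (intro continuous_on_diff)

lemma D0_joint: "(\<lambda>(x, \<omega>). D0 x \<omega>) \<in> borel_measurable (borel \<Otimes>\<^sub>M N)"
  by (rule continuous_process_measurable[OF D0_measurable D0_continuous])

lemma bridge_products:
  "integrable N (\<lambda>\<omega>. BX (F x) \<omega> * BX (F y) \<omega>)" "integrable N (\<lambda>\<omega>. BY (F x) \<omega> * BY (F y) \<omega>)"
  "integrable N (\<lambda>\<omega>. BX (F x) \<omega> * BY (F y) \<omega>)" "integrable N (\<lambda>\<omega>. BY (F x) \<omega> * BX (F y) \<omega>)"
  by (intro integrable_product bridge_facts(1,4)[OF BX] bridge_facts(1,4)[OF BY])+

text \<open>The products \<open>F x * F y\<close> cancel: the two bridge covariances and the two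
  cross covariances carry them with opposite signs.\<close>

lemma D0_product:
  "integrable N (\<lambda>\<omega>. D0 x \<omega> * D0 y \<omega>)"
  "(LINT \<omega>|N. D0 x \<omega> * D0 y \<omega>) = 2 * min (F x) (F y) - H x y - H y x"
proof -
  have e: "D0 x \<omega> * D0 y \<omega> = BX (F x) \<omega> * BX (F y) \<omega> + BY (F x) \<omega> * BY (F y) \<omega> - BX (F x) \<omega> * BY (F y) \<omega> - BX (F y) \<omega> * BY (F x) \<omega>" for \<omega>
    by (simp add: D0_def algebra_simps)
  show "integrable N (\<lambda>\<omega>. D0 x \<omega> * D0 y \<omega>)" unfolding e
    by (intro Bochner_Integration.integrable_diff Bochner_Integration.integrable_add bridge_products)
  show "(LINT \<omega>|N. D0 x \<omega> * D0 y \<omega>) = 2 * min (F x) (F y) - H x y - H y x" unfolding e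
    by (simp add: Bochner_Integration.integrable_diff Bochner_Integration.integrable_add bridge_products
        bridge_facts(5)[OF BX] bridge_facts(5)[OF BY] cross_moment)
qed

lemma D0_square_integrable: "integrable N (\<lambda>\<omega>. (D0 x \<omega>)\<^sup>2)"
  using D0_product(1)[of x x] by (simp add: power2_eq_square)

lemma D0_second_moment: "(LINT \<omega>|N. (D0 x \<omega>)\<^sup>2) \<le> 4 * (F x * (1 - F x))"
proof -
  have "(LINT \<omega>|N. (D0 x \<omega>)\<^sup>2) \<le> (LINT \<omega>|N. 2 * (BX (F x) \<omega>)\<^sup>2 + 2 * (BY (F x) \<omega>)\<^sup>2)"
  proof (rule integral_mono)
    fix \<omega>
    have "0 \<le> (BX (F x) \<omega> + BY (F x) \<omega>)\<^sup>2" by simp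
    thus "(D0 x \<omega>)\<^sup>2 \<le> 2 * (BX (F x) \<omega>)\<^sup>2 + 2 * (BY (F x) \<omega>)\<^sup>2" by (simp add: D0_def power2_diff power2_sum)
  qed (use D0_square_integrable bridge_facts(4)[OF BX] bridge_facts(4)[OF BY] in auto)
  also have "\<dots> = 4 * (F x * (1 - F x))"
    using bridge_facts(4)[OF BX, of x] bridge_facts(4)[OF BY, of x] bridge_facts(5)[OF BX, of x x] bridge_facts(5)[OF BY, of x x]
    by (simp add: power2_eq_square algebra_simps)
  finally show ?thesis .
qed

lemma D0_second_moment_le_1: "(LINT \<omega>|N. (D0 x \<omega>)\<^sup>2) \<le> 1"
proof -
  have "0 \<le> (2 * F x - 1)\<^sup>2" by simp
  hence "4 * (F x * (1 - F x)) \<le> 1" by (simp add: power2_eq_square algebra_simps)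
  thus ?thesis using D0_second_moment[of x] by simp
qed

lemma D0_increment: "(LINT \<omega>|N. (D0 x \<omega> - D0 y \<omega>)\<^sup>2) \<le> 4 * \<bar>F x - F y\<bar>"
proof -
  have inc: "integrable N (\<lambda>\<omega>. (B (F x) \<omega> - B (F y) \<omega>)\<^sup>2)" "(LINT \<omega>|N. (B (F x) \<omega> - B (F y) \<omega>)\<^sup>2) \<le> \<bar>F x - F y\<bar>"
    if B: "brownian_bridge N B" for B
  proof -
    have e: "(B (F x) \<omega> - B (F y) \<omega>)\<^sup>2 = B (F x) \<omega> * B (F x) \<omega> + B (F y) \<omega> * B (F y) \<omega> - 2 * (B (F x) \<omega> * B (F y) \<omega>)" for \<omega>
      by (simp add: power2_eq_square algebra_simps)
    have i: "integrable N (\<lambda>\<omega>. B (F x) \<omega> * B (F y) \<omega>)" for x y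
      by (intro integrable_product bridge_facts(1,4)[OF B])
    show "integrable N (\<lambda>\<omega>. (B (F x) \<omega> - B (F y) \<omega>)\<^sup>2)" unfolding e
      by (intro Bochner_Integration.integrable_diff Bochner_Integration.integrable_add i integrable_mult_right)
    have "(LINT \<omega>|N. (B (F x) \<omega> - B (F y) \<omega>)\<^sup>2) = F x - F x * F x + (F y - F y * F y) - 2 * (min (F x) (F y) - F x * F y)"
      unfolding e by (simp add: Bochner_Integration.integrable_diff Bochner_Integration.integrable_add i bridge_facts(5)[OF B])
    also have "\<dots> = \<bar>F x - F y\<bar> - (F x - F y)\<^sup>2" by (simp add: power2_eq_square algebra_simps min_def)
    finally show "(LINT \<omega>|N. (B (F x) \<omega> - B (F y) \<omega>)\<^sup>2) \<le> \<bar>F x - F y\<bar>" by simp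
  qed
  have "(LINT \<omega>|N. (D0 x \<omega> - D0 y \<omega>)\<^sup>2) \<le> (LINT \<omega>|N. 2 * (BX (F x) \<omega> - BX (F y) \<omega>)\<^sup>2 + 2 * (BY (F x) \<omega> - BY (F y) \<omega>)\<^sup>2)"
  proof (rule integral_mono)
    fix \<omega>
    have "(a - b)\<^sup>2 \<le> 2 * a\<^sup>2 + 2 * b\<^sup>2" for a b :: real
    proof -
      have "0 \<le> (a + b)\<^sup>2" by simp
      thus ?thesis by (simp add: power2_diff power2_sum)
    qed
    from this[of "BX (F x) \<omega> - BX (F y) \<omega>" "BY (F x) \<omega> - BY (F y) \<omega>"]
    show "(D0 x \<omega> - D0 y \<omega>)\<^sup>2 \<le> 2 * (BX (F x) \<omega> - BX (F y) \<omega>)\<^sup>2 + 2 * (BY (F x) \<omega> - BY (F y) \<omega>)\<^sup>2"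
      by (simp add: D0_def algebra_simps)
  next
    have "integrable N (\<lambda>\<omega>. D0 x \<omega> * D0 x \<omega> + D0 y \<omega> * D0 y \<omega> - 2 * (D0 x \<omega> * D0 y \<omega>))"
      by (intro Bochner_Integration.integrable_diff Bochner_Integration.integrable_add D0_product integrable_mult_right)
    thus "integrable N (\<lambda>\<omega>. (D0 x \<omega> - D0 y \<omega>)\<^sup>2)" by (simp add: power2_eq_square algebra_simps)
  qed (use inc[OF BX] inc[OF BY] in auto)
  also have "\<dots> \<le> 4 * \<bar>F x - F y\<bar>" using inc[OF BX] inc[OF BY] by simp
  finally show ?thesis .
qed

lemma D0_char:
  assumes V: "finite V"
  shows "(CLINT \<omega>|N. iexp (\<Sum>v\<in>V. a v * D0 v \<omega>)) = exp (- (\<Sum>v\<in>V. \<Sum>w\<in>V. a v * a w * (2 * min (F v) (F w) - H v w - H w v)) / 2)"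
proof -
  define S where "S \<omega> = (\<Sum>v\<in>V. a v * D0 v \<omega>)" for \<omega>
  have inj: "inj_on F V" by (rule inj_onI) (metis Q_F)
  \<comment> \<open>Joint Gaussianity concerns index sets in a disjoint union. Each \<open>v\<close>
    contributes the level \<open>F v\<close> to both copies, with coefficients \<open>a v\<close>
    and \<open>- a v\<close>, and \<open>Q\<close> recovers \<open>v\<close> from
    \<open>F v\<close>.\<close>
  define T where "T = Inl ` F ` V \<union> Inr ` F ` V"
  define b where "b t = (case t of Inl u \<Rightarrow> a (Q u) | Inr u \<Rightarrow> - a (Q u))" for t :: "real + real"
  have "(\<Sum>t\<in>T. b t * case_sum BX BY t \<omega>) = S \<omega>" for \<omega>
  proof -
    have "(\<Sum>t\<in>T. b t * case_sum BX BY t \<omega>) = (\<Sum>t\<in>(Inl ` F ` V). b t * case_sum BX BY t \<omega>) + (\<Sum>t\<in>(Inr ` F ` V). b t * case_sum BX BY t \<omega>)"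
      unfolding T_def using V by (intro sum.union_disjoint) auto
    also have "(\<Sum>t\<in>(Inl ` F ` V). b t * case_sum BX BY t \<omega>) = (\<Sum>v\<in>V. a v * BX (F v) \<omega>)"
      using inj by (simp add: sum.reindex b_def Q_F inj_on_def)
    also have "(\<Sum>t\<in>(Inr ` F ` V). b t * case_sum BX BY t \<omega>) = (\<Sum>v\<in>V. - a v * BY (F v) \<omega>)"
      using inj by (simp add: sum.reindex b_def Q_F inj_on_def)
    finally show ?thesis by (simp add: S_def D0_def right_diff_distrib sum_subtractf sum_negf)
  qed
  moreover have "normal_rv N (\<lambda>\<omega>. \<Sum>t\<in>T. b t * case_sum BX BY t \<omega>)"
  proof -
    have "finite T" "T \<subseteq> {0<..<1} <+> {0<..<1}" using V F_in by (auto simp: T_def Plus_def)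
    thus ?thesis using joint unfolding jointly_centered_gaussian_def gaussian_process_def by blast
  qed
  ultimately have nS: "normal_rv N S" by simp
  have iD: "integrable N (D0 v)" "(LINT \<omega>|N. D0 v \<omega>) = 0" for v
    using bridge_facts(2,3)[OF BX, of v] bridge_facts(2,3)[OF BY, of v] by (auto simp: D0_def[abs_def])
  have ES: "(LINT \<omega>|N. S \<omega>) = 0" unfolding S_def using iD by (simp add: Bochner_Integration.integral_sum)
  have "(LINT \<omega>|N. (S \<omega>)\<^sup>2) = (LINT \<omega>|N. (\<Sum>v\<in>V. \<Sum>w\<in>V. a v * a w * (D0 v \<omega> * D0 w \<omega>)))"
    unfolding S_def power2_eq_square sum_product by (simp add: mult_ac)
  also have "\<dots> = (\<Sum>v\<in>V. \<Sum>w\<in>V. a v * a w * (2 * min (F v) (F w) - H v w - H w v))"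
    by (simp add: Bochner_Integration.integral_sum Bochner_Integration.integrable_sum D0_product)
  finally have "(LINT \<omega>|N. (S \<omega>)\<^sup>2) = (\<Sum>v\<in>V. \<Sum>w\<in>V. a v * a w * (2 * min (F v) (F w) - H v w - H w v))" .
  thus ?thesis using normal_rv_centered(2)[OF N.prob_space_axioms nS ES] by (simp add: S_def)
qed

lemma D0_set_integrable:
  assumes "\<omega> \<in> space N" shows "set_integrable lborel {-L..L} (\<lambda>x. (D0 x \<omega>)\<^sup>2 / f x)"
proof (rule borel_integrable_atLeastAtMost')
  show "continuous_on {-L..L} (\<lambda>x. (D0 x \<omega>)\<^sup>2 / f x)"
    using f_pos by (intro continuous_on_divide continuous_on_power continuous_on_subset[OF D0_continuous[OF assms]] continuous_on_subset[OF f_cont])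
      (auto simp: less_imp_neq[symmetric])
qed

text \<open>With \<open>u = F x\<close> and \<open>h u = f x\<close>, the expression
  \<open>(B / h)^2 du\<close> becomes \<open>(D0 / f)^2 f dx\<close>. If the integral diverges both
  sides are 0 by convention, so the identity holds for every path.\<close>

lemma limit_functional:
  assumes \<omega>: "\<omega> \<in> space N"
  shows "(LBINT u:{0<..<1}. (BX u \<omega> / h u - BY u \<omega> / h u)\<^sup>2) = enn2real (\<integral>\<^sup>+x. ennreal ((D0 x \<omega>)\<^sup>2 / f x) \<partial>lborel)"
proof -
  define g where "g u = indicator {0<..<1} u *\<^sub>R (BX u \<omega> / h u - BY u \<omega> / h u)\<^sup>2" for u
  have cont: "continuous_on {0<..<1} (\<lambda>u. B u \<omega>)" if "brownian_bridge N B" for B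
    using that \<omega> by (simp add: brownian_bridge_def)
  have Bm: "(\<lambda>u. indicator {0<..<1} u * B u \<omega>) \<in> borel_measurable borel" if "brownian_bridge N B" for B
    using set_measurable_continuous_on[OF _ cont[OF that]] by (simp add: set_borel_measurable_def)
  note [measurable] = Bm[OF BX] Bm[OF BY] h_measurable
  have g_eq: "g = (\<lambda>u. ((indicator {0<..<1} u * BX u \<omega>) / (h u * indicator {0<..<1} u) - (indicator {0<..<1} u * BY u \<omega>) / (h u * indicator {0<..<1} u))\<^sup>2)"
    by (auto simp: g_def indicator_def fun_eq_iff)
  have [measurable]: "g \<in> borel_measurable borel" unfolding g_eq by measurable
  have "(LBINT u:{0<..<1}. (BX u \<omega> / h u - BY u \<omega> / h u)\<^sup>2) = (LINT u|lborel. g u)"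
    by (simp add: set_lebesgue_integral_def g_def)
  also have "\<dots> = enn2real (\<integral>\<^sup>+u. ennreal (g u) \<partial>lborel)"
  proof (rule integral_eq_nn_integral)
    show "AE u in lborel. 0 \<le> g u" by (simp add: g_def)
  qed measurable
  also have "(\<integral>\<^sup>+u. ennreal (g u) \<partial>lborel) = (\<integral>\<^sup>+u. ennreal (g u) * indicator {0<..<1} u \<partial>lborel)"
    by (intro nn_integral_cong) (auto simp: g_def indicator_def)
  also have "\<dots> = (\<integral>\<^sup>+x. ennreal (g (F x)) * ennreal (f x) \<partial>lborel)" by (rule substitution) measurable
  also have "\<dots> = (\<integral>\<^sup>+x. ennreal ((D0 x \<omega>)\<^sup>2 / f x) \<partial>lborel)"
  proof (intro nn_integral_cong)
    fix x
    have "g (F x) * f x = (D0 x \<omega>)\<^sup>2 / f x"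
      using F_in[of x] f_pos[of x] by (simp add: g_def h_F D0_def diff_divide_distrib[symmetric] power_divide power2_eq_square)
    thus "ennreal (g (F x)) * ennreal (f x) = ennreal ((D0 x \<omega>)\<^sup>2 / f x)" using f_pos[of x] by (simp flip: ennreal_mult'')
  qed
  finally show ?thesis .
qed

lemma limit_measurable: "(\<lambda>\<omega>. LBINT u:{0<..<1}. (BX u \<omega> / h u - BY u \<omega> / h u)\<^sup>2) \<in> borel_measurable N"
proof -
  note [measurable] = D0_joint
  have [measurable]: "(\<lambda>(\<omega>, x). D0 x \<omega>) \<in> borel_measurable (N \<Otimes>\<^sub>M borel)"
    using measurable_compose[OF measurable_pair_swap' D0_joint] by (simp add: split_beta')
  have "(\<lambda>\<omega>. enn2real (\<integral>\<^sup>+x. ennreal ((D0 x \<omega>)\<^sup>2 / f x) \<partial>lborel)) \<in> borel_measurable N" by measurable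
  thus ?thesis using limit_functional by (simp cong: measurable_cong)
qed

text \<open>By Fubini the full integral of \<open>D0^2 / f\<close> has mean at most \<open>4\<close>
  times the integral of \<open>F (1 - F) / f\<close>. So it is finite almost surely, and the
  truncated integrals increase to it.\<close>

lemma laplace_limit:
  assumes fin: "(\<integral>\<^sup>+x. ennreal (F x * (1 - F x) / f x) \<partial>lborel) < \<infinity>" and l: "0 \<le> l"
  shows "(\<lambda>k. LINT \<omega>|N. exp (- (l * (LBINT x:{-real k..real k}. (D0 x \<omega>)\<^sup>2 / f x)))) \<longlonglongrightarrow>
     (LINT \<omega>|N. exp (- (l * (LBINT u:{0<..<1}. (BX u \<omega> / h u - BY u \<omega> / h u)\<^sup>2))))"
proof -
  interpret P: pair_sigma_finite lborel N ..
  note [measurable] = D0_joint limit_measurable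
  have [measurable]: "(\<lambda>(\<omega>, x). D0 x \<omega>) \<in> borel_measurable (N \<Otimes>\<^sub>M borel)"
    using measurable_compose[OF measurable_pair_swap' D0_joint] by (simp add: split_beta')
  have "(\<integral>\<^sup>+\<omega>. \<integral>\<^sup>+x. ennreal ((D0 x \<omega>)\<^sup>2 / f x) \<partial>lborel \<partial>N) = (\<integral>\<^sup>+x. \<integral>\<^sup>+\<omega>. ennreal ((D0 x \<omega>)\<^sup>2 / f x) \<partial>N \<partial>lborel)"
    by (rule P.Fubini') measurable
  also have "\<dots> \<le> (\<integral>\<^sup>+x. ennreal 4 * ennreal (F x * (1 - F x) / f x) \<partial>lborel)"
  proof (intro nn_integral_mono)
    fix x
    have "(\<integral>\<^sup>+\<omega>. ennreal ((D0 x \<omega>)\<^sup>2 / f x) \<partial>N) = ennreal (LINT \<omega>|N. (D0 x \<omega>)\<^sup>2 / f x)"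
      using D0_square_integrable f_pos[of x] by (intro nn_integral_eq_integral) auto
    also have "\<dots> \<le> ennreal (4 * (F x * (1 - F x)) / f x)"
      using D0_second_moment[of x] f_pos[of x] by (intro ennreal_leI) (simp add: divide_right_mono)
    also have "\<dots> = ennreal 4 * ennreal (F x * (1 - F x) / f x)" by (subst ennreal_mult'[symmetric]) auto
    finally show "(\<integral>\<^sup>+\<omega>. ennreal ((D0 x \<omega>)\<^sup>2 / f x) \<partial>N) \<le> \<dots>" .
  qed
  also have "\<dots> = ennreal 4 * (\<integral>\<^sup>+x. ennreal (F x * (1 - F x) / f x) \<partial>lborel)" by (rule nn_integral_cmult) measurable
  also have "\<dots> < \<infinity>" using fin by (simp add: ennreal_mult_less_top)
  finally have "AE \<omega> in N. (\<integral>\<^sup>+x. ennreal ((D0 x \<omega>)\<^sup>2 / f x) \<partial>lborel) \<noteq> \<infinity>"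
    by (intro nn_integral_PInf_AE) auto
  hence conv: "AE \<omega> in N. (\<lambda>k. LBINT x:{-real k..real k}. (D0 x \<omega>)\<^sup>2 / f x) \<longlonglongrightarrow> (LBINT u:{0<..<1}. (BX u \<omega> / h u - BY u \<omega> / h u)\<^sup>2)"
  proof (rule AE_mp, intro AE_I2 impI)
    fix \<omega> assume \<omega>: "\<omega> \<in> space N" and ne: "(\<integral>\<^sup>+x. ennreal ((D0 x \<omega>)\<^sup>2 / f x) \<partial>lborel) \<noteq> \<infinity>"
    have [measurable]: "(\<lambda>x. D0 x \<omega>) \<in> borel_measurable borel" using D0_continuous[OF \<omega>] by (rule borel_measurable_continuous_onI)
    have int: "integrable lborel (\<lambda>x. (D0 x \<omega>)\<^sup>2 / f x)"
      unfolding integrable_iff_bounded using ne f_pos by (auto simp: top.not_eq_extremum less_imp_le)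
    have "(\<lambda>k. LINT x|lborel. indicator {-real k..real k} x *\<^sub>R ((D0 x \<omega>)\<^sup>2 / f x)) \<longlonglongrightarrow> (LINT x|lborel. (D0 x \<omega>)\<^sup>2 / f x)"
    proof (rule integral_dominated_convergence[where w="\<lambda>x. (D0 x \<omega>)\<^sup>2 / f x"])
      show "AE x in lborel. (\<lambda>k. indicator {-real k..real k} x *\<^sub>R ((D0 x \<omega>)\<^sup>2 / f x)) \<longlonglongrightarrow> (D0 x \<omega>)\<^sup>2 / f x"
      proof (rule AE_I2)
        fix x :: real
        have "eventually (\<lambda>k. \<bar>x\<bar> \<le> real k) sequentially"
          using filterlim_real_sequentially by (auto simp: filterlim_at_top)
        hence "eventually (\<lambda>k. indicator {-real k..real k} x *\<^sub>R ((D0 x \<omega>)\<^sup>2 / f x) = (D0 x \<omega>)\<^sup>2 / f x) sequentially"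
          by eventually_elim (auto simp: indicator_def)
        thus "(\<lambda>k. indicator {-real k..real k} x *\<^sub>R ((D0 x \<omega>)\<^sup>2 / f x)) \<longlonglongrightarrow> (D0 x \<omega>)\<^sup>2 / f x" by (rule tendsto_eventually)
      qed
    qed (use int f_pos in \<open>auto simp: indicator_def less_imp_le intro!: AE_I2\<close>)
    moreover have "(LINT x|lborel. (D0 x \<omega>)\<^sup>2 / f x) = (LBINT u:{0<..<1}. (BX u \<omega> / h u - BY u \<omega> / h u)\<^sup>2)"
      unfolding limit_functional[OF \<omega>] using f_pos by (intro integral_eq_nn_integral) (auto simp: less_imp_le)
    ultimately show "(\<lambda>k. LBINT x:{-real k..real k}. (D0 x \<omega>)\<^sup>2 / f x) \<longlonglongrightarrow> (LBINT u:{0<..<1}. (BX u \<omega> / h u - BY u \<omega> / h u)\<^sup>2)"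
      by (simp add: set_lebesgue_integral_def)
  qed
  have pos: "0 \<le> (LBINT x:{-real k..real k}. (D0 x \<omega>)\<^sup>2 / f x)" for k \<omega>
    unfolding set_lebesgue_integral_def using f_pos by (intro Bochner_Integration.integral_nonneg) (auto simp: less_imp_le)
  show ?thesis
  proof (rule integral_dominated_convergence[where w="\<lambda>_. 1"])
    show "AE \<omega> in N. (\<lambda>k. exp (- (l * (LBINT x:{-real k..real k}. (D0 x \<omega>)\<^sup>2 / f x)))) \<longlonglongrightarrow> exp (- (l * (LBINT u:{0<..<1}. (BX u \<omega> / h u - BY u \<omega> / h u)\<^sup>2)))"
      using conv by eventually_elim (intro tendsto_intros)
    show "(\<lambda>\<omega>. exp (- (l * (LBINT x:{-real k..real k}. (D0 x \<omega>)\<^sup>2 / f x)))) \<in> borel_measurable N" for k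
      unfolding set_lebesgue_integral_def by measurable
  qed (use pos l in auto)
qed

end

section \<open>The squared distance of quantile functions\<close>

text \<open>For positive \<open>D\<close>, the area of a right triangle with height \<open>D\<close>
  and base \<open>D / k\<close>.\<close>

lemma nn_integral_ramp:
  fixes D k :: real assumes k: "0 < k"
  shows "(\<integral>\<^sup>+r. ennreal (max 0 (D - k * r)) * indicator {0<..} r \<partial>lborel) = ennreal ((max 0 D)\<^sup>2 / (2 * k))"
proof (cases "D > 0")
  case True
  have "(\<integral>\<^sup>+r. ennreal (max 0 (D - k * r)) * indicator {0<..} r \<partial>lborel) =
        (\<integral>\<^sup>+r. ennreal (D - k * r) * indicator {0..D/k} r \<partial>lborel)"
    using k AE_lborel_singleton[of 0]
    by (intro nn_integral_cong_AE) (auto simp: field_simps indicator_def max_def elim!: eventually_mono)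
  also have "\<dots> = ennreal ((D * (D/k) - k * (D/k)\<^sup>2 / 2) - (D * 0 - k * 0\<^sup>2 / 2))"
    using k True by (intro nn_integral_FTC_Icc) (auto intro!: derivative_eq_intros simp: field_simps)
  also have "D * (D/k) - k * (D/k)\<^sup>2 / 2 - (D * 0 - k * 0\<^sup>2 / 2) = (max 0 D)\<^sup>2 / (2 * k)"
    using k True by (simp add: field_simps power2_eq_square)
  finally show ?thesis .
next
  case False
  have *: "D - k * r \<le> 0" if "r > 0" for r using False k that
    by (smt (verit) mult_pos_pos)
  have "(\<integral>\<^sup>+r. ennreal (max 0 (D - k * r)) * indicator {0<..} r \<partial>lborel) = (\<integral>\<^sup>+r. 0 \<partial>(lborel::real measure))"
    by (intro nn_integral_cong) (use * in \<open>auto simp: indicator_def max_def antisym\<close>)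
  thus ?thesis using False by (simp add: max_def)
qed

text \<open>The square is twice the area of the triangle below a diagonal. In this form the square
  of a quantile gap can be integrated over \<open>u\<close> before \<open>x\<close> and
  \<open>y\<close>.\<close>

lemma square_eq_nn_integral:
  fixes a b :: real
  shows "ennreal ((max 0 (b - a))\<^sup>2) =
    2 * (\<integral>\<^sup>+x. \<integral>\<^sup>+y. indicator {(x, y). x < y \<and> a \<le> x \<and> y < b} (x, y) \<partial>lborel \<partial>lborel)"
proof -
  have "(\<integral>\<^sup>+y. indicator {(x, y). x < y \<and> a \<le> x \<and> y < b} (x, y) \<partial>lborel) =
     ennreal (max 0 (b - x)) * indicator {a..} x" for x
  proof -
    have "(\<integral>\<^sup>+y. indicator {(x, y). x < y \<and> a \<le> x \<and> y < b} (x, y) \<partial>lborel) =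
      (\<integral>\<^sup>+y. indicator (if a \<le> x then {x<..<b} else {}) y \<partial>lborel)"
      by (intro nn_integral_cong) (auto simp: indicator_def)
    thus ?thesis by (cases "x \<le> b") (auto simp: max_def)
  qed
  hence "(\<integral>\<^sup>+x. \<integral>\<^sup>+y. indicator {(x, y). x < y \<and> a \<le> x \<and> y < b} (x, y) \<partial>lborel \<partial>lborel) =
     (\<integral>\<^sup>+x. ennreal (max 0 (b - x)) * indicator {a..} x \<partial>lborel)" by simp
  also have "\<dots> = (\<integral>\<^sup>+r. ennreal (max 0 (b - (a + r))) * indicator {a..} (a + r) \<partial>lborel)"
    by (subst nn_integral_real_affine[of _ 1 a]) auto
  also have "\<dots> = (\<integral>\<^sup>+r. ennreal (max 0 ((b - a) - 1 * r)) * indicator {0<..} r \<partial>lborel)"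
    using AE_lborel_singleton[of 0]
    by (intro nn_integral_cong_AE) (auto simp: indicator_def algebra_simps elim!: eventually_mono)
  also have "\<dots> = ennreal ((max 0 (b - a))\<^sup>2 / (2 * 1))" by (rule nn_integral_ramp) simp
  finally show ?thesis by (simp add: ennreal_mult'[symmetric] flip: ennreal_numeral)
qed

text \<open>By the Galois property \<open>a u <= x\<close> means \<open>u <= F x\<close>, and
  \<open>y < b u\<close> means \<open>G y < u\<close>. For fixed \<open>x < y\<close> the admissible
  levels thus form the interval from \<open>G y\<close> to \<open>F x\<close>.\<close>

lemma square_distance_quantiles_half:
  fixes F G a b :: "real \<Rightarrow> real"
  assumes [measurable]: "F \<in> borel_measurable borel" "G \<in> borel_measurable borel"
    "a \<in> borel_measurable borel" "b \<in> borel_measurable borel"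
    and F: "\<And>x. 0 \<le> F x" "\<And>x. F x \<le> 1" and G: "\<And>x. 0 \<le> G x" "\<And>x. G x \<le> 1"
    and a: "\<And>u x. 0 < u \<Longrightarrow> u < 1 \<Longrightarrow> a u \<le> x \<longleftrightarrow> u \<le> F x"
    and b: "\<And>u x. 0 < u \<Longrightarrow> u < 1 \<Longrightarrow> b u \<le> x \<longleftrightarrow> u \<le> G x"
  shows "(\<integral>\<^sup>+u. ennreal ((max 0 (b u - a u))\<^sup>2) * indicator {0<..<1} u \<partial>lborel) =
     2 * (\<integral>\<^sup>+x. \<integral>\<^sup>+y. ennreal (max 0 (F x - G y)) * indicator {x<..} y \<partial>lborel \<partial>lborel)"
proof -
  let ?I = "\<lambda>u x y. indicator {(x, y). x < y \<and> a u \<le> x \<and> y < b u} (x, y) * indicator {0<..<1} u :: ennreal"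
  have I: "?I u x y = (if x < y \<and> a u \<le> x \<and> y < b u \<and> 0 < u \<and> u < 1 then 1 else 0)" for u x y
    by (auto simp: indicator_def)
  have inner: "(\<integral>\<^sup>+u. ?I u x y \<partial>lborel) = ennreal (max 0 (F x - G y)) * indicator {x<..} y" for x y
  proof -
    \<comment> \<open>The level 1 is left out because \<open>F x\<close> may equal 1; then it lies
      in the half-open interval but not in the open unit interval.\<close>
    have *: "?I u x y = indicator (if x < y then {G y<..F x} else {}) u" if "u \<noteq> 1" for u
    proof (cases "0 < u \<and> u < 1")
      case True
      thus ?thesis using a[of u x] b[of u y] by (auto simp: indicator_def)
    next
      case False
      thus ?thesis using that F(2)[of x] G(1)[of y] by (auto simp: indicator_def)
    qed
    have "(\<integral>\<^sup>+u. ?I u x y \<partial>lborel) = (\<integral>\<^sup>+u. indicator (if x < y then {G y<..F x} else {}) u \<partial>lborel)"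
      using AE_lborel_singleton[of 1] * by (intro nn_integral_cong_AE) (auto elim!: eventually_mono)
    also have "\<dots> = emeasure lborel (if x < y then {G y<..F x} else {})"
      by (rule nn_integral_indicator) auto
    also have "\<dots> = ennreal (max 0 (F x - G y)) * indicator {x<..} y"
      by (cases "G y \<le> F x") (auto simp: max_def indicator_def)
    finally show ?thesis .
  qed
  have "(\<integral>\<^sup>+u. ennreal ((max 0 (b u - a u))\<^sup>2) * indicator {0<..<1} u \<partial>lborel) =
     (\<integral>\<^sup>+u. 2 * (\<integral>\<^sup>+x. \<integral>\<^sup>+y. ?I u x y \<partial>lborel \<partial>lborel) \<partial>lborel)"
    unfolding square_eq_nn_integral
    by (intro nn_integral_cong) (auto simp: indicator_def)
  also have "\<dots> = 2 * (\<integral>\<^sup>+u. \<integral>\<^sup>+x. \<integral>\<^sup>+y. ?I u x y \<partial>lborel \<partial>lborel \<partial>lborel)"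
    unfolding I by (rule nn_integral_cmult) measurable
  also have "(\<integral>\<^sup>+u. \<integral>\<^sup>+x. \<integral>\<^sup>+y. ?I u x y \<partial>lborel \<partial>lborel \<partial>lborel) =
             (\<integral>\<^sup>+x. \<integral>\<^sup>+u. \<integral>\<^sup>+y. ?I u x y \<partial>lborel \<partial>lborel \<partial>lborel)"
    unfolding I by (rule lborel_pair.Fubini'[symmetric]) measurable
  also have "\<dots> = (\<integral>\<^sup>+x. \<integral>\<^sup>+y. \<integral>\<^sup>+u. ?I u x y \<partial>lborel \<partial>lborel \<partial>lborel)"
    unfolding I by (intro nn_integral_cong lborel_pair.Fubini'[symmetric]) measurable
  finally show ?thesis unfolding inner .
qed

lemma square_distance_quantiles:
  fixes F G a b :: "real \<Rightarrow> real"
  assumes [measurable]: "F \<in> borel_measurable borel" "G \<in> borel_measurable borel"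
    "a \<in> borel_measurable borel" "b \<in> borel_measurable borel"
    and F: "\<And>x. 0 \<le> F x" "\<And>x. F x \<le> 1" and G: "\<And>x. 0 \<le> G x" "\<And>x. G x \<le> 1"
    and a: "\<And>u x. 0 < u \<Longrightarrow> u < 1 \<Longrightarrow> a u \<le> x \<longleftrightarrow> u \<le> F x"
    and b: "\<And>u x. 0 < u \<Longrightarrow> u < 1 \<Longrightarrow> b u \<le> x \<longleftrightarrow> u \<le> G x"
  shows "(\<integral>\<^sup>+u. ennreal ((a u - b u)\<^sup>2) * indicator {0<..<1} u \<partial>lborel) =
     2 * (\<integral>\<^sup>+x. \<integral>\<^sup>+y. ennreal (max 0 (F x - G y)) * indicator {x<..} y \<partial>lborel \<partial>lborel) +
     2 * (\<integral>\<^sup>+x. \<integral>\<^sup>+y. ennreal (max 0 (G x - F y)) * indicator {x<..} y \<partial>lborel \<partial>lborel)"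
proof -
  have e: "(a u - b u)\<^sup>2 = (max 0 (b u - a u))\<^sup>2 + (max 0 (a u - b u))\<^sup>2" for u
    by (auto simp: max_def power2_commute)
  have "(\<integral>\<^sup>+u. ennreal ((a u - b u)\<^sup>2) * indicator {0<..<1} u \<partial>lborel) =
    (\<integral>\<^sup>+u. ennreal ((max 0 (b u - a u))\<^sup>2) * indicator {0<..<1} u + ennreal ((max 0 (a u - b u))\<^sup>2) * indicator {0<..<1} u \<partial>lborel)"
    by (intro nn_integral_cong) (auto simp: indicator_def e ennreal_plus[symmetric] simp del: ennreal_plus)
  also have "\<dots> = (\<integral>\<^sup>+u. ennreal ((max 0 (b u - a u))\<^sup>2) * indicator {0<..<1} u \<partial>lborel) +
     (\<integral>\<^sup>+u. ennreal ((max 0 (a u - b u))\<^sup>2) * indicator {0<..<1} u \<partial>lborel)"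
    by (rule nn_integral_add) auto
  also have "\<dots> = 2 * (\<integral>\<^sup>+x. \<integral>\<^sup>+y. ennreal (max 0 (F x - G y)) * indicator {x<..} y \<partial>lborel \<partial>lborel) +
     2 * (\<integral>\<^sup>+x. \<integral>\<^sup>+y. ennreal (max 0 (G x - F y)) * indicator {x<..} y \<partial>lborel \<partial>lborel)"
    using square_distance_quantiles_half[of F G a b] square_distance_quantiles_half[of G F b a] assms by simp
  finally show ?thesis .
qed

text \<open>Reflecting and swapping the coordinates preserves \<open>x < y\<close>, so a right tail
  of \<open>F\<close> against \<open>G\<close> turns into a left tail for the reflected
  functions.\<close>

lemma nn_integral_reflect2:
  fixes \<phi> :: "real \<Rightarrow> real \<Rightarrow> ennreal"
  assumes [measurable]: "(\<lambda>(x, y). \<phi> x y) \<in> borel_measurable (borel \<Otimes>\<^sub>M borel)"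
  shows "(\<integral>\<^sup>+x. \<integral>\<^sup>+y. \<phi> x y \<partial>lborel \<partial>lborel) = (\<integral>\<^sup>+x. \<integral>\<^sup>+y. \<phi> (- y) (- x) \<partial>lborel \<partial>lborel)"
proof -
  have "(\<integral>\<^sup>+x. \<integral>\<^sup>+y. \<phi> x y \<partial>lborel \<partial>lborel) = (\<integral>\<^sup>+x. \<integral>\<^sup>+y. \<phi> (- x) y \<partial>lborel \<partial>lborel)"
    by (subst nn_integral_real_affine[of _ "-1" 0]) auto
  also have "\<dots> = (\<integral>\<^sup>+x. \<integral>\<^sup>+y. \<phi> (- x) (- y) \<partial>lborel \<partial>lborel)"
  proof (rule nn_integral_cong)
    fix x
    show "(\<integral>\<^sup>+y. \<phi> (- x) y \<partial>lborel) = (\<integral>\<^sup>+y. \<phi> (- x) (- y) \<partial>lborel)"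
      by (subst nn_integral_real_affine[of _ "-1" 0]) auto
  qed
  also have "\<dots> = (\<integral>\<^sup>+y. \<integral>\<^sup>+x. \<phi> (- x) (- y) \<partial>lborel \<partial>lborel)"
    by (rule lborel_pair.Fubini'[symmetric]) measurable
  finally show ?thesis .
qed

lemma nn_integral_add3:
  fixes u v w :: "real \<Rightarrow> real \<Rightarrow> ennreal"
  assumes [measurable]: "(\<lambda>(x, y). u x y) \<in> borel_measurable (borel \<Otimes>\<^sub>M borel)"
    "(\<lambda>(x, y). v x y) \<in> borel_measurable (borel \<Otimes>\<^sub>M borel)" "(\<lambda>(x, y). w x y) \<in> borel_measurable (borel \<Otimes>\<^sub>M borel)"
  shows "(\<integral>\<^sup>+x. \<integral>\<^sup>+y. u x y + (v x y + w x y) \<partial>lborel \<partial>lborel) =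
    (\<integral>\<^sup>+x. \<integral>\<^sup>+y. u x y \<partial>lborel \<partial>lborel) + ((\<integral>\<^sup>+x. \<integral>\<^sup>+y. v x y \<partial>lborel \<partial>lborel) + (\<integral>\<^sup>+x. \<integral>\<^sup>+y. w x y \<partial>lborel \<partial>lborel))"
proof -
  have [measurable]: "u x \<in> borel_measurable borel" "v x \<in> borel_measurable borel" "w x \<in> borel_measurable borel" for x
    using assms[THEN measurable_Pair2, of x] by simp_all
  show ?thesis by (simp add: nn_integral_add)
qed

lemma nn_integral_le_abs_diff:
  fixes p q :: "'z \<Rightarrow> real"
  assumes [measurable]: "p \<in> borel_measurable M" "q \<in> borel_measurable M" "R \<in> sets M"
    and p: "\<And>z. 0 \<le> p z" and q: "\<And>z. 0 \<le> q z"
  shows "(\<integral>\<^sup>+z. ennreal (p z) * indicator R z \<partial>M) \<le> (\<integral>\<^sup>+z. ennreal (q z) * indicator R z \<partial>M) + (\<integral>\<^sup>+z. ennreal \<bar>p z - q z\<bar> * indicator R z \<partial>M)"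
proof -
  have "(\<integral>\<^sup>+z. ennreal (p z) * indicator R z \<partial>M) \<le> (\<integral>\<^sup>+z. ennreal (q z) * indicator R z + ennreal \<bar>p z - q z\<bar> * indicator R z \<partial>M)"
    using p q by (intro nn_integral_mono) (auto simp: ennreal_plus[symmetric] indicator_def intro!: ennreal_leI simp del: ennreal_plus)
  also have "\<dots> = (\<integral>\<^sup>+z. ennreal (q z) * indicator R z \<partial>M) + (\<integral>\<^sup>+z. ennreal \<bar>p z - q z\<bar> * indicator R z \<partial>M)"
    by (rule nn_integral_add) measurable
  finally show ?thesis .
qed

text \<open>The integrand lives on \<open>x < y < x + 1\<close>, by \<open>sep\<close>. A point
  there with \<open>c <= y\<close> and \<open>x <= - c\<close> satisfies
  \<open>c - 1 < x <= 1 - c\<close>; hence the strip with \<open>|x| <= 1 - c\<close> and the two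
  corners \<open>y < c\<close> and \<open>- c < x\<close> cover everything. The upper estimate pays
  \<eta> for the strip and for each corner, the lower one only for the strip.\<close>

lemma one_sided_comparison:
  fixes F G f :: "real \<Rightarrow> real" and n :: nat and c \<eta> :: real
  assumes F: "mono F" and G: "mono G" and [measurable]: "f \<in> borel_measurable borel" and f: "\<And>x. 0 < f x"
    and n: "1 \<le> n" and \<eta>: "0 \<le> \<eta>"
    and sep: "\<And>x. F x \<le> G (x + 1)"
    and left: "ennreal (real n) * (\<integral>\<^sup>+x. \<integral>\<^sup>+y. ennreal (max 0 (F x - G y)) * indicator {(x, y). x < y \<and> y < c} (x, y) \<partial>lborel \<partial>lborel) \<le> ennreal \<eta>"
    and right: "ennreal (real n) * (\<integral>\<^sup>+x. \<integral>\<^sup>+y. ennreal (max 0 ((1 - G (- x)) - (1 - F (- y)))) * indicator {(x, y). x < y \<and> y < c} (x, y) \<partial>lborel \<partial>lborel) \<le> ennreal \<eta>"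
    and middle: "(\<integral>\<^sup>+p. ennreal \<bar>max 0 (sqrt (real n) * (F (fst p) - G (fst p + snd p / sqrt (real n)))) * indicator {..<sqrt (real n)} (snd p)
            - max 0 (sqrt (real n) * (F (fst p) - G (fst p)) - f (fst p) * snd p)\<bar>
          * indicator ({-(1-c)..1-c} \<times> {0<..}) p \<partial>(lborel \<Otimes>\<^sub>M lborel)) \<le> ennreal \<eta>"
  defines "I \<equiv> ennreal (real n) * (\<integral>\<^sup>+x. \<integral>\<^sup>+y. ennreal (max 0 (F x - G y)) * indicator {x<..} y \<partial>lborel \<partial>lborel)"
    and "J \<equiv> (\<integral>\<^sup>+x. ennreal ((max 0 (sqrt (real n) * (F x - G x)))\<^sup>2 / (2 * f x)) * indicator {-(1-c)..1-c} x \<partial>lborel)"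
  shows "I \<le> J + ennreal (3 * \<eta>)" and "J \<le> I + ennreal \<eta>"
proof -
  define L where "L = 1 - c"
  have Fm [measurable]: "F \<in> borel_measurable borel" and Gm [measurable]: "G \<in> borel_measurable borel"
    using F G by (auto intro: borel_measurable_mono)
  define p where "p z = max 0 (sqrt (real n) * (F (fst z) - G (fst z + snd z / sqrt (real n)))) * indicator {..<sqrt (real n)} (snd z)" for z :: "real \<times> real"
  define q where "q z = max 0 (sqrt (real n) * (F (fst z) - G (fst z)) - f (fst z) * snd z)" for z :: "real \<times> real"
  define R where "R = {-L..L} \<times> {0::real<..}"
  have [measurable]: "R \<in> sets (lborel \<Otimes>\<^sub>M lborel)" "R \<in> sets (borel \<Otimes>\<^sub>M borel)" unfolding R_def by auto
  have [measurable]: "p \<in> borel_measurable (borel \<Otimes>\<^sub>M borel)" "q \<in> borel_measurable (borel \<Otimes>\<^sub>M borel)"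
    unfolding p_def q_def by measurable
  have p0: "0 \<le> p z" and q0: "0 \<le> q z" for z by (auto simp: p_def q_def)
  have mid: "(\<integral>\<^sup>+z. ennreal \<bar>p z - q z\<bar> * indicator R z \<partial>(lborel \<Otimes>\<^sub>M lborel)) \<le> ennreal \<eta>"
    using middle by (simp add: p_def q_def R_def L_def)
  have mid': "(\<integral>\<^sup>+z. ennreal \<bar>q z - p z\<bar> * indicator R z \<partial>(lborel \<Otimes>\<^sub>M lborel)) \<le> ennreal \<eta>"
    using mid by (simp add: abs_minus_commute)
  define W where "W = {(x, y). x < y \<and> y < x + 1 \<and> - L \<le> x \<and> x \<le> L}"
  have "W = {p\<in>space (borel \<Otimes>\<^sub>M borel). fst p < snd p \<and> snd p < fst p + 1 \<and> - L \<le> fst p \<and> fst p \<le> L}"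
    by (auto simp: W_def space_pair_measure)
  hence [measurable]: "W \<in> sets (borel \<Otimes>\<^sub>M borel)" by simp
  define Mid where "Mid = (\<integral>\<^sup>+x. \<integral>\<^sup>+y. ennreal (max 0 (F x - G y)) * indicator W (x, y) \<partial>lborel \<partial>lborel)"
  have r: "0 < sqrt (real n)" using n by simp
  \<comment> \<open>The substitution \<open>y = x + r / sqrt n\<close> produces a factor
    \<open>1 / sqrt n\<close>, so that one \<open>sqrt n\<close> is left to be moved into the
    integrand; the condition \<open>y < x + 1\<close> becomes \<open>r < sqrt n\<close>.\<close>
  have P: "(\<integral>\<^sup>+z. ennreal (p z) * indicator R z \<partial>(lborel \<Otimes>\<^sub>M lborel)) = ennreal (real n) * Mid"
  proof -
    have "(\<integral>\<^sup>+z. ennreal (p z) * indicator R z \<partial>(lborel \<Otimes>\<^sub>M lborel)) = (\<integral>\<^sup>+x. \<integral>\<^sup>+r. ennreal (p (x, r)) * indicator R (x, r) \<partial>lborel \<partial>lborel)"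
      by (rule lborel.nn_integral_fst[symmetric]) measurable
    also have "\<dots> = (\<integral>\<^sup>+x. ennreal (real n) * (\<integral>\<^sup>+y. ennreal (max 0 (F x - G y)) * indicator W (x, y) \<partial>lborel) \<partial>lborel)"
    proof (intro nn_integral_cong)
      fix x
      let ?s = "sqrt (real n)"
      have e: "(\<integral>\<^sup>+y. ennreal (max 0 (F x - G y)) * indicator W (x, y) \<partial>lborel) =
        ennreal (1 / ?s) * (\<integral>\<^sup>+r. ennreal (max 0 (F x - G (x + 1 / ?s * r))) * indicator W (x, x + 1 / ?s * r) \<partial>lborel)"
        using r by (subst nn_integral_real_affine[of _ "1 / ?s" x]) auto
      have "ennreal (real n) * (\<integral>\<^sup>+y. ennreal (max 0 (F x - G y)) * indicator W (x, y) \<partial>lborel)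
        = ennreal ?s * (\<integral>\<^sup>+r. ennreal (max 0 (F x - G (x + 1 / ?s * r))) * indicator W (x, x + 1 / ?s * r) \<partial>lborel)"
      proof -
        have "ennreal (real n) * ennreal (1 / ?s) = ennreal ?s" using r by (subst ennreal_mult''[symmetric]) (auto simp: real_div_sqrt)
        thus ?thesis unfolding e by (simp only: mult.assoc[symmetric])
      qed
      also have "\<dots> = (\<integral>\<^sup>+r. ennreal ?s * (ennreal (max 0 (F x - G (x + 1 / ?s * r))) * indicator W (x, x + 1 / ?s * r)) \<partial>lborel)"
        by (rule nn_integral_cmult[symmetric]) measurable
      also have "\<dots> = (\<integral>\<^sup>+r. ennreal (p (x, r)) * indicator R (x, r) \<partial>lborel)"
      proof (intro nn_integral_cong)
        fix t :: real
        have "max 0 (?s * a) = ?s * max 0 a" for a using r by (auto simp: max_def zero_le_mult_iff mult_le_0_iff)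
        hence "p (x, t) = ?s * max 0 (F x - G (x + t / ?s)) * indicator {..<?s} t" by (simp add: p_def)
        moreover have "(indicator W (x, x + 1 / ?s * t) :: ennreal) = indicator {..<?s} t * indicator R (x, t)"
          using r by (auto simp: W_def R_def indicator_def field_simps)
        ultimately show "ennreal ?s * (ennreal (max 0 (F x - G (x + 1 / ?s * t))) * indicator W (x, x + 1 / ?s * t)) = ennreal (p (x, t)) * indicator R (x, t)"
          using r by (auto simp: indicator_def ennreal_mult')
      qed
      finally show "(\<integral>\<^sup>+r. ennreal (p (x, r)) * indicator R (x, r) \<partial>lborel) = ennreal (real n) * (\<integral>\<^sup>+y. ennreal (max 0 (F x - G y)) * indicator W (x, y) \<partial>lborel)" ..
    qed
    also have "\<dots> = ennreal (real n) * Mid" unfolding Mid_def by (rule nn_integral_cmult) measurable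
    finally show ?thesis .
  qed
  have Q: "(\<integral>\<^sup>+z. ennreal (q z) * indicator R z \<partial>(lborel \<Otimes>\<^sub>M lborel)) = J"
  proof -
    have "(\<integral>\<^sup>+z. ennreal (q z) * indicator R z \<partial>(lborel \<Otimes>\<^sub>M lborel)) = (\<integral>\<^sup>+x. \<integral>\<^sup>+r. ennreal (q (x, r)) * indicator R (x, r) \<partial>lborel \<partial>lborel)"
      by (rule lborel.nn_integral_fst[symmetric]) measurable
    also have "\<dots> = J" unfolding J_def
    proof (intro nn_integral_cong)
      fix x
      have "(\<integral>\<^sup>+r. ennreal (q (x, r)) * indicator R (x, r) \<partial>lborel) = (\<integral>\<^sup>+r. ennreal (max 0 (sqrt (real n) * (F x - G x) - f x * r)) * indicator {0<..} r * indicator {-L..L} x \<partial>lborel)"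
        by (intro nn_integral_cong) (auto simp: q_def R_def indicator_def)
      also have "\<dots> = (\<integral>\<^sup>+r. ennreal (max 0 (sqrt (real n) * (F x - G x) - f x * r)) * indicator {0<..} r \<partial>lborel) * indicator {-L..L} x"
        by (rule nn_integral_multc) measurable
      finally show "(\<integral>\<^sup>+r. ennreal (q (x, r)) * indicator R (x, r) \<partial>lborel) = ennreal ((max 0 (sqrt (real n) * (F x - G x)))\<^sup>2 / (2 * f x)) * indicator {-(1-c)..1-c} x"
        by (simp only: nn_integral_ramp[OF f] L_def)
    qed
    finally show ?thesis .
  qed
  have PQ: "ennreal (real n) * Mid \<le> J + ennreal \<eta>"
    using nn_integral_le_abs_diff[of p "lborel \<Otimes>\<^sub>M lborel" q R] p0 q0 mid unfolding P Q
    by (simp add: add_left_mono order_trans[OF _ add_left_mono[OF mid]])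
  have QP: "J \<le> ennreal (real n) * Mid + ennreal \<eta>"
    using nn_integral_le_abs_diff[of q "lborel \<Otimes>\<^sub>M lborel" p R] p0 q0 mid' unfolding P Q
    by (simp add: order_trans[OF _ add_left_mono[OF mid']])
  have "ennreal (real n) * Mid \<le> I"
    unfolding Mid_def I_def by (intro mult_left_mono nn_integral_mono) (auto simp: W_def indicator_def)
  thus "J \<le> I + ennreal \<eta>" using QP by (meson add_right_mono order_trans)
  define Lt where "Lt = (\<integral>\<^sup>+x. \<integral>\<^sup>+y. ennreal (max 0 (F x - G y)) * indicator {(x, y). x < y \<and> y < c} (x, y) \<partial>lborel \<partial>lborel)"
  define Rt where "Rt = (\<integral>\<^sup>+x. \<integral>\<^sup>+y. ennreal (max 0 (F x - G y)) * indicator {(x, y). x < y \<and> - c < x} (x, y) \<partial>lborel \<partial>lborel)"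
  have Rt: "ennreal (real n) * Rt \<le> ennreal \<eta>"
  proof -
    have "Rt = (\<integral>\<^sup>+x. \<integral>\<^sup>+y. ennreal (max 0 (F (- y) - G (- x))) * indicator {(x, y). x < y \<and> - c < x} (- y, - x) \<partial>lborel \<partial>lborel)"
      unfolding Rt_def by (rule nn_integral_reflect2) measurable
    also have "\<dots> = (\<integral>\<^sup>+x. \<integral>\<^sup>+y. ennreal (max 0 ((1 - G (- x)) - (1 - F (- y)))) * indicator {(x, y). x < y \<and> y < c} (x, y) \<partial>lborel \<partial>lborel)"
      by (intro nn_integral_cong) (auto simp: indicator_def)
    finally show ?thesis using right by simp
  qed
  have Lt: "ennreal (real n) * Lt \<le> ennreal \<eta>" using left by (simp add: Lt_def)
  have split: "ennreal (max 0 (F x - G y)) * indicator {x<..} y \<le>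
     ennreal (max 0 (F x - G y)) * indicator W (x, y) +
     (ennreal (max 0 (F x - G y)) * indicator {(x, y). x < y \<and> y < c} (x, y) + ennreal (max 0 (F x - G y)) * indicator {(x, y). x < y \<and> - c < x} (x, y))" for x y
  proof (cases "x < y \<and> G y < F x")
    case True
    have "y < x + 1"
    proof (rule ccontr)
      assume "\<not> y < x + 1"
      hence "G (x + 1) \<le> G y" using G by (simp add: mono_def)
      thus False using sep[of x] True by simp
    qed
    hence "(x < y \<and> y < x + 1 \<and> - L \<le> x \<and> x \<le> L) \<or> y < c \<or> - c < x" using True by (auto simp: L_def)
    thus ?thesis using True by (auto simp: W_def add_increasing add_increasing2)
  qed (auto simp: max_def)
  have "I \<le> ennreal (real n) * (\<integral>\<^sup>+x. \<integral>\<^sup>+y. ennreal (max 0 (F x - G y)) * indicator W (x, y) +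
     (ennreal (max 0 (F x - G y)) * indicator {(x, y). x < y \<and> y < c} (x, y) + ennreal (max 0 (F x - G y)) * indicator {(x, y). x < y \<and> - c < x} (x, y)) \<partial>lborel \<partial>lborel)"
    unfolding I_def by (intro mult_left_mono nn_integral_mono split) simp
  also have "\<dots> = ennreal (real n) * (Mid + (Lt + Rt))"
  proof (rule arg_cong[where f="(*) (ennreal (real n))"])
    show "(\<integral>\<^sup>+x. \<integral>\<^sup>+y. ennreal (max 0 (F x - G y)) * indicator W (x, y) +
     (ennreal (max 0 (F x - G y)) * indicator {(x, y). x < y \<and> y < c} (x, y) + ennreal (max 0 (F x - G y)) * indicator {(x, y). x < y \<and> - c < x} (x, y)) \<partial>lborel \<partial>lborel) = Mid + (Lt + Rt)"
      unfolding Mid_def Lt_def Rt_def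
      by (rule nn_integral_add3[where u="\<lambda>x y. ennreal (max 0 (F x - G y)) * indicator W (x, y)"
            and v="\<lambda>x y. ennreal (max 0 (F x - G y)) * indicator {(x, y). x < y \<and> y < c} (x, y)"
            and w="\<lambda>x y. ennreal (max 0 (F x - G y)) * indicator {(x, y). x < y \<and> - c < x} (x, y)"]) measurable
  qed
  also have "\<dots> = ennreal (real n) * Mid + (ennreal (real n) * Lt + ennreal (real n) * Rt)" by (simp add: distrib_left)
  also have "\<dots> \<le> (J + ennreal \<eta>) + (ennreal \<eta> + ennreal \<eta>)" by (intro add_mono PQ Lt Rt)
  also have "\<dots> = J + ennreal (3 * \<eta>)" using \<eta> by (simp add: add.assoc ennreal_plus[symmetric] del: ennreal_plus)
  finally show "I \<le> J + ennreal (3 * \<eta>)" .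
qed

lemma gen_inverse_galois:
  assumes "mono F" "\<And>x. continuous (at_right x) F" "(F \<longlongrightarrow> 0) at_bot" "(F \<longlongrightarrow> 1) at_top" "0 < u" "u < 1"
  shows "gen_inverse F u \<le> x \<longleftrightarrow> u \<le> F x"
proof -
  interpret right_continuous_mono F 0 1 using assms by unfold_locales auto
  show ?thesis using pseudoinverse[OF assms(5,6), of x] by (simp add: gen_inverse_def)
qed

lemma quantile_distance:
  fixes F G :: "real \<Rightarrow> real"
  assumes a: "\<And>x. a \<le> x \<longleftrightarrow> u \<le> F x" and b: "\<And>x. b \<le> x \<longleftrightarrow> u \<le> G x"
    and sep: "\<And>x. F x \<le> G (x + d)" "\<And>x. G x \<le> F (x + d)"
  shows "\<bar>a - b\<bar> \<le> (d::real)"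
proof -
  have "u \<le> F a" "u \<le> G b" using a[of a] b[of b] by auto
  hence "u \<le> G (a + d)" using sep(1)[of a] by linarith
  moreover have "u \<le> F (b + d)" using \<open>u \<le> G b\<close> sep(2)[of b] by linarith
  ultimately show ?thesis using a[of "b + d"] b[of "a + d"] by simp
qed

section \<open>Comparison of the cost with a truncated quadratic functional\<close>

lemma step_cdf:
  fixes v :: "nat \<Rightarrow> real" and n :: nat
  assumes n: "1 \<le> n"
  defines "F \<equiv> \<lambda>x. (\<Sum>i=1..n. indicator {v i..} x) / real n"
  shows "mono F" "\<And>x. continuous (at_right x) F" "(F \<longlongrightarrow> 0) at_bot" "(F \<longlongrightarrow> 1) at_top"
proof -
  show "mono F" unfolding F_def by (intro monoI divide_right_mono sum_mono) (auto simp: indicator_def)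
  show "continuous (at_right x) F" for x
  proof -
    have "eventually (\<lambda>y. (indicator {v i..} y :: real) = indicator {v i..} x) (at_right x)" for i
    proof (cases "v i \<le> x")
      case True
      show ?thesis using eventually_at_right_less[of x]
        by (rule eventually_mono) (use True in \<open>auto simp: indicator_def\<close>)
    next
      case False
      thus ?thesis by (intro eventually_at_rightI[of x "v i"]) (auto simp: indicator_def)
    qed
    hence lim: "((\<lambda>y. indicator {v i..} y :: real) \<longlongrightarrow> indicator {v i..} x) (at_right x)" for i
      by (rule tendsto_eventually)
    show ?thesis unfolding F_def continuous_within by (rule tendsto_divide[OF tendsto_sum[OF lim] tendsto_const]) (use n in simp)
  qed
  have "eventually (\<lambda>x. (indicator {v i..} x :: real) = 0) at_bot" for i
    using eventually_gt_at_bot[of "v i"] by (elim eventually_mono) (auto simp: indicator_def)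
  hence lim0: "((\<lambda>x. indicator {v i..} x :: real) \<longlongrightarrow> 0) at_bot" for i by (rule tendsto_eventually)
  have "(F \<longlongrightarrow> (\<Sum>i=1..n. 0) / real n) at_bot" unfolding F_def by (rule tendsto_divide[OF tendsto_sum[OF lim0] tendsto_const]) (use n in simp)
  thus "(F \<longlongrightarrow> 0) at_bot" by simp
  have "eventually (\<lambda>x. (indicator {v i..} x :: real) = 1) at_top" for i
    using eventually_ge_at_top[of "v i"] by (elim eventually_mono) (auto simp: indicator_def)
  hence lim1: "((\<lambda>x. indicator {v i..} x :: real) \<longlongrightarrow> 1) at_top" for i by (rule tendsto_eventually)
  have "(F \<longlongrightarrow> (\<Sum>i=1..n. 1) / real n) at_top" unfolding F_def by (rule tendsto_divide[OF tendsto_sum[OF lim1] tendsto_const]) (use n in simp)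
  thus "(F \<longlongrightarrow> 1) at_top" using n by simp
qed

text \<open>On a grid of mesh \<open>d / 2\<close> only finitely many comparisons of neighbouring
  points are needed, each a law of large numbers. Between \<open>x\<close> and \<open>x + d\<close>
  there are always two neighbouring grid points, and monotonicity does the rest.\<close>

lemma (in iid_sample) eventually_separated:
  fixes F :: "real \<Rightarrow> real" and A B :: "real \<Rightarrow> 'c set"
  assumes A [measurable]: "\<And>x. A x \<in> sets S" and Amono: "\<And>x y. x \<le> y \<Longrightarrow> A x \<subseteq> A y" and FA: "\<And>x. measure law (A x) = F x"
    and B [measurable]: "\<And>x. B x \<in> sets S" and Bmono: "\<And>x y. x \<le> y \<Longrightarrow> B x \<subseteq> B y" and FB: "\<And>x. measure law (B x) = F x"
    and F: "\<And>x y. x < y \<Longrightarrow> F x < F y" and d: "0 < d"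
  obtains bad where "\<And>n. bad n \<in> events" "(\<lambda>n. prob (bad n)) \<longlonglongrightarrow> 0"
    "\<And>n \<omega> x. \<omega> \<in> space M - bad n \<Longrightarrow> - R \<le> x \<Longrightarrow> x \<le> R \<Longrightarrow> emp n (A x) \<omega> \<le> emp n (B (x + d)) \<omega>"
proof -
  define s where "s k = real_of_int k * (d / 2)" for k
  define I where "I = {\<lceil>- R / (d / 2)\<rceil>..\<lceil>R / (d / 2)\<rceil>}"
  define bad where "bad n = (\<Union>k\<in>I. {\<omega>\<in>space M. emp n (B (s (k + 1))) \<omega> < emp n (A (s k)) \<omega>})" for n
  show thesis
  proof (rule that[of bad])
    show bm: "bad n \<in> events" for n unfolding bad_def I_def by measurable
    have "s k < s (k + 1)" for k using d by (simp add: s_def)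
    hence "(\<lambda>n. prob {\<omega>\<in>space M. emp n (B (s (k + 1))) \<omega> < emp n (A (s k)) \<omega>}) \<longlonglongrightarrow> 0" for k
      by (intro emp_less_tendsto) (auto simp: FA FB intro!: F)
    hence lim: "(\<lambda>n. \<Sum>k\<in>I. prob {\<omega>\<in>space M. emp n (B (s (k + 1))) \<omega> < emp n (A (s k)) \<omega>}) \<longlonglongrightarrow> (\<Sum>k\<in>I. 0)"
      by (rule tendsto_sum)
    have "prob (bad n) \<le> (\<Sum>k\<in>I. prob {\<omega>\<in>space M. emp n (B (s (k + 1))) \<omega> < emp n (A (s k)) \<omega>})" for n
      unfolding bad_def by (rule finite_measure_subadditive_finite) (auto simp: I_def)
    hence ev: "eventually (\<lambda>n. prob (bad n) \<le> (\<Sum>k\<in>I. prob {\<omega>\<in>space M. emp n (B (s (k + 1))) \<omega> < emp n (A (s k)) \<omega>})) sequentially" by simp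
    show "(\<lambda>n. prob (bad n)) \<longlonglongrightarrow> 0"
      by (rule tendsto_sandwich[OF _ ev tendsto_const]) (use lim in auto)
    fix n \<omega> x assume \<omega>: "\<omega> \<in> space M - bad n" and x: "- R \<le> x" "x \<le> R"
    define k where "k = \<lceil>x / (d / 2)\<rceil>"
    have "- R / (d / 2) \<le> x / (d / 2)" "x / (d / 2) \<le> R / (d / 2)"
      by (rule divide_right_mono; use x d in simp)+
    hence kI: "k \<in> I" unfolding I_def k_def atLeastAtMost_iff by (intro conjI ceiling_mono)
    have "x / (d / 2) \<le> real_of_int k" "real_of_int k < x / (d / 2) + 1" unfolding k_def by linarith+
    hence k: "x \<le> s k" "s (k + 1) \<le> x + d" using d by (auto simp: s_def field_simps)
    have "emp n (A x) \<omega> \<le> emp n (A (s k)) \<omega>" by (rule emp_mono[OF Amono[OF k(1)]])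
    also have "\<dots> \<le> emp n (B (s (k + 1))) \<omega>" using \<omega> kI by (force simp: bad_def)
    also have "\<dots> \<le> emp n (B (x + d)) \<omega>" by (rule emp_mono[OF Bmono[OF k(2)]])
    finally show "emp n (A x) \<omega> \<le> emp n (B (x + d)) \<omega>" .
  qed
qed

section \<open>The sample of pairs, its quantile functions and its cost\<close>

locale paired_sample = iid_sample M "borel :: (real \<times> real) measure" Z + regular_cdf F \<gamma>
  for M :: "'a measure" and Z and F \<gamma> +
  assumes marg1: "\<And>x. measure law {z. fst z \<le> x} = F x" and marg2: "\<And>x. measure law {z. snd z \<le> x} = F x"
begin

definition A where "A x = {z :: real \<times> real. fst z \<le> x}"
definition B where "B x = {z :: real \<times> real. snd z \<le> x}"
text \<open>The reflected samples \<open>- X\<close>, \<open>- Y\<close> turn the right tail into a left one. Strict inequalities make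
  \<open>A' x\<close> the complement of \<open>A (- x)\<close>.\<close>

definition A' where "A' x = {z :: real \<times> real. - x < fst z}"
definition B' where "B' x = {z :: real \<times> real. - x < snd z}"

lemma sets_AB [measurable]: "A x \<in> sets borel" "B x \<in> sets borel" "A' x \<in> sets borel" "B' x \<in> sets borel"
proof -
  have [measurable]: "fst \<in> borel_measurable (borel :: (real \<times> real) measure)" "snd \<in> borel_measurable (borel :: (real \<times> real) measure)"
    by (auto intro!: borel_measurable_continuous_onI continuous_intros)
  have "{z\<in>space borel. fst z \<le> x} \<in> sets (borel :: (real \<times> real) measure)" "{z\<in>space borel. snd z \<le> x} \<in> sets (borel :: (real \<times> real) measure)"
    "{z\<in>space borel. - x < fst z} \<in> sets (borel :: (real \<times> real) measure)" "{z\<in>space borel. - x < snd z} \<in> sets (borel :: (real \<times> real) measure)"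
    by measurable
  thus "A x \<in> sets borel" "B x \<in> sets borel" "A' x \<in> sets borel" "B' x \<in> sets borel"
    by (simp_all add: A_def B_def A'_def B'_def)
qed

lemma mono_AB: "x \<le> y \<Longrightarrow> A x \<subseteq> A y" "x \<le> y \<Longrightarrow> B x \<subseteq> B y" "x \<le> y \<Longrightarrow> A' x \<subseteq> A' y" "x \<le> y \<Longrightarrow> B' x \<subseteq> B' y"
  by (auto simp: A_def B_def A'_def B'_def)

lemma joint_AB:
  "(\<lambda>(x, z). indicator (A x) z :: real) \<in> borel_measurable (borel \<Otimes>\<^sub>M borel)"
  "(\<lambda>(x, z). indicator (B x) z :: real) \<in> borel_measurable (borel \<Otimes>\<^sub>M borel)"
  "(\<lambda>(x, z). indicator (A' x) z :: real) \<in> borel_measurable (borel \<Otimes>\<^sub>M borel)"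
  "(\<lambda>(x, z). indicator (B' x) z :: real) \<in> borel_measurable (borel \<Otimes>\<^sub>M borel)"
proof -
  have [measurable]: "fst \<in> borel_measurable (borel :: (real \<times> real) measure)" "snd \<in> borel_measurable (borel :: (real \<times> real) measure)"
    by (auto intro!: borel_measurable_continuous_onI continuous_intros)
  have "(\<lambda>p. if fst (snd p) \<le> fst p then 1 else 0 :: real) \<in> borel_measurable (borel \<Otimes>\<^sub>M (borel :: (real \<times> real) measure))"
    "(\<lambda>p. if snd (snd p) \<le> fst p then 1 else 0 :: real) \<in> borel_measurable (borel \<Otimes>\<^sub>M (borel :: (real \<times> real) measure))"
    "(\<lambda>p. if - fst p < fst (snd p) then 1 else 0 :: real) \<in> borel_measurable (borel \<Otimes>\<^sub>M (borel :: (real \<times> real) measure))"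
    "(\<lambda>p. if - fst p < snd (snd p) then 1 else 0 :: real) \<in> borel_measurable (borel \<Otimes>\<^sub>M (borel :: (real \<times> real) measure))"
    by measurable
  thus "(\<lambda>(x, z). indicator (A x) z :: real) \<in> borel_measurable (borel \<Otimes>\<^sub>M borel)"
    "(\<lambda>(x, z). indicator (B x) z :: real) \<in> borel_measurable (borel \<Otimes>\<^sub>M borel)"
    "(\<lambda>(x, z). indicator (A' x) z :: real) \<in> borel_measurable (borel \<Otimes>\<^sub>M borel)"
    "(\<lambda>(x, z). indicator (B' x) z :: real) \<in> borel_measurable (borel \<Otimes>\<^sub>M borel)"
    by (simp_all add: indicator_def of_bool_def A_def B_def A'_def B'_def split_beta' cong: if_cong)
qed

lemma law_AB: "measure law (A x) = F x" "measure law (B x) = F x" "measure law (A' x) = 1 - F (- x)" "measure law (B' x) = 1 - F (- x)"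
proof -
  interpret L: prob_space law by (rule prob_space_law)
  show AB: "measure law (A x) = F x" "measure law (B x) = F x" for x using marg1 marg2 by (auto simp: A_def B_def)
  have "A' x = space law - A (- x)" "B' x = space law - B (- x)" by (auto simp: A_def B_def A'_def B'_def)
  thus "measure law (A' x) = 1 - F (- x)" "measure law (B' x) = 1 - F (- x)" by (simp_all add: L.prob_compl AB del: space_law)
qed

lemma emp_reflect:
  assumes n: "1 \<le> n" shows "emp n (A' x) \<omega> = 1 - emp n (A (- x)) \<omega>" "emp n (B' x) \<omega> = 1 - emp n (B (- x)) \<omega>"
proof -
  have "indicator (A' x) z = (1 - indicator (A (- x)) z :: real)" "indicator (B' x) z = (1 - indicator (B (- x)) z :: real)" for z
    by (auto simp: A_def B_def A'_def B'_def indicator_def)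
  thus "emp n (A' x) \<omega> = 1 - emp n (A (- x)) \<omega>" "emp n (B' x) \<omega> = 1 - emp n (B (- x)) \<omega>"
    using n by (simp_all add: emp_def sum_subtractf diff_divide_distrib)
qed

lemma emp_cdf:
  assumes n: "1 \<le> n"
  shows "mono (\<lambda>x. emp n (A x) \<omega>)" "continuous (at_right x) (\<lambda>x. emp n (A x) \<omega>)" "((\<lambda>x. emp n (A x) \<omega>) \<longlongrightarrow> 0) at_bot" "((\<lambda>x. emp n (A x) \<omega>) \<longlongrightarrow> 1) at_top"
    "mono (\<lambda>x. emp n (B x) \<omega>)" "continuous (at_right x) (\<lambda>x. emp n (B x) \<omega>)" "((\<lambda>x. emp n (B x) \<omega>) \<longlongrightarrow> 0) at_bot" "((\<lambda>x. emp n (B x) \<omega>) \<longlongrightarrow> 1) at_top"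
proof -
  have iA: "indicator (A x) z = (indicator {fst z..} x :: real)" and iB: "indicator (B x) z = (indicator {snd z..} x :: real)" for x z
    by (simp_all add: A_def B_def indicator_def)
  have eA: "(\<lambda>x. emp n (A x) \<omega>) = (\<lambda>x. (\<Sum>i=1..n. indicator {fst (Z i \<omega>)..} x) / real n)"
    and eB: "(\<lambda>x. emp n (B x) \<omega>) = (\<lambda>x. (\<Sum>i=1..n. indicator {snd (Z i \<omega>)..} x) / real n)"
    by (simp_all only: emp_def iA iB)
  show "mono (\<lambda>x. emp n (A x) \<omega>)" "continuous (at_right x) (\<lambda>x. emp n (A x) \<omega>)" "((\<lambda>x. emp n (A x) \<omega>) \<longlongrightarrow> 0) at_bot" "((\<lambda>x. emp n (A x) \<omega>) \<longlongrightarrow> 1) at_top"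
    unfolding eA by (rule step_cdf(1)[OF n], rule step_cdf(2)[OF n], rule step_cdf(3)[OF n], rule step_cdf(4)[OF n])
  show "mono (\<lambda>x. emp n (B x) \<omega>)" "continuous (at_right x) (\<lambda>x. emp n (B x) \<omega>)" "((\<lambda>x. emp n (B x) \<omega>) \<longlongrightarrow> 0) at_bot" "((\<lambda>x. emp n (B x) \<omega>) \<longlongrightarrow> 1) at_top"
    unfolding eB by (rule step_cdf(1)[OF n], rule step_cdf(2)[OF n], rule step_cdf(3)[OF n], rule step_cdf(4)[OF n])
qed

text \<open>Outside the unit interval \<open>gen_inverse\<close> is the infimum of an empty or unbounded set.\<close>

definition qA where "qA n u \<omega> = indicator {0<..<1} u * gen_inverse (\<lambda>x. emp n (A x) \<omega>) u"
definition qB where "qB n u \<omega> = indicator {0<..<1} u * gen_inverse (\<lambda>x. emp n (B x) \<omega>) u"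

lemma q_galois:
  assumes n: "1 \<le> n" and u: "0 < u" "u < 1"
  shows "qA n u \<omega> \<le> x \<longleftrightarrow> u \<le> emp n (A x) \<omega>" "qB n u \<omega> \<le> x \<longleftrightarrow> u \<le> emp n (B x) \<omega>"
  using gen_inverse_galois[OF emp_cdf(1)[OF n, of \<omega>] emp_cdf(2)[OF n, of _ \<omega>] emp_cdf(3)[OF n, of \<omega>] emp_cdf(4)[OF n, of \<omega>] u, of x]
    gen_inverse_galois[OF emp_cdf(5)[OF n, of \<omega>] emp_cdf(6)[OF n, of _ \<omega>] emp_cdf(7)[OF n, of \<omega>] emp_cdf(8)[OF n, of \<omega>] u, of x] u
  by (simp_all add: qA_def qB_def)

text \<open>Expresses the sublevel sets of the quantile functions through empirical frequencies at a
  fixed point, which makes them jointly measurable in \<open>u\<close> and \<omega>.\<close>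

lemma q_le_iff:
  assumes n: "1 \<le> n"
  shows "qA n u \<omega> \<le> x \<longleftrightarrow> (0 < u \<and> u < 1 \<and> u \<le> emp n (A x) \<omega>) \<or> (\<not> (0 < u \<and> u < 1) \<and> 0 \<le> x)"
    "qB n u \<omega> \<le> x \<longleftrightarrow> (0 < u \<and> u < 1 \<and> u \<le> emp n (B x) \<omega>) \<or> (\<not> (0 < u \<and> u < 1) \<and> 0 \<le> x)"
proof -
  have "qA n u \<omega> = 0 \<and> qB n u \<omega> = 0" if "\<not> (0 < u \<and> u < 1)" using that by (auto simp: qA_def qB_def indicator_def)
  note z = this
  show "qA n u \<omega> \<le> x \<longleftrightarrow> (0 < u \<and> u < 1 \<and> u \<le> emp n (A x) \<omega>) \<or> (\<not> (0 < u \<and> u < 1) \<and> 0 \<le> x)"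
    using q_galois(1)[OF n, of u \<omega> x] z by (cases "0 < u \<and> u < 1") auto
  show "qB n u \<omega> \<le> x \<longleftrightarrow> (0 < u \<and> u < 1 \<and> u \<le> emp n (B x) \<omega>) \<or> (\<not> (0 < u \<and> u < 1) \<and> 0 \<le> x)"
    using q_galois(2)[OF n, of u \<omega> x] z by (cases "0 < u \<and> u < 1") auto
qed

lemma emp_AB_measurable [measurable]:
  "(\<lambda>(x, \<omega>). emp n (A x) \<omega>) \<in> borel_measurable (borel \<Otimes>\<^sub>M M)" "(\<lambda>(x, \<omega>). emp n (B x) \<omega>) \<in> borel_measurable (borel \<Otimes>\<^sub>M M)"
  by (rule emp_joint_measurable, rule joint_AB)+

lemma q_measurable:
  assumes n: "1 \<le> n"
  shows "(\<lambda>(u, \<omega>). qA n u \<omega>) \<in> borel_measurable (borel \<Otimes>\<^sub>M M)" "(\<lambda>(u, \<omega>). qB n u \<omega>) \<in> borel_measurable (borel \<Otimes>\<^sub>M M)"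
proof -
  have "{p\<in>space (borel \<Otimes>\<^sub>M M). qA n (fst p) (snd p) \<le> x} =
     {p\<in>space (borel \<Otimes>\<^sub>M M). (0 < fst p \<and> fst p < 1 \<and> fst p \<le> emp n (A x) (snd p)) \<or> (\<not> (0 < fst p \<and> fst p < 1) \<and> 0 \<le> x)}" for x
    using q_le_iff(1)[OF n] by simp
  thus "(\<lambda>(u, \<omega>). qA n u \<omega>) \<in> borel_measurable (borel \<Otimes>\<^sub>M M)"
    unfolding borel_measurable_iff_le split_beta' by simp
  have "{p\<in>space (borel \<Otimes>\<^sub>M M). qB n (fst p) (snd p) \<le> x} =
     {p\<in>space (borel \<Otimes>\<^sub>M M). (0 < fst p \<and> fst p < 1 \<and> fst p \<le> emp n (B x) (snd p)) \<or> (\<not> (0 < fst p \<and> fst p < 1) \<and> 0 \<le> x)}" for x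
    using q_le_iff(2)[OF n] by simp
  thus "(\<lambda>(u, \<omega>). qB n u \<omega>) \<in> borel_measurable (borel \<Otimes>\<^sub>M M)"
    unfolding borel_measurable_iff_le split_beta' by simp
qed

definition cost where
  "cost \<rho> n \<omega> = real n * (LBINT u:{0<..<1}. \<rho> (gen_inverse (\<lambda>x. emp n (A x) \<omega>) u - gen_inverse (\<lambda>x. emp n (B x) \<omega>) u))"

lemma cost_q: "cost \<rho> n \<omega> = real n * (LINT u|lborel. indicator {0<..<1} u * \<rho> (qA n u \<omega> - qB n u \<omega>))"
  unfolding cost_def set_lebesgue_integral_def qA_def qB_def
  by (intro arg_cong2[where f="(*)"] refl Bochner_Integration.integral_cong) (auto simp: indicator_def)

lemma cost_measurable:
  assumes [measurable]: "\<rho> \<in> borel_measurable borel" shows "cost \<rho> n \<in> borel_measurable M"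
proof (cases "n = 0")
  case True
  thus ?thesis unfolding cost_def[abs_def] by simp
next
  case False
  hence n: "1 \<le> n" by simp
  note [measurable] = q_measurable[OF n]
  have [measurable]: "(\<lambda>(\<omega>, u). qA n u \<omega>) \<in> borel_measurable (M \<Otimes>\<^sub>M borel)" "(\<lambda>(\<omega>, u). qB n u \<omega>) \<in> borel_measurable (M \<Otimes>\<^sub>M borel)"
    using measurable_compose[OF measurable_pair_swap' q_measurable(1)[OF n]] measurable_compose[OF measurable_pair_swap' q_measurable(2)[OF n]] by (simp_all add: split_beta')
  show ?thesis unfolding cost_q[abs_def] by measurable
qed

definition D where "D n x \<omega> = sqrt (real n) * (emp n (A x) \<omega> - emp n (B x) \<omega>)"
definition Phi where "Phi L n \<omega> = (LBINT x:{-L..L}. (D n x \<omega>)\<^sup>2 / f x)"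

lemma D_joint: "(\<lambda>(x, \<omega>). D n x \<omega>) \<in> borel_measurable (borel \<Otimes>\<^sub>M M)"
  unfolding D_def by measurable

lemma D_section [measurable]: "(\<lambda>x. D n x \<omega>) \<in> borel_measurable borel"
proof (cases "n = 0")
  case False
  hence "1 \<le> n" by simp
  hence [measurable]: "(\<lambda>x. emp n (A x) \<omega>) \<in> borel_measurable borel" "(\<lambda>x. emp n (B x) \<omega>) \<in> borel_measurable borel"
    using emp_cdf(1,5) borel_measurable_mono by blast+
  show ?thesis unfolding D_def by measurable
qed (simp add: D_def)

lemma D_square_le: "(D n x \<omega>)\<^sup>2 \<le> real n"
proof -
  have "\<bar>emp n (A x) \<omega> - emp n (B x) \<omega>\<bar> \<le> 1"
    using emp_nonneg[of n "A x" \<omega>] emp_le_1[of n "A x" \<omega>] emp_nonneg[of n "B x" \<omega>] emp_le_1[of n "B x" \<omega>] by linarith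
  hence "(emp n (A x) \<omega> - emp n (B x) \<omega>)\<^sup>2 \<le> 1" by (simp add: abs_square_le_1)
  hence "real n * (emp n (A x) \<omega> - emp n (B x) \<omega>)\<^sup>2 \<le> real n * 1" by (intro mult_left_mono) auto
  thus ?thesis by (simp add: D_def power_mult_distrib)
qed

lemma D_set_integrable: "set_integrable lborel {-L..L} (\<lambda>x. (D n x \<omega>)\<^sup>2 / f x)"
  unfolding set_integrable_def
proof (rule Bochner_Integration.integrable_bound)
  show "integrable lborel (\<lambda>x. indicator {-L..L} x *\<^sub>R (real n / f x))"
    using f_pos by (intro borel_integrable_atLeastAtMost'[unfolded set_integrable_def] continuous_on_divide continuous_on_const continuous_on_subset[OF f_cont])
      (auto simp: less_imp_neq[symmetric])
  show "AE x in lborel. norm (indicator {-L..L} x *\<^sub>R ((D n x \<omega>)\<^sup>2 / f x)) \<le> norm (indicator {-L..L} x *\<^sub>R (real n / f x))"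
    using D_square_le f_pos by (intro AE_I2) (auto simp: indicator_def abs_of_pos less_imp_le intro!: divide_right_mono)
qed measurable

lemma Phi_nn: "ennreal (Phi L n \<omega>) = (\<integral>\<^sup>+x. ennreal ((D n x \<omega>)\<^sup>2 / f x) * indicator {-L..L} x \<partial>lborel)"
proof -
  have "ennreal (Phi L n \<omega>) = (\<integral>\<^sup>+x. ennreal (indicator {-L..L} x *\<^sub>R ((D n x \<omega>)\<^sup>2 / f x)) \<partial>lborel)"
    unfolding Phi_def set_lebesgue_integral_def using D_set_integrable[of L n \<omega>] f_pos
    by (intro nn_integral_eq_integral[symmetric]) (auto simp: set_integrable_def less_imp_le)
  also have "\<dots> = (\<integral>\<^sup>+x. ennreal ((D n x \<omega>)\<^sup>2 / f x) * indicator {-L..L} x \<partial>lborel)"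
    by (intro nn_integral_cong) (auto simp: indicator_def)
  finally show ?thesis .
qed

lemma Phi_nonneg: "0 \<le> Phi L n \<omega>"
  unfolding Phi_def set_lebesgue_integral_def using f_pos by (intro Bochner_Integration.integral_nonneg) (auto simp: less_imp_le)

lemma Phi_measurable: "Phi L n \<in> borel_measurable M"
proof -
  note [measurable del] = D_section
  have [measurable]: "(\<lambda>(\<omega>, x). D n x \<omega>) \<in> borel_measurable (M \<Otimes>\<^sub>M borel)"
    using measurable_compose[OF measurable_pair_swap' D_joint] by (simp add: split_beta')
  show ?thesis unfolding Phi_def[abs_def] set_lebesgue_integral_def by measurable
qed

text \<open>A statement about a single \<omega>. The separation bounds the quantile gap by
  \<open>d\<close>; \<open>d <= x0\<close> makes the cost quadratic, and \<open>d <= 1\<close>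
  confines the double integral to a strip of width 1. In \<open>r1\<close> and \<open>r2\<close> the
  roles of the samples are exchanged, since complements reverse the sign of the difference. The
  constant 12 is \<open>2 * (3 + 3)\<close>, with the factor 2 from the area formula.\<close>

lemma cost_comparison:
  assumes n: "1 \<le> n" and \<eta>: "0 \<le> \<eta>" and d: "d \<le> 1" "d \<le> x0" and \<rho>: "\<And>x. \<bar>x\<bar> \<le> x0 \<Longrightarrow> \<rho> x = x\<^sup>2"
    and sep: "\<And>x. emp n (A x) \<omega> \<le> emp n (B (x + d)) \<omega>" "\<And>x. emp n (B x) \<omega> \<le> emp n (A (x + d)) \<omega>"
    and l1: "ennreal (real n) * (\<integral>\<^sup>+x. \<integral>\<^sup>+y. ennreal (max 0 (emp n (A x) \<omega> - emp n (B y) \<omega>)) * indicator {(x, y). x < y \<and> y < c} (x, y) \<partial>lborel \<partial>lborel) \<le> ennreal \<eta>"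
    and l2: "ennreal (real n) * (\<integral>\<^sup>+x. \<integral>\<^sup>+y. ennreal (max 0 (emp n (B x) \<omega> - emp n (A y) \<omega>)) * indicator {(x, y). x < y \<and> y < c} (x, y) \<partial>lborel \<partial>lborel) \<le> ennreal \<eta>"
    and r1: "ennreal (real n) * (\<integral>\<^sup>+x. \<integral>\<^sup>+y. ennreal (max 0 (emp n (B' x) \<omega> - emp n (A' y) \<omega>)) * indicator {(x, y). x < y \<and> y < c} (x, y) \<partial>lborel \<partial>lborel) \<le> ennreal \<eta>"
    and r2: "ennreal (real n) * (\<integral>\<^sup>+x. \<integral>\<^sup>+y. ennreal (max 0 (emp n (A' x) \<omega> - emp n (B' y) \<omega>)) * indicator {(x, y). x < y \<and> y < c} (x, y) \<partial>lborel \<partial>lborel) \<le> ennreal \<eta>"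
    and m1: "(\<integral>\<^sup>+p. ennreal \<bar>max 0 (sqrt (real n) * (emp n (A (fst p)) \<omega> - emp n (B (fst p + snd p / sqrt (real n))) \<omega>)) * indicator {..<sqrt (real n)} (snd p)
            - max 0 (sqrt (real n) * (emp n (A (fst p)) \<omega> - emp n (B (fst p)) \<omega>) - f (fst p) * snd p)\<bar>
          * indicator ({-(1-c)..1-c} \<times> {0<..}) p \<partial>(lborel \<Otimes>\<^sub>M lborel)) \<le> ennreal \<eta>"
    and m2: "(\<integral>\<^sup>+p. ennreal \<bar>max 0 (sqrt (real n) * (emp n (B (fst p)) \<omega> - emp n (A (fst p + snd p / sqrt (real n))) \<omega>)) * indicator {..<sqrt (real n)} (snd p)
            - max 0 (sqrt (real n) * (emp n (B (fst p)) \<omega> - emp n (A (fst p)) \<omega>) - f (fst p) * snd p)\<bar>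
          * indicator ({-(1-c)..1-c} \<times> {0<..}) p \<partial>(lborel \<Otimes>\<^sub>M lborel)) \<le> ennreal \<eta>"
    and \<omega>: "\<omega> \<in> space M"
  shows "\<bar>cost \<rho> n \<omega> - Phi (1 - c) n \<omega>\<bar> \<le> 12 * \<eta>"
proof -
  define L where "L = 1 - c"
  have [measurable]: "(\<lambda>x. emp n (A x) \<omega>) \<in> borel_measurable borel" "(\<lambda>x. emp n (B x) \<omega>) \<in> borel_measurable borel"
    using emp_cdf(1,5)[OF n] borel_measurable_mono by blast+
  have [measurable]: "(\<lambda>u. qA n u \<omega>) \<in> borel_measurable borel" "(\<lambda>u. qB n u \<omega>) \<in> borel_measurable borel"
    using measurable_Pair1[OF q_measurable(1)[OF n] \<omega>] measurable_Pair1[OF q_measurable(2)[OF n] \<omega>] by simp_all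
  define I1 where "I1 = ennreal (real n) * (\<integral>\<^sup>+x. \<integral>\<^sup>+y. ennreal (max 0 (emp n (A x) \<omega> - emp n (B y) \<omega>)) * indicator {x<..} y \<partial>lborel \<partial>lborel)"
  define I2 where "I2 = ennreal (real n) * (\<integral>\<^sup>+x. \<integral>\<^sup>+y. ennreal (max 0 (emp n (B x) \<omega> - emp n (A y) \<omega>)) * indicator {x<..} y \<partial>lborel \<partial>lborel)"
  define J1 where "J1 = (\<integral>\<^sup>+x. ennreal ((max 0 (sqrt (real n) * (emp n (A x) \<omega> - emp n (B x) \<omega>)))\<^sup>2 / (2 * f x)) * indicator {-L..L} x \<partial>lborel)"
  define J2 where "J2 = (\<integral>\<^sup>+x. ennreal ((max 0 (sqrt (real n) * (emp n (B x) \<omega> - emp n (A x) \<omega>)))\<^sup>2 / (2 * f x)) * indicator {-L..L} x \<partial>lborel)"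
  have sep1: "emp n (A x) \<omega> \<le> emp n (B (x + 1)) \<omega>" "emp n (B x) \<omega> \<le> emp n (A (x + 1)) \<omega>" for x
    using order_trans[OF sep(1) emp_mono[OF mono_AB(2)], of x "x + 1"] order_trans[OF sep(2) emp_mono[OF mono_AB(1)], of x "x + 1"] d by simp_all
  have c1: "I1 \<le> J1 + ennreal (3 * \<eta>)" "J1 \<le> I1 + ennreal \<eta>"
    unfolding I1_def J1_def L_def using one_sided_comparison[OF emp_cdf(1)[OF n] emp_cdf(5)[OF n] f_measurable f_pos n \<eta> sep1(1) l1 _ m1]
      r1[unfolded emp_reflect[OF n]] by blast+
  have c2: "I2 \<le> J2 + ennreal (3 * \<eta>)" "J2 \<le> I2 + ennreal \<eta>"
    unfolding I2_def J2_def L_def using one_sided_comparison[OF emp_cdf(5)[OF n] emp_cdf(1)[OF n] f_measurable f_pos n \<eta> sep1(2) l2 _ m2]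
      r2[unfolded emp_reflect[OF n]] by blast+
  have J: "ennreal (Phi L n \<omega>) = 2 * (J1 + J2)"
  proof -
    have "ennreal (Phi L n \<omega>) = (\<integral>\<^sup>+x. ennreal 2 * (ennreal ((max 0 (sqrt (real n) * (emp n (A x) \<omega> - emp n (B x) \<omega>)))\<^sup>2 / (2 * f x)) * indicator {-L..L} x
        + ennreal ((max 0 (sqrt (real n) * (emp n (B x) \<omega> - emp n (A x) \<omega>)))\<^sup>2 / (2 * f x)) * indicator {-L..L} x) \<partial>lborel)"
      unfolding Phi_nn
    proof (intro nn_integral_cong)
      fix x
      define a where "a = D n x \<omega>"
      have b: "sqrt (real n) * (emp n (A x) \<omega> - emp n (B x) \<omega>) = a" "sqrt (real n) * (emp n (B x) \<omega> - emp n (A x) \<omega>) = - a"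
        by (simp_all add: a_def D_def algebra_simps)
      have "a\<^sup>2 = (max 0 a)\<^sup>2 + (max 0 (- a))\<^sup>2" by (auto simp: max_def)
      define p q where "p = (max 0 a)\<^sup>2 / (2 * f x)" and "q = (max 0 (- a))\<^sup>2 / (2 * f x)"
      have pq: "0 \<le> p" "0 \<le> q" using f_pos[of x] by (auto simp: p_def q_def less_imp_le)
      have "a\<^sup>2 / f x = 2 * (p + q)"
        unfolding p_def q_def \<open>a\<^sup>2 = _\<close> using f_pos[of x] by (simp add: field_simps)
      hence "ennreal (a\<^sup>2 / f x) = ennreal 2 * (ennreal p + ennreal q)"
        using pq by (simp only: ennreal_mult' ennreal_plus zero_le_numeral)
      hence "ennreal (a\<^sup>2 / f x) = ennreal 2 * (ennreal ((max 0 a)\<^sup>2 / (2 * f x)) + ennreal ((max 0 (- a))\<^sup>2 / (2 * f x)))"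
        by (simp only: p_def q_def)
      thus "ennreal ((D n x \<omega>)\<^sup>2 / f x) * indicator {-L..L} x = ennreal 2 * (ennreal ((max 0 (sqrt (real n) * (emp n (A x) \<omega> - emp n (B x) \<omega>)))\<^sup>2 / (2 * f x)) * indicator {-L..L} x
        + ennreal ((max 0 (sqrt (real n) * (emp n (B x) \<omega> - emp n (A x) \<omega>)))\<^sup>2 / (2 * f x)) * indicator {-L..L} x)"
        unfolding b a_def[symmetric] by (simp only: distrib_right mult.assoc)
    qed
    also have "\<dots> = ennreal 2 * (J1 + J2)"
      unfolding J1_def J2_def by (subst nn_integral_cmult, measurable, subst nn_integral_add, measurable)
    finally show ?thesis by simp
  qed
  have sq: "ennreal (real n) * (\<integral>\<^sup>+u. ennreal ((qA n u \<omega> - qB n u \<omega>)\<^sup>2) * indicator {0<..<1} u \<partial>lborel) = 2 * (I1 + I2)"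
    by (subst square_distance_quantiles[where F="\<lambda>x. emp n (A x) \<omega>" and G="\<lambda>x. emp n (B x) \<omega>"])
       (auto simp: emp_nonneg emp_le_1 q_galois[OF n] I1_def I2_def distrib_left mult.left_commute)
  have quad: "indicator {0<..<1} u * \<rho> (qA n u \<omega> - qB n u \<omega>) = indicator {0<..<1} u * (qA n u \<omega> - qB n u \<omega>)\<^sup>2" for u
  proof (cases "0 < u \<and> u < 1")
    case True
    have a: "qA n u \<omega> \<le> x \<longleftrightarrow> u \<le> emp n (A x) \<omega>" and b: "qB n u \<omega> \<le> x \<longleftrightarrow> u \<le> emp n (B x) \<omega>" for x
      using q_galois[OF n] True by blast+
    have "\<bar>qA n u \<omega> - qB n u \<omega>\<bar> \<le> d"
      using quantile_distance[where F="\<lambda>x. emp n (A x) \<omega>" and G="\<lambda>x. emp n (B x) \<omega>", OF a b sep] .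
    thus ?thesis using \<rho>[of "qA n u \<omega> - qB n u \<omega>"] d by simp
  qed auto
  have up: "2 * (I1 + I2) \<le> ennreal (Phi L n \<omega> + 12 * \<eta>)"
  proof -
    have "2 * (I1 + I2) \<le> 2 * ((J1 + ennreal (3 * \<eta>)) + (J2 + ennreal (3 * \<eta>)))" by (intro mult_left_mono add_mono c1 c2) simp
    also have "\<dots> = 2 * (J1 + J2) + 2 * (ennreal (3 * \<eta>) + ennreal (3 * \<eta>))" by (simp add: distrib_left add_ac)
    also have "2 * (ennreal (3 * \<eta>) + ennreal (3 * \<eta>)) = ennreal (12 * \<eta>)"
      using \<eta> by (simp add: ennreal_plus[symmetric] ennreal_mult'[symmetric] flip: ennreal_numeral del: ennreal_plus)
    finally show ?thesis using J \<eta> Phi_nonneg[of L n \<omega>] by (simp add: ennreal_plus)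
  qed
  \<comment> \<open>Finiteness has to be known here: a divergent Bochner integral would be 0, and
    the identification of the cost with \<open>2 * (I1 + I2)\<close> would fail.\<close>
  have ne: "(\<integral>\<^sup>+u. ennreal ((qA n u \<omega> - qB n u \<omega>)\<^sup>2) * indicator {0<..<1} u \<partial>lborel) \<noteq> \<infinity>"
  proof
    assume "(\<integral>\<^sup>+u. ennreal ((qA n u \<omega> - qB n u \<omega>)\<^sup>2) * indicator {0<..<1} u \<partial>lborel) = \<infinity>"
    hence inf: "2 * (I1 + I2) = top" unfolding sq[symmetric] using n by (simp add: ennreal_mult_top)
    show False using up unfolding inf by (simp add: top_unique)
  qed
  have T: "ennreal (cost \<rho> n \<omega>) = 2 * (I1 + I2)"
  proof -
    have "(LINT u|lborel. indicator {0<..<1} u * (qA n u \<omega> - qB n u \<omega>)\<^sup>2) = enn2real (\<integral>\<^sup>+u. ennreal (indicator {0<..<1} u * (qA n u \<omega> - qB n u \<omega>)\<^sup>2) \<partial>lborel)"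
      by (rule integral_eq_nn_integral) auto
    also have "(\<integral>\<^sup>+u. ennreal (indicator {0<..<1} u * (qA n u \<omega> - qB n u \<omega>)\<^sup>2) \<partial>lborel) = (\<integral>\<^sup>+u. ennreal ((qA n u \<omega> - qB n u \<omega>)\<^sup>2) * indicator {0<..<1} u \<partial>lborel)"
      by (intro nn_integral_cong) (auto simp: indicator_def)
    finally have "cost \<rho> n \<omega> = real n * enn2real (\<integral>\<^sup>+u. ennreal ((qA n u \<omega> - qB n u \<omega>)\<^sup>2) * indicator {0<..<1} u \<partial>lborel)"
      unfolding cost_q quad by simp
    thus ?thesis unfolding sq[symmetric] using ne by (simp add: ennreal_mult' ennreal_enn2real_if top.not_eq_extremum)
  qed
  have T0: "0 \<le> cost \<rho> n \<omega>"
    unfolding cost_q quad by (intro mult_nonneg_nonneg Bochner_Integration.integral_nonneg) auto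
  have "ennreal (cost \<rho> n \<omega>) \<le> ennreal (Phi L n \<omega> + 12 * \<eta>)" using up by (simp add: T)
  hence 1: "cost \<rho> n \<omega> \<le> Phi L n \<omega> + 12 * \<eta>" using \<eta> Phi_nonneg[of L n \<omega>] by (subst (asm) ennreal_le_iff) auto
  have "ennreal (Phi L n \<omega>) \<le> 2 * ((I1 + ennreal \<eta>) + (I2 + ennreal \<eta>))" unfolding J by (intro mult_left_mono add_mono c1 c2) simp
  also have "\<dots> = 2 * (I1 + I2) + 2 * (ennreal \<eta> + ennreal \<eta>)" by (simp add: distrib_left add_ac)
  also have "2 * (ennreal \<eta> + ennreal \<eta>) = ennreal (4 * \<eta>)"
    using \<eta> by (simp add: ennreal_plus[symmetric] ennreal_mult'[symmetric] flip: ennreal_numeral del: ennreal_plus)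
  finally have "ennreal (Phi L n \<omega>) \<le> ennreal (cost \<rho> n \<omega> + 4 * \<eta>)" using \<eta> T0 by (simp add: T ennreal_plus)
  hence 2: "Phi L n \<omega> \<le> cost \<rho> n \<omega> + 4 * \<eta>" using \<eta> T0 by (subst (asm) ennreal_le_iff) auto
  show ?thesis using 1 2 \<eta> by (simp add: L_def)
qed

end

text \<open>On \<open>E\<close> the exponential is Lipschitz with constant \<open>l\<close>; off
  \<open>E\<close> both exponentials lie between 0 and 1.\<close>

lemma (in prob_space) laplace_difference_le:
  fixes U V :: "'a \<Rightarrow> real"
  assumes [measurable]: "U \<in> borel_measurable M" "V \<in> borel_measurable M" "E \<in> events"
    and U: "\<And>\<omega>. 0 \<le> U \<omega>" and V: "\<And>\<omega>. 0 \<le> V \<omega>" and l: "0 \<le> l" and d: "0 \<le> \<delta>"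
    and E: "\<And>\<omega>. \<omega> \<in> E \<Longrightarrow> \<bar>U \<omega> - V \<omega>\<bar> \<le> \<delta>"
  shows "\<bar>expectation (\<lambda>\<omega>. exp (- (l * U \<omega>))) - expectation (\<lambda>\<omega>. exp (- (l * V \<omega>)))\<bar> \<le> prob (space M - E) + l * \<delta>"
proof -
  have i: "integrable M (\<lambda>\<omega>. exp (- (l * U \<omega>)))" "integrable M (\<lambda>\<omega>. exp (- (l * V \<omega>)))"
    using U V l by (auto intro!: integrable_const_bound[of _ 1] mult_nonneg_nonneg)
  have ib: "integrable M (\<lambda>\<omega>. indicator (space M - E) \<omega> + l * \<delta> :: real)"
    by (intro Bochner_Integration.integrable_add integrable_real_indicator) (auto simp: emeasure_eq_measure)
  have "\<bar>expectation (\<lambda>\<omega>. exp (- (l * U \<omega>))) - expectation (\<lambda>\<omega>. exp (- (l * V \<omega>)))\<bar> = \<bar>expectation (\<lambda>\<omega>. exp (- (l * U \<omega>)) - exp (- (l * V \<omega>)))\<bar>"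
    using i by simp
  also have "\<dots> \<le> expectation (\<lambda>\<omega>. \<bar>exp (- (l * U \<omega>)) - exp (- (l * V \<omega>))\<bar>)" by (rule integral_abs_bound)
  also have "\<dots> \<le> expectation (\<lambda>\<omega>. indicator (space M - E) \<omega> + l * \<delta>)"
  proof (rule integral_mono)
    fix \<omega> assume \<omega>: "\<omega> \<in> space M"
    show "\<bar>exp (- (l * U \<omega>)) - exp (- (l * V \<omega>))\<bar> \<le> indicator (space M - E) \<omega> + l * \<delta>"
    proof (cases "\<omega> \<in> E")
      case True
      have "\<bar>exp (- (l * U \<omega>)) - exp (- (l * V \<omega>))\<bar> \<le> \<bar>l * U \<omega> - l * V \<omega>\<bar>" using U V l by (intro abs_exp_minus_diff_le) auto
      also have "\<dots> = l * \<bar>U \<omega> - V \<omega>\<bar>" using l by (simp add: right_diff_distrib[symmetric] abs_mult)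
      also have "\<dots> \<le> l * \<delta>" using E[OF True] l by (rule mult_left_mono)
      finally show ?thesis using True by simp
    next
      case False
      have "0 < exp (- (l * U \<omega>))" "exp (- (l * U \<omega>)) \<le> 1" "0 < exp (- (l * V \<omega>))" "exp (- (l * V \<omega>)) \<le> 1"
        using U V l by (auto intro: mult_nonneg_nonneg)
      hence "\<bar>exp (- (l * U \<omega>)) - exp (- (l * V \<omega>))\<bar> \<le> 1" by linarith
      moreover have "0 \<le> l * \<delta>" using l d by simp
      ultimately show ?thesis using False \<omega> by simp
    qed
  qed (use i ib in auto)
  also have "\<dots> = prob (space M - E) + l * \<delta>"
    by (subst Bochner_Integration.integral_add) (auto simp: prob_space emeasure_eq_measure)
  finally show ?thesis .
qed

lemma (in prob_space) eventually_small_probability: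
  fixes V :: "nat \<Rightarrow> 'a \<Rightarrow> ennreal"
  assumes [measurable]: "\<And>n. V n \<in> borel_measurable M" and lim: "(\<lambda>n. \<integral>\<^sup>+\<omega>. V n \<omega> \<partial>M) \<longlonglongrightarrow> 0" and \<eta>: "0 < \<eta>" and \<delta>: "0 < \<delta>"
  shows "eventually (\<lambda>n. prob {\<omega>\<in>space M. \<not> V n \<omega> \<le> ennreal \<eta>} < \<delta>) sequentially"
proof -
  have "(\<lambda>n. ennreal (1 / \<eta>) * (\<integral>\<^sup>+\<omega>. V n \<omega> \<partial>M)) \<longlonglongrightarrow> ennreal (1 / \<eta>) * 0" by (intro ennreal_tendsto_cmult lim) simp
  hence "eventually (\<lambda>n. ennreal (1 / \<eta>) * (\<integral>\<^sup>+\<omega>. V n \<omega> \<partial>M) < ennreal \<delta>) sequentially"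
    using \<delta> by (intro order_tendstoD(2)[where y="ennreal (1 / \<eta>) * 0"]) auto
  thus ?thesis
  proof eventually_elim
    fix n assume lt: "ennreal (1 / \<eta>) * (\<integral>\<^sup>+\<omega>. V n \<omega> \<partial>M) < ennreal \<delta>"
    have "{\<omega>\<in>space M. \<not> V n \<omega> \<le> ennreal \<eta>} \<subseteq> {\<omega>\<in>space M. 1 \<le> ennreal (1 / \<eta>) * V n \<omega>}"
    proof safe
      fix \<omega> assume "\<not> V n \<omega> \<le> ennreal \<eta>"
      hence "ennreal (1 / \<eta>) * ennreal \<eta> \<le> ennreal (1 / \<eta>) * V n \<omega>" by (intro mult_left_mono) auto
      moreover have "ennreal (1 / \<eta>) * ennreal \<eta> = 1" using \<eta> by (simp add: ennreal_mult'[symmetric])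
      ultimately show "1 \<le> ennreal (1 / \<eta>) * V n \<omega>" by simp
    qed
    hence "emeasure M {\<omega>\<in>space M. \<not> V n \<omega> \<le> ennreal \<eta>} \<le> emeasure M {\<omega>\<in>space M. 1 \<le> ennreal (1 / \<eta>) * V n \<omega>}" by (intro emeasure_mono) auto
    also have "\<dots> \<le> ennreal (1 / \<eta>) * (\<integral>\<^sup>+\<omega>. V n \<omega> * indicator (space M) \<omega> \<partial>M)" by (rule nn_integral_Markov_inequality) measurable
    also have "(\<integral>\<^sup>+\<omega>. V n \<omega> * indicator (space M) \<omega> \<partial>M) = (\<integral>\<^sup>+\<omega>. V n \<omega> \<partial>M)" by (intro nn_integral_cong) auto
    also have "ennreal (1 / \<eta>) * (\<integral>\<^sup>+\<omega>. V n \<omega> \<partial>M) < ennreal \<delta>" by (rule lt)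
    finally show "prob {\<omega>\<in>space M. \<not> V n \<omega> \<le> ennreal \<eta>} < \<delta>" by (simp add: emeasure_eq_measure ennreal_less_iff)
  qed
qed

section \<open>Laplace transform of the cost against that of the truncated quadratic
  functional\<close>

context paired_sample begin

lemma cost_nonneg: "(\<And>x. 0 \<le> \<rho> x) \<Longrightarrow> 0 \<le> cost \<rho> n \<omega>"
  unfolding cost_q by (intro mult_nonneg_nonneg Bochner_Integration.integral_nonneg) auto

text \<open>The error of local linearisation on the strip; its mean tends to 0 by
  \<open>local_difference_tendsto\<close>.\<close>

definition gap :: "(real \<Rightarrow> (real \<times> real) set) \<Rightarrow> (real \<Rightarrow> (real \<times> real) set) \<Rightarrow> real \<Rightarrow> nat \<Rightarrow> 'a \<Rightarrow> ennreal" where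
  "gap C C' L n \<omega> = (\<integral>\<^sup>+p. ennreal \<bar>max 0 (sqrt (real n) * (emp n (C (fst p)) \<omega> - emp n (C' (fst p + snd p / sqrt (real n))) \<omega>)) * indicator {..<sqrt (real n)} (snd p)
            - max 0 (sqrt (real n) * (emp n (C (fst p)) \<omega> - emp n (C' (fst p)) \<omega>) - f (fst p) * snd p)\<bar>
          * indicator ({-L..L} \<times> {0<..}) p \<partial>(lborel \<Otimes>\<^sub>M lborel))"

lemma gap_measurable:
  assumes [measurable]: "(\<lambda>(x, \<omega>). emp n (C x) \<omega>) \<in> borel_measurable (borel \<Otimes>\<^sub>M M)" "(\<lambda>(x, \<omega>). emp n (C' x) \<omega>) \<in> borel_measurable (borel \<Otimes>\<^sub>M M)"
  shows "gap C C' L n \<in> borel_measurable M"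
proof -
  interpret LL: sigma_finite_measure "lborel \<Otimes>\<^sub>M lborel :: (real \<times> real) measure"
    by (rule lborel_pair.sigma_finite_measure_axioms)
  show ?thesis unfolding gap_def[abs_def] by measurable
qed

text \<open>The estimate has to hold for all large \<open>L\<close>, because \<open>L\<close> is
  later also made large for the limit process. The four tail events fail with probability at most
  \<eta> each, the two separation and two linearisation events with at most
  \<open>\<eta> / 4\<close> each; this gives 5, and \<open>12 * l\<close> comes from
  \<open>cost_comparison\<close>.\<close>

lemma laplace_comparison:
  assumes x0: "0 < x0" and \<rho>: "\<And>x. \<bar>x\<bar> \<le> x0 \<Longrightarrow> \<rho> x = x\<^sup>2" and \<rho>0: "\<And>x. 0 \<le> \<rho> x"
    and [measurable]: "\<rho> \<in> borel_measurable borel" and l: "0 \<le> l" and \<eta>: "0 < \<eta>"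
  obtains L0 where "\<And>L. L0 \<le> L \<Longrightarrow> eventually (\<lambda>n. \<bar>expectation (\<lambda>\<omega>. exp (- (l * cost \<rho> n \<omega>))) - expectation (\<lambda>\<omega>. exp (- (l * Phi L n \<omega>)))\<bar> \<le> (5 + 12 * l) * \<eta>) sequentially"
proof -
  define d where "d = min x0 1"
  have d: "0 < d" "d \<le> 1" "d \<le> x0" using x0 by (auto simp: d_def)
  have FR1: "1 - F (- x) < 1" for x using F_pos[of "- x"] by simp
  have FRtop: "((\<lambda>x. 1 - F (- x)) \<longlongrightarrow> 1) at_top"
    using tendsto_diff[OF tendsto_const[of 1] filterlim_compose[OF F_bot filterlim_uminus_at_bot_at_top]] by simp
  let ?good = "\<lambda>C C' c n E. 1 - \<eta> \<le> prob E \<and> (\<forall>\<omega>\<in>E.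
      ennreal (real n) * (\<integral>\<^sup>+x. \<integral>\<^sup>+y. ennreal (max 0 (emp n (C x) \<omega> - emp n (C' y) \<omega>)) * indicator {(x, y). x < y \<and> y < c} (x, y) \<partial>lborel \<partial>lborel) \<le> ennreal \<eta> \<and>
      (\<forall>x<c. emp n (C x) \<omega> \<le> emp n (C' (x + d)) \<omega>))"
  obtain c1 where c1: "\<And>c n. c \<le> c1 \<Longrightarrow> 1 \<le> n \<Longrightarrow> \<exists>E\<in>events. ?good A B c n E"
    by (rule left_tail_bound[OF left_tail F_lt_1 F_top integrable_left sets_AB(1) mono_AB(1) joint_AB(1) law_AB(1) sets_AB(2) mono_AB(2) joint_AB(2) law_AB(2) \<eta> d(1)]) (assumption+, erule that)
  obtain c2 where c2: "\<And>c n. c \<le> c2 \<Longrightarrow> 1 \<le> n \<Longrightarrow> \<exists>E\<in>events. ?good B A c n E"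
    by (rule left_tail_bound[OF left_tail F_lt_1 F_top integrable_left sets_AB(2) mono_AB(2) joint_AB(2) law_AB(2) sets_AB(1) mono_AB(1) joint_AB(1) law_AB(1) \<eta> d(1)]) (assumption+, erule that)
  obtain c3 where c3: "\<And>c n. c \<le> c3 \<Longrightarrow> 1 \<le> n \<Longrightarrow> \<exists>E\<in>events. ?good B' A' c n E"
    by (rule left_tail_bound[OF right_tail FR1 FRtop integrable_right sets_AB(4) mono_AB(4) joint_AB(4) law_AB(4) sets_AB(3) mono_AB(3) joint_AB(3) law_AB(3) \<eta> d(1)]) (assumption+, erule that)
  obtain c4 where c4: "\<And>c n. c \<le> c4 \<Longrightarrow> 1 \<le> n \<Longrightarrow> \<exists>E\<in>events. ?good A' B' c n E"
    by (rule left_tail_bound[OF right_tail FR1 FRtop integrable_right sets_AB(3) mono_AB(3) joint_AB(3) law_AB(3) sets_AB(4) mono_AB(4) joint_AB(4) law_AB(4) \<eta> d(1)]) (assumption+, erule that)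
  show thesis
  proof (rule that[of "1 - min (min c1 c2) (min c3 c4)"])
    fix L assume "1 - min (min c1 c2) (min c3 c4) \<le> L"
    define c where "c = 1 - L"
    have c: "c \<le> c1" "c \<le> c2" "c \<le> c3" "c \<le> c4" and L: "L = 1 - c" using \<open>_ \<le> L\<close> by (auto simp: c_def)
    \<comment> \<open>The tail events give the shifted ordering for \<open>x < c\<close> and for
      \<open>x > - c - d\<close>. As \<open>d <= 1\<close>, the remaining points lie between
      \<open>- (|c| + 1)\<close> and \<open>|c| + 1\<close>.\<close>
    have "\<exists>b. (\<forall>n. b n \<in> events) \<and> (\<lambda>n. prob (b n)) \<longlonglongrightarrow> 0 \<and> (\<forall>n \<omega> x. \<omega> \<in> space M - b n \<longrightarrow> - (\<bar>c\<bar> + 1) \<le> x \<longrightarrow> x \<le> \<bar>c\<bar> + 1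
        \<longrightarrow> emp n (A x) \<omega> \<le> emp n (B (x + d)) \<omega>)"
    proof (rule eventually_separated[where R="\<bar>c\<bar> + 1" and A=A and B=B and F=F, OF sets_AB(1) mono_AB(1) law_AB(1) sets_AB(2) mono_AB(2) law_AB(2) F_strict d(1)])
      fix b assume "\<And>n. b n \<in> events" "(\<lambda>n. prob (b n)) \<longlonglongrightarrow> 0"
        "\<And>n \<omega> x. \<omega> \<in> space M - b n \<Longrightarrow> - (\<bar>c\<bar> + 1) \<le> x \<Longrightarrow> x \<le> \<bar>c\<bar> + 1 \<Longrightarrow> emp n (A x) \<omega> \<le> emp n (B (x + d)) \<omega>"
      thus ?thesis by (intro exI[of _ b]) simp
    qed
    then obtain b1 where b1': "(\<forall>n. b1 n \<in> events) \<and> (\<lambda>n. prob (b1 n)) \<longlonglongrightarrow> 0 \<and> (\<forall>n \<omega> x. \<omega> \<in> space M - b1 n \<longrightarrow> - (\<bar>c\<bar> + 1) \<le> x \<longrightarrow> x \<le> \<bar>c\<bar> + 1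
        \<longrightarrow> emp n (A x) \<omega> \<le> emp n (B (x + d)) \<omega>)"
      by (rule exE)
    have b1: "\<And>n. b1 n \<in> events" "(\<lambda>n. prob (b1 n)) \<longlonglongrightarrow> 0"
      using b1' by simp_all
    have sep_b1: "\<omega> \<in> space M - b1 n \<Longrightarrow> - (\<bar>c\<bar> + 1) \<le> x \<Longrightarrow> x \<le> \<bar>c\<bar> + 1 \<Longrightarrow> emp n (A x) \<omega> \<le> emp n (B (x + d)) \<omega>" for n \<omega> x
      using b1' by blast
    have "\<exists>b. (\<forall>n. b n \<in> events) \<and> (\<lambda>n. prob (b n)) \<longlonglongrightarrow> 0 \<and> (\<forall>n \<omega> x. \<omega> \<in> space M - b n \<longrightarrow> - (\<bar>c\<bar> + 1) \<le> x \<longrightarrow> x \<le> \<bar>c\<bar> + 1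
        \<longrightarrow> emp n (B x) \<omega> \<le> emp n (A (x + d)) \<omega>)"
    proof (rule eventually_separated[where R="\<bar>c\<bar> + 1" and A=B and B=A and F=F, OF sets_AB(2) mono_AB(2) law_AB(2) sets_AB(1) mono_AB(1) law_AB(1) F_strict d(1)])
      fix b assume "\<And>n. b n \<in> events" "(\<lambda>n. prob (b n)) \<longlonglongrightarrow> 0"
        "\<And>n \<omega> x. \<omega> \<in> space M - b n \<Longrightarrow> - (\<bar>c\<bar> + 1) \<le> x \<Longrightarrow> x \<le> \<bar>c\<bar> + 1 \<Longrightarrow> emp n (B x) \<omega> \<le> emp n (A (x + d)) \<omega>"
      thus ?thesis by (intro exI[of _ b]) simp
    qed
    then obtain b2 where b2': "(\<forall>n. b2 n \<in> events) \<and> (\<lambda>n. prob (b2 n)) \<longlonglongrightarrow> 0 \<and> (\<forall>n \<omega> x. \<omega> \<in> space M - b2 n \<longrightarrow> - (\<bar>c\<bar> + 1) \<le> x \<longrightarrow> x \<le> \<bar>c\<bar> + 1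
        \<longrightarrow> emp n (B x) \<omega> \<le> emp n (A (x + d)) \<omega>)"
      by (rule exE)
    have b2: "\<And>n. b2 n \<in> events" "(\<lambda>n. prob (b2 n)) \<longlonglongrightarrow> 0"
      using b2' by simp_all
    have sep_b2: "\<omega> \<in> space M - b2 n \<Longrightarrow> - (\<bar>c\<bar> + 1) \<le> x \<Longrightarrow> x \<le> \<bar>c\<bar> + 1 \<Longrightarrow> emp n (B x) \<omega> \<le> emp n (A (x + d)) \<omega>" for n \<omega> x
      using b2' by blast
    have gm: "gap A B L n \<in> borel_measurable M" "gap B A L n \<in> borel_measurable M" for n
      by (intro gap_measurable emp_AB_measurable)+
    have g1: "(\<lambda>n. \<integral>\<^sup>+\<omega>. gap A B L n \<omega> \<partial>M) \<longlonglongrightarrow> 0"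
      unfolding gap_def by (rule local_difference_tendsto[OF F_deriv f_cont f_pos sets_AB(1) joint_AB(1) law_AB(1) sets_AB(2) mono_AB(2) joint_AB(2) law_AB(2)])
    have g2: "(\<lambda>n. \<integral>\<^sup>+\<omega>. gap B A L n \<omega> \<partial>M) \<longlonglongrightarrow> 0"
      unfolding gap_def by (rule local_difference_tendsto[OF F_deriv f_cont f_pos sets_AB(2) joint_AB(2) law_AB(2) sets_AB(1) mono_AB(1) joint_AB(1) law_AB(1)])
    have \<eta>4: "0 < \<eta> / 4" using \<eta> by simp
    show "eventually (\<lambda>n. \<bar>expectation (\<lambda>\<omega>. exp (- (l * cost \<rho> n \<omega>))) - expectation (\<lambda>\<omega>. exp (- (l * Phi L n \<omega>)))\<bar> \<le> (5 + 12 * l) * \<eta>) sequentially"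
      using eventually_ge_at_top[of "1::nat"] order_tendstoD(2)[OF b1(2) \<eta>4] order_tendstoD(2)[OF b2(2) \<eta>4]
        eventually_small_probability[OF gm(1) g1 \<eta> \<eta>4] eventually_small_probability[OF gm(2) g2 \<eta> \<eta>4]
    proof eventually_elim
      fix n :: nat assume n: "1 \<le> n" and pb1: "prob (b1 n) < \<eta> / 4" and pb2: "prob (b2 n) < \<eta> / 4"
        and pg1: "prob {\<omega>\<in>space M. \<not> gap A B L n \<omega> \<le> ennreal \<eta>} < \<eta> / 4" and pg2: "prob {\<omega>\<in>space M. \<not> gap B A L n \<omega> \<le> ennreal \<eta>} < \<eta> / 4"
      obtain E1 where E1: "E1 \<in> events" "?good A B c n E1" using c1[OF c(1) n] by blast
      obtain E2 where E2: "E2 \<in> events" "?good B A c n E2" using c2[OF c(2) n] by blast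
      obtain E3 where E3: "E3 \<in> events" "?good B' A' c n E3" using c3[OF c(3) n] by blast
      obtain E4 where E4: "E4 \<in> events" "?good A' B' c n E4" using c4[OF c(4) n] by blast
      define G1 where "G1 = {\<omega>\<in>space M. \<not> gap A B L n \<omega> \<le> ennreal \<eta>}"
      define G2 where "G2 = {\<omega>\<in>space M. \<not> gap B A L n \<omega> \<le> ennreal \<eta>}"
      note [measurable] = gm
      have ev [measurable]: "E1 \<in> events" "E2 \<in> events" "E3 \<in> events" "E4 \<in> events" "b1 n \<in> events" "b2 n \<in> events" "G1 \<in> events" "G2 \<in> events"
        using E1 E2 E3 E4 b1 b2 unfolding G1_def G2_def by auto
      define E where "E = E1 \<inter> E2 \<inter> E3 \<inter> E4 - (b1 n \<union> b2 n \<union> G1 \<union> G2)"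
      have [measurable]: "E \<in> events" unfolding E_def by measurable
      have "space M - E \<subseteq> (space M - E1) \<union> ((space M - E2) \<union> ((space M - E3) \<union> ((space M - E4) \<union> (b1 n \<union> (b2 n \<union> (G1 \<union> G2))))))"
        by (auto simp: E_def)
      hence "prob (space M - E) \<le> prob ((space M - E1) \<union> ((space M - E2) \<union> ((space M - E3) \<union> ((space M - E4) \<union> (b1 n \<union> (b2 n \<union> (G1 \<union> G2)))))))"
        by (intro finite_measure_mono) auto
      also have "\<dots> \<le> prob (space M - E1) + (prob (space M - E2) + (prob (space M - E3) + (prob (space M - E4) + (prob (b1 n) + (prob (b2 n) + (prob G1 + prob G2))))))"
        by (intro order_trans[OF measure_Un_le] add_left_mono order_refl; measurable)
      also have "\<dots> \<le> 5 * \<eta>"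
        using E1 E2 E3 E4 pb1 pb2 pg1 pg2 by (simp add: prob_compl G1_def G2_def)
      finally have PE: "prob (space M - E) \<le> 5 * \<eta>" .
      have close: "\<bar>cost \<rho> n \<omega> - Phi L n \<omega>\<bar> \<le> 12 * \<eta>" if \<omega>: "\<omega> \<in> E" for \<omega>
      proof -
        have \<omega>M: "\<omega> \<in> space M" using \<omega> sets.sets_into_space[OF ev(1)] by (auto simp: E_def)
        have \<omega>E: "\<omega> \<in> E1" "\<omega> \<in> E2" "\<omega> \<in> E3" "\<omega> \<in> E4" and \<omega>b: "\<omega> \<in> space M - b1 n" "\<omega> \<in> space M - b2 n"
          and \<omega>g: "gap A B L n \<omega> \<le> ennreal \<eta>" "gap B A L n \<omega> \<le> ennreal \<eta>"
          using \<omega> \<omega>M by (auto simp: E_def G1_def G2_def)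
        have sepAB: "emp n (A x) \<omega> \<le> emp n (B (x + d)) \<omega>" for x
        proof -
          consider "x < c" | "- c - d < x" | "- (\<bar>c\<bar> + 1) \<le> x" "x \<le> \<bar>c\<bar> + 1" using d by linarith
          thus ?thesis
          proof cases
            case 1 thus ?thesis using E1 \<omega>E by blast
          next
            case 2
            \<comment> \<open>Taken at \<open>y = - (x + d)\<close>: passing to complements turns it
              into the ordering of \<open>A x\<close> and \<open>B (x + d)\<close>.\<close>
            have "\<forall>y<c. emp n (B' y) \<omega> \<le> emp n (A' (y + d)) \<omega>" using E3 \<omega>E by blast
            moreover have "- (x + d) < c" using 2 by linarith
            ultimately have "emp n (B' (- (x + d))) \<omega> \<le> emp n (A' (- (x + d) + d)) \<omega>" by blast
            thus ?thesis by (simp add: emp_reflect[OF n] add.commute)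
          next
            case 3 thus ?thesis using sep_b1[OF \<omega>b(1)] by simp
          qed
        qed
        have sepBA: "emp n (B x) \<omega> \<le> emp n (A (x + d)) \<omega>" for x
        proof -
          consider "x < c" | "- c - d < x" | "- (\<bar>c\<bar> + 1) \<le> x" "x \<le> \<bar>c\<bar> + 1" using d by linarith
          thus ?thesis
          proof cases
            case 1 thus ?thesis using E2 \<omega>E by blast
          next
            case 2
            have "\<forall>y<c. emp n (A' y) \<omega> \<le> emp n (B' (y + d)) \<omega>" using E4 \<omega>E by blast
            moreover have "- (x + d) < c" using 2 by linarith
            ultimately have "emp n (A' (- (x + d))) \<omega> \<le> emp n (B' (- (x + d) + d)) \<omega>" by blast
            thus ?thesis by (simp add: emp_reflect[OF n] add.commute)
          next
            case 3 thus ?thesis using sep_b2[OF \<omega>b(2)] by simp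
          qed
        qed
        show ?thesis unfolding L
          by (rule cost_comparison[OF n less_imp_le[OF \<eta>] d(2,3) \<rho> sepAB sepBA])
             (use E1 E2 E3 E4 \<omega>E \<omega>g \<omega>M in \<open>auto simp: gap_def L\<close>)
      qed
      have "\<bar>expectation (\<lambda>\<omega>. exp (- (l * cost \<rho> n \<omega>))) - expectation (\<lambda>\<omega>. exp (- (l * Phi L n \<omega>)))\<bar> \<le> prob (space M - E) + l * (12 * \<eta>)"
        by (rule laplace_difference_le) (use cost_measurable Phi_measurable cost_nonneg[OF \<rho>0] Phi_nonneg l \<eta> close in auto)
      also have "\<dots> \<le> (5 + 12 * l) * \<eta>" using PE by (simp add: algebra_simps)
      finally show "\<bar>expectation (\<lambda>\<omega>. exp (- (l * cost \<rho> n \<omega>))) - expectation (\<lambda>\<omega>. exp (- (l * Phi L n \<omega>)))\<bar> \<le> (5 + 12 * l) * \<eta>" .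
    qed
  qed
qed

section \<open>Finite-dimensional distributions of the difference process\<close>

definition g where "g x z = (indicator (A x) z - indicator (B x) z :: real)"

lemma g_measurable [measurable]: "g x \<in> borel_measurable borel"
  unfolding g_def[abs_def] by measurable

lemma g_bound: "\<bar>g x z\<bar> \<le> 1"
  by (auto simp: g_def indicator_def)

lemma indicator_integrable: "C \<in> sets borel \<Longrightarrow> integrable law (indicator C :: _ \<Rightarrow> real)"
  by (rule integrable_law[of _ 1]) (auto simp: indicator_def)

text \<open>\<open>g x\<close> is the contribution of one pair to \<open>D\<close>; equality of the
  two marginals makes it centred.\<close>

lemma g_mean: "(LINT z|law. g x z) = 0"
  unfolding g_def by (simp add: indicator_integrable law_AB)

text \<open>With \<open>H x y = measure law (A x \<inter> B y)\<close> this is the covariance of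
  \<open>D0\<close>, which identifies the limit.\<close>

lemma g_product: "(LINT z|law. g x z * g y z) = 2 * min (F x) (F y) - measure law (A x \<inter> B y) - measure law (A y \<inter> B x)"
proof -
  have e: "g x z * g y z = indicator (A (min x y)) z + indicator (B (min x y)) z - indicator (A x \<inter> B y) z - indicator (A y \<inter> B x) z" for z
    by (auto simp: g_def A_def B_def indicator_def min_def)
  have "F (min x y) = min (F x) (F y)" by (simp add: min_def F_le_iff)
  thus ?thesis unfolding e by (simp add: indicator_integrable law_AB Bochner_Integration.integrable_add Bochner_Integration.integrable_diff)
qed

lemma g_increment: "(LINT z|law. (g x z - g y z)\<^sup>2) \<le> 4 * \<bar>F x - F y\<bar>"
proof -
  have inc: "(LINT z|law. (g x z - g y z)\<^sup>2) \<le> 4 * (F y - F x)" if "x \<le> y" for x y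
  proof -
    interpret L: prob_space law by (rule prob_space_law)
    have "(LINT z|law. (g x z - g y z)\<^sup>2) \<le> (LINT z|law. 2 * indicator (A y - A x) z + 2 * indicator (B y - B x) z)"
    proof (rule integral_mono)
      show "integrable law (\<lambda>z. (g x z - g y z)\<^sup>2)"
        by (rule integrable_law[of _ 4]) (auto simp: g_def indicator_def power2_eq_square)
      show "integrable law (\<lambda>z. 2 * indicator (A y - A x) z + 2 * indicator (B y - B x) z :: real)"
        by (intro Bochner_Integration.integrable_add integrable_mult_right indicator_integrable) auto
      show "(g x z - g y z)\<^sup>2 \<le> 2 * indicator (A y - A x) z + 2 * indicator (B y - B x) z" for z
        using that by (auto simp: g_def A_def B_def indicator_def)
    qed
    also have "\<dots> = 2 * measure law (A y - A x) + 2 * measure law (B y - B x)"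
      by (simp add: indicator_integrable)
    also have "\<dots> = 4 * (F y - F x)" using mono_AB(1,2)[OF that]
      by (simp add: L.finite_measure_Diff law_AB)
    finally show ?thesis .
  qed
  show ?thesis
  proof (cases "x \<le> y")
    case True thus ?thesis using inc[OF True] F_le_iff[of x y] by simp
  next
    case False
    hence "y \<le> x" by simp
    thus ?thesis using inc[of y x] F_le_iff[of y x] by (simp add: power2_commute)
  qed
qed

text \<open>A linear combination of values of \<open>D\<close> is the empirical process at one
  bounded function, so the one-dimensional central limit theorem yields the joint limit.\<close>

lemma cemp_sum_D:
  assumes V: "finite V"
  shows "cemp n (\<lambda>z. \<Sum>v\<in>V. a v * g v z) \<omega> = (\<Sum>v\<in>V. a v * D n v \<omega>)"
proof -
  have ig: "integrable law (g v)" for v by (rule integrable_law[of _ 1]) (auto simp: g_bound)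
  have m: "(LINT z|law. (\<Sum>v\<in>V. a v * g v z)) = 0" using ig by (simp add: g_mean)
  have D: "D n v \<omega> = (\<Sum>i=1..n. g v (Z i \<omega>)) / sqrt (real n)" for v
  proof -
    have "(\<Sum>i=1..n. g v (Z i \<omega>)) = real n * (emp n (A v) \<omega> - emp n (B v) \<omega>)"
      by (cases "n = 0") (simp_all add: g_def emp_def sum_subtractf right_diff_distrib)
    hence "(\<Sum>i=1..n. g v (Z i \<omega>)) / sqrt (real n) = real n / sqrt (real n) * (emp n (A v) \<omega> - emp n (B v) \<omega>)" by simp
    thus ?thesis by (simp add: D_def real_div_sqrt)
  qed
  have "(\<Sum>i=1..n. \<Sum>v\<in>V. a v * g v (Z i \<omega>)) = (\<Sum>v\<in>V. a v * (\<Sum>i=1..n. g v (Z i \<omega>)))"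
    by (subst sum.swap) (simp add: sum_distrib_left)
  hence "cemp n (\<lambda>z. \<Sum>v\<in>V. a v * g v z) \<omega> = (\<Sum>v\<in>V. a v * (\<Sum>i=1..n. g v (Z i \<omega>))) / sqrt (real n)"
    unfolding cemp_def m by simp
  thus ?thesis unfolding D times_divide_eq_right sum_divide_distrib[symmetric] .
qed

lemma D_moments:
  shows "integrable M (\<lambda>\<omega>. (D n x \<omega>)\<^sup>2)" "expectation (\<lambda>\<omega>. (D n x \<omega>)\<^sup>2) \<le> 1"
    "expectation (\<lambda>\<omega>. (D n x \<omega> - D n y \<omega>)\<^sup>2) \<le> 4 * \<bar>F x - F y\<bar>"
proof -
  interpret L: prob_space law by (rule prob_space_law)
  have D1: "cemp n (g x) \<omega> = D n x \<omega>" for \<omega> using cemp_sum_D[of "{x}" n "\<lambda>_. 1" \<omega>] by simp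
  show "integrable M (\<lambda>\<omega>. (D n x \<omega>)\<^sup>2)"
    using second_moment_cemp_le(1)[of "g x" 1 n] by (simp add: D1 g_bound)
  have "expectation (\<lambda>\<omega>. (D n x \<omega>)\<^sup>2) \<le> (LINT z|law. (g x z)\<^sup>2)"
    using second_moment_cemp_le(2)[of "g x" 1 n] by (simp add: D1 g_bound)
  also have "\<dots> \<le> 1"
  proof (rule L.integral_le_const)
    show "integrable law (\<lambda>z. (g x z)\<^sup>2)" by (rule integrable_law[of _ 1]) (use g_bound in \<open>auto simp: abs_square_le_1\<close>)
    show "AE z in law. (g x z)\<^sup>2 \<le> 1" using g_bound by (auto simp: abs_square_le_1)
  qed
  finally show "expectation (\<lambda>\<omega>. (D n x \<omega>)\<^sup>2) \<le> 1" .
  show "expectation (\<lambda>\<omega>. (D n x \<omega> - D n y \<omega>)\<^sup>2) \<le> 4 * \<bar>F x - F y\<bar>"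
  proof (cases "x = y")
    case False
    have "cemp n (\<lambda>z. g x z - g y z) \<omega> = D n x \<omega> - D n y \<omega>" for \<omega>
      using cemp_sum_D[of "{x, y}" n "\<lambda>v. if v = x then 1 else -1" \<omega>] False by simp
    moreover have "expectation (\<lambda>\<omega>. (cemp n (\<lambda>z. g x z - g y z) \<omega>)\<^sup>2) \<le> (LINT z|law. (g x z - g y z)\<^sup>2)"
      by (rule second_moment_cemp_le(2)[of _ 2]) (auto simp: g_def indicator_def)
    ultimately show ?thesis using g_increment[of x y] by simp
  qed simp
qed

lemma D_char:
  assumes V: "finite V"
  shows "(\<lambda>n. CLINT \<omega>|M. iexp (\<Sum>v\<in>V. a v * D n v \<omega>)) \<longlonglongrightarrow>
    exp (- (\<Sum>v\<in>V. \<Sum>w\<in>V. a v * a w * (2 * min (F v) (F w) - measure law (A v \<inter> B w) - measure law (A w \<inter> B v))) / 2)"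
proof -
  have ig: "integrable law (g v)" for v by (rule integrable_law[of _ 1]) (auto simp: g_bound)
  have igg: "integrable law (\<lambda>z. g v z * g w z)" for v w
    by (rule integrable_law[of _ 1]) (auto simp: g_def indicator_def)
  have "(\<lambda>n. CLINT \<omega>|M. iexp (cemp n (\<lambda>z. \<Sum>v\<in>V. a v * g v z) \<omega>)) \<longlonglongrightarrow> exp (- (LINT z|law. (\<Sum>v\<in>V. a v * g v z)\<^sup>2) / 2)"
  proof (rule char_cemp_tendsto)
    show "(\<lambda>z. \<Sum>v\<in>V. a v * g v z) \<in> borel_measurable borel" by measurable
    show "(LINT z|law. (\<Sum>v\<in>V. a v * g v z)) = 0" using ig by (simp add: g_mean)
    fix z
    have "\<bar>\<Sum>v\<in>V. a v * g v z\<bar> \<le> (\<Sum>v\<in>V. \<bar>a v * g v z\<bar>)" by (rule sum_abs)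
    also have "\<dots> \<le> (\<Sum>v\<in>V. \<bar>a v\<bar>)" by (intro sum_mono) (simp add: abs_mult mult_left_le g_bound)
    finally show "\<bar>\<Sum>v\<in>V. a v * g v z\<bar> \<le> (\<Sum>v\<in>V. \<bar>a v\<bar>)" .
  qed
  moreover have "(LINT z|law. (\<Sum>v\<in>V. a v * g v z)\<^sup>2) = (\<Sum>v\<in>V. \<Sum>w\<in>V. a v * a w * (2 * min (F v) (F w) - measure law (A v \<inter> B w) - measure law (A w \<inter> B v)))"
  proof -
    have "(LINT z|law. (\<Sum>v\<in>V. a v * g v z)\<^sup>2) = (LINT z|law. (\<Sum>v\<in>V. \<Sum>w\<in>V. a v * a w * (g v z * g w z)))"
      unfolding power2_eq_square sum_product by (simp add: mult_ac)
    also have "\<dots> = (\<Sum>v\<in>V. \<Sum>w\<in>V. a v * a w * (LINT z|law. g v z * g w z))"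
      by (simp add: Bochner_Integration.integral_sum Bochner_Integration.integrable_sum igg)
    finally show ?thesis by (simp only: g_product)
  qed
  ultimately show ?thesis by (simp only: cemp_sum_D[OF V])
qed

text \<open>For given accuracy \<open>r\<close> three errors of at most \<open>r / 4\<close> are
  added: replacing the cost by its truncated quadratic form, letting \<open>n\<close> grow at fixed
  truncation, and removing the truncation in the limit.\<close>

lemma weak_convergence:
  assumes LP: "limit_process F N BX BY (\<lambda>x y. measure law (A x \<inter> B y))"
    and x0: "0 < x0" and \<rho>: "\<And>x. \<bar>x\<bar> \<le> x0 \<Longrightarrow> \<rho> x = x\<^sup>2" and \<rho>0: "\<And>x. 0 \<le> \<rho> x"
    and \<rho>m [measurable]: "\<rho> \<in> borel_measurable borel"
  shows "weak_conv_m (\<lambda>n. distr M borel (cost \<rho> n)) (distr N borel (\<lambda>\<omega>. LBINT u:{0<..<1}. (BX u \<omega> / h u - BY u \<omega> / h u)\<^sup>2))"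
proof -
  interpret P: limit_process F N BX BY "\<lambda>x y. measure law (A x \<inter> B y)" by fact
  define R where "R \<omega> = (LBINT u:{0<..<1}. (BX u \<omega> / h u - BY u \<omega> / h u)\<^sup>2)" for \<omega>
  have Rm: "R \<in> borel_measurable N" using P.limit_measurable by (simp add: R_def[abs_def])
  have R0: "0 \<le> R \<omega>" for \<omega> unfolding R_def set_lebesgue_integral_def by (intro Bochner_Integration.integral_nonneg) auto
  have trunc: "(\<lambda>n. LINT \<omega>|M. exp (- (l * Phi L n \<omega>))) \<longlonglongrightarrow> (LINT \<omega>|N. exp (- (l * (LBINT x:{-L..L}. (P.D0 x \<omega>)\<^sup>2 / f x))))"
    if l: "0 \<le> l" for l L
    unfolding Phi_def
  proof (rule laplace_truncated_tendsto[OF prob_space_axioms P.N.prob_space_axioms D_joint P.D0_joint F_strict F_cont less_imp_le[OF F_pos] less_imp_le[OF F_lt_1] f_cont f_pos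
        D_moments D_set_integrable P.D0_square_integrable P.D0_second_moment_le_1 P.D0_increment P.D0_set_integrable _ l])
    fix V :: "real set" and a :: "real \<Rightarrow> real" assume V: "finite V"
    show "(\<lambda>n. CLINT \<omega>|M. iexp (\<Sum>v\<in>V. a v * D n v \<omega>)) \<longlonglongrightarrow> (CLINT \<omega>|N. iexp (\<Sum>v\<in>V. a v * P.D0 v \<omega>))"
      using D_char[OF V, of a] by (simp only: P.D0_char[OF V])
  qed
  have "weak_conv_m (\<lambda>n. distr M borel (cost \<rho> n)) (distr N borel R)"
  proof (rule laplace_weak_conv[OF prob_space_axioms P.N.prob_space_axioms cost_measurable[OF \<rho>m] Rm cost_nonneg[OF \<rho>0] R0])
    fix k :: nat
    have l: "0 \<le> real k" by simp
    show "(\<lambda>n. LINT \<omega>|M. exp (- (real k * cost \<rho> n \<omega>))) \<longlonglongrightarrow> (LINT \<omega>|N. exp (- (real k * R \<omega>)))"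
    proof (rule LIMSEQ_I)
      fix r :: real assume r: "0 < r"
      define C where "C = 5 + 12 * real k"
      define \<eta> where "\<eta> = r / 4 / C"
      have C: "0 < C" by (simp add: C_def)
      have "0 < \<eta>" "C * \<eta> = r / 4" using r C by (auto simp: \<eta>_def)
      hence \<eta>: "0 < \<eta>" "(5 + 12 * real k) * \<eta> = r / 4" by (simp_all only: C_def)
      obtain L0 where L0: "\<And>L. L0 \<le> L \<Longrightarrow> eventually (\<lambda>n. \<bar>expectation (\<lambda>\<omega>. exp (- (real k * cost \<rho> n \<omega>))) - expectation (\<lambda>\<omega>. exp (- (real k * Phi L n \<omega>)))\<bar> \<le> (5 + 12 * real k) * \<eta>) sequentially"
        using laplace_comparison[OF x0 \<rho> \<rho>0 \<rho>m l \<eta>(1)] by blast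
      \<comment> \<open>One truncation \<open>j\<close> has to serve both the comparison with the
        cost and the approximation of the limit functional.\<close>
      have "eventually (\<lambda>j. L0 \<le> real j) sequentially" using filterlim_real_sequentially by (auto simp: filterlim_at_top)
      moreover have "eventually (\<lambda>j. \<bar>(LINT \<omega>|N. exp (- (real k * (LBINT x:{-real j..real j}. (P.D0 x \<omega>)\<^sup>2 / f x)))) - (LINT \<omega>|N. exp (- (real k * R \<omega>)))\<bar> < r / 4) sequentially"
        using tendstoD[OF P.laplace_limit[OF integrable_F l], of "r / 4"] r by (simp add: R_def dist_real_def)
      ultimately have "eventually (\<lambda>j. L0 \<le> real j \<and> \<bar>(LINT \<omega>|N. exp (- (real k * (LBINT x:{-real j..real j}. (P.D0 x \<omega>)\<^sup>2 / f x)))) - (LINT \<omega>|N. exp (- (real k * R \<omega>)))\<bar> < r / 4) sequentially"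
        by eventually_elim simp
      then obtain j where j: "L0 \<le> real j" "\<bar>(LINT \<omega>|N. exp (- (real k * (LBINT x:{-real j..real j}. (P.D0 x \<omega>)\<^sup>2 / f x)))) - (LINT \<omega>|N. exp (- (real k * R \<omega>)))\<bar> < r / 4"
        by (auto simp: eventually_sequentially)
      have "eventually (\<lambda>n. \<bar>(LINT \<omega>|M. exp (- (real k * Phi (real j) n \<omega>))) - (LINT \<omega>|N. exp (- (real k * (LBINT x:{-real j..real j}. (P.D0 x \<omega>)\<^sup>2 / f x))))\<bar> < r / 4) sequentially"
        using tendstoD[OF trunc[OF l, of "real j"], of "r / 4"] r by (simp add: dist_real_def)
      with L0[OF j(1)] have "eventually (\<lambda>n. norm ((LINT \<omega>|M. exp (- (real k * cost \<rho> n \<omega>))) - (LINT \<omega>|N. exp (- (real k * R \<omega>)))) < r) sequentially"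
      proof eventually_elim
        case (elim n)
        thus ?case using j(2) r unfolding \<eta>(2) real_norm_def by linarith
      qed
      thus "\<exists>n0. \<forall>n\<ge>n0. norm ((LINT \<omega>|M. exp (- (real k * cost \<rho> n \<omega>))) - (LINT \<omega>|N. exp (- (real k * R \<omega>)))) < r"
        by (simp add: eventually_sequentially)
    qed
  qed
  thus ?thesis by (simp add: R_def[abs_def])
qed

end

section \<open>Translation to the original formulation\<close>

lemma empirical_cdf_eq_average:
  "empirical_cdf X n \<omega> x = (\<Sum>i=1..n. indicator {..x} (X i \<omega>)) / real n"
proof -
  have "(\<Sum>i=1..n. indicator {..x} (X i \<omega>) :: real) = (\<Sum>i\<in>{1..n}. if X i \<omega> \<le> x then 1 else 0)"
    by (intro sum.cong) (auto simp: indicator_def)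
  also have "\<dots> = real (card {i\<in>{1..n}. X i \<omega> \<le> x})"
    by (simp add: sum.If_cases Int_def)
  finally show ?thesis by (simp add: empirical_cdf_def)
qed

theorem theorem11:
  fixes M :: "'a measure" and N :: "'b measure"
    and X Y :: "nat \<Rightarrow> 'a \<Rightarrow> real"
    and H :: "real \<Rightarrow> real \<Rightarrow> real" and F G :: "real \<Rightarrow> real"
    and BX BY :: "real \<Rightarrow> 'b \<Rightarrow> real"
    and c :: "real \<Rightarrow> real \<Rightarrow> real" and \<rho> :: "real \<Rightarrow> real" and x0 :: real
  assumes "prob_space M"
    and "prob_space.indep_vars M (\<lambda>_. borel) (\<lambda>i \<omega>. (X i \<omega>, Y i \<omega>)) {1..}"
    and "\<And>i. i \<ge> 1 \<Longrightarrow>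
           distr M borel (\<lambda>\<omega>. (X i \<omega>, Y i \<omega>)) = distr M borel (\<lambda>\<omega>. (X 1 \<omega>, Y 1 \<omega>))"
    and "\<And>x y. H x y = measure M {\<omega> \<in> space M. X 1 \<omega> \<le> x \<and> Y 1 \<omega> \<le> y}"
    and "F = cdf (distr M borel (X 1))"
    and "G = cdf (distr M borel (Y 1))"
    and "F = G"
    and "measure_support (distr M borel (X 1)) = UNIV"
    and "\<And>x. F differentiable (at x)"
    and "deriv F C1_differentiable_on UNIV"
    and "\<And>x. deriv F x > 0"
    and "bdd_above ((\<lambda>u. min u (1 - u) * \<bar>deriv (\<lambda>t. ln (density_quantile F t)) u\<bar>) ` {0<..<1})"
    and "((\<lambda>u. u / density_quantile F u) \<longlongrightarrow> 0) (at_right 0)"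
    and "((\<lambda>u. (1 - u) / density_quantile F u) \<longlongrightarrow> 0) (at_left 1)"
    and "set_integrable lborel {0<..<1} (\<lambda>u. u * (1 - u) / (density_quantile F u)\<^sup>2)"
    and "\<And>x y. c x y = \<rho> (x - y)"
    and "\<And>x. \<rho> x \<ge> 0"
    and "convex_on UNIV \<rho>"
    and "x0 > 0"
    and "\<And>x. \<bar>x\<bar> \<le> x0 \<Longrightarrow> \<rho> x = x\<^sup>2"
    and "prob_space N"
    and "jointly_centered_gaussian N {0<..<1} BX BY"
    and "brownian_bridge N BX"
    and "brownian_bridge N BY"
    and "\<And>u v. u \<in> {0<..<1} \<Longrightarrow> v \<in> {0<..<1} \<Longrightarrow>
           covariance N (BX u) (BY v) = H (gen_inverse F u) (gen_inverse G v) - u * v"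
  shows "weak_conv_m
    (\<lambda>n. distr M borel
       (\<lambda>\<omega>. real n * wasserstein_cost c (empirical_cdf X n \<omega>) (empirical_cdf Y n \<omega>)))
    (distr N borel
       (\<lambda>\<omega>. LBINT u:{0<..<1}. (BX u \<omega> / density_quantile F u - BY u \<omega> / density_quantile G u)\<^sup>2))"
proof -
  interpret M: prob_space M by fact
  define Z where "Z i \<omega> = (X i \<omega>, Y i \<omega>)" for i \<omega>
  have Z1: "(\<lambda>\<omega>. (X 1 \<omega>, Y 1 \<omega>)) \<in> borel_measurable M"
    using assms(2) by (auto simp: M.indep_vars_def)
  have XY [measurable]: "X 1 \<in> borel_measurable M" "Y 1 \<in> borel_measurable M"
    using measurable_compose[OF Z1 borel_measurable_continuous_onI[OF continuous_on_fst[OF continuous_on_id]]]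
      measurable_compose[OF Z1 borel_measurable_continuous_onI[OF continuous_on_snd[OF continuous_on_id]]]
    by simp_all
  interpret RX: real_distribution "distr M borel (X 1)" by (rule M.real_distribution_distr) measurable
  interpret S: iid_sample M borel Z
  proof
    show "M.indep_vars (\<lambda>_. borel) Z {1..}" using assms(2) by (simp only: Z_def[abs_def])
    show "distr M borel (Z i) = distr M borel (Z 1)" if "1 \<le> i" for i
      using assms(3)[OF that] by (simp only: Z_def[abs_def])
  qed
  have law: "measure S.law C = measure M {\<omega>\<in>space M. (X 1 \<omega>, Y 1 \<omega>) \<in> C}" if "C \<in> sets borel" for C
    unfolding S.law_def using that Z1
    by (subst measure_distr) (auto simp: Z_def[abs_def] vimage_def Int_def conj_commute)
  have F: "F x = measure M {\<omega>\<in>space M. X 1 \<omega> \<le> x}" for x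
    unfolding assms(5) cdf_def by (subst measure_distr[OF XY(1)]) (auto simp: vimage_def Int_def conj_commute)
  have G: "F x = measure M {\<omega>\<in>space M. Y 1 \<omega> \<le> x}" for x
    unfolding assms(7) assms(6) cdf_def by (subst measure_distr[OF XY(2)]) (auto simp: vimage_def Int_def conj_commute)
  obtain \<gamma> where \<gamma>: "\<And>u. u \<in> {0<..<1} \<Longrightarrow> min u (1 - u) * \<bar>deriv (\<lambda>t. ln (density_quantile F t)) u\<bar> \<le> \<gamma>"
    using assms(12) unfolding bdd_above_def by blast
  interpret C: smooth_cdf F
    using assms(9,10,11) RX.cdf_lim_at_bot RX.cdf_lim_at_top_prob by unfold_locales (simp_all add: assms(5))
  \<comment> \<open>The maximum with 0 supplies the sign that the locale asks of its
    constant.\<close>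
  interpret R: regular_cdf F "max 0 \<gamma>"
    using assms(13,14,15) \<gamma> by unfold_locales (auto simp: le_max_iff_disj)
  have closed: "{z :: real \<times> real. fst z \<le> x} \<in> sets borel" "{z :: real \<times> real. snd z \<le> x} \<in> sets borel" for x
    by (auto intro!: borel_closed closed_Collect_le continuous_intros)
  interpret P: paired_sample M Z F "max 0 \<gamma>"
  proof
    show "measure S.law {z. fst z \<le> x} = F x" "measure S.law {z. snd z \<le> x} = F x" for x
      using law[OF closed(1)] law[OF closed(2)] F G by simp_all
  qed
  have H: "H x y = measure S.law (P.A x \<inter> P.B y)" for x y
    using law[of "P.A x \<inter> P.B y"] by (simp add: assms(4)) (simp add: P.A_def P.B_def)
  have LP: "limit_process F N BX BY (\<lambda>x y. measure S.law (P.A x \<inter> P.B y))"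
    using assms(21-25) unfolding limit_process_def limit_process_axioms_def
    by (auto simp: C.smooth_cdf_axioms H assms(7)[symmetric])
  \<comment> \<open>Finite convex functions on the line are continuous; this gives the measurability
    of the cost.\<close>
  have "continuous_on UNIV \<rho>" using assms(18) by (intro convex_on_continuous) auto
  hence \<rho>m: "\<rho> \<in> borel_measurable borel" by (rule borel_measurable_continuous_onI)
  have emp: "(\<lambda>x. S.emp n (P.A x) \<omega>) = empirical_cdf X n \<omega>" "(\<lambda>x. S.emp n (P.B x) \<omega>) = empirical_cdf Y n \<omega>" for n \<omega>
    by (auto simp: fun_eq_iff empirical_cdf_eq_average S.emp_def P.A_def P.B_def Z_def indicator_def)
  have "P.cost \<rho> n = (\<lambda>\<omega>. real n * wasserstein_cost c (empirical_cdf X n \<omega>) (empirical_cdf Y n \<omega>))" for n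
    by (simp add: P.cost_def[abs_def] wasserstein_cost_def emp assms(16))
  thus ?thesis
    using P.weak_convergence[OF LP assms(19,20,17) \<rho>m] by (simp add: assms(7)[symmetric])
qed

end
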